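(* Let $M$ be a compact Riemannian manifold of class $C^1$ and let $f:M\to M$ be an Anosov diffeomorphism. Then for every $\beta>0$ there exists a Markov partition of $M$ for $f$ with diameter less than $\beta$.
   Context: Let $\mathrm{dist}$ be the Riemannian distance on $M$. A $C^1$ diffeomorphism $f:M\to M$ is Anosov if there are constants $K>0$, $0<\lambda<1$ and subspaces $S_x,U_x\subset T_xM$ ($x\in M$), depending continuously on $x$, with $S_x\oplus U_x=T_xM$, $f'_xS_x=S_{f(x)}$, $f'_xU_x=U_{f(x)}$, $\|(f^n)'_x s\|\le K\lambda^n\|s\|$ for all $s\in S_x$, $n\ge 0$, and $\|(f^n)'_x u\|\le K\lambda^{-n}\|u\|$ for all $u\in U_x$, $n\le 0$. Every Anosov diffeomorphism is expansive: there is $\rho>0$ (a constant of expansivity) such that $\mathrm{dist}(f^nx,f^ny)\le\rho$ for all $n\in\mathbb{Z}$ if and only if $x=y$. Fix such a $\rho$. For $\eta>0$ and $x\in M$ put $W^s_\eta(x)=\{y\in M:\mathrm{dist}(f^nx,f^ny)\le\eta\ \forall n\ge 0\}$ and $W^u_\eta(x)=\{y\in M:\mathrm{dist}(f^nx,f^ny)\le\eta\ \forall n\le 0\}$. Fix $\epsilon$ with $0<\epsilon<\rho/4$, and fix $\delta>0$ such that whenever $\mathrm{dist}(x,y)<\delta$ the set $W^s_\epsilon(x)\cap W^u_\epsilon(y)$ consists of exactly one point, denoted $[x,y]$ (such a $\delta$ exists). A rectangle is a nonempty set $R\subset M$ of diameter less than $\delta$ such that $[x,y]\in R$ for all $x,y\in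 R$. It is proper if $R=\overline{\mathrm{int}\,R}$. For $x\in R$, $W^s(x,R)=W^s_\epsilon(x)\cap R$ and $W^u(x,R)=W^u_\epsilon(x)\cap R$. A partition of $M$ by closed sets is a finite cover of $M$ by closed sets with pairwise disjoint interiors; its diameter is the maximum of the diameters of its members. A Markov partition for $f$ is a partition of $M$ by closed sets consisting of proper rectangles $R_1,\dots,R_m$ such that for all $i,j$ and all $x\in\mathrm{int}\,R_i\cap f^{-1}(\mathrm{int}\,R_j)$: (i) $f(W^s(x,R_i))\subset W^s(fx,R_j)$ and (ii) $f(W^u(x,R_i))\supset W^u(fx,R_j)$. *)

theory Defs
  imports "HOL-Analysis.Analysis"
begin

section \<open>Compact manifolds of class \<open>C\<^sup>1\<close>\<close>

text \<open>
  The manifold is the whole type \<open>'m\<close>.  The model space \<open>'e\<close> is an arbitrary finite-dimensional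
  real normed space: a normed space is finite-dimensional iff it is of class
  \<^class>\<open>heine_borel\<close>.  Unlike \<^class>\<open>euclidean_space\<close> this allows dimension 0.
  A chart is a pair of a domain and a coordinate map.
  Second countability is implied by compactness.
\<close>

type_synonym ('m, 'e) chart = "'m set \<times> ('m \<Rightarrow> 'e)"

definition chart_inv :: "('m, 'e) chart \<Rightarrow> 'e \<Rightarrow> 'm" where
  "chart_inv c = inv_into (fst c) (snd c)"

definition is_chart :: "('m::topological_space, 'e::topological_space) chart \<Rightarrow> bool" where
  "is_chart c \<longleftrightarrow> open (fst c) \<and> open (snd c ` fst c) \<and>
     homeomorphism (fst c) (snd c ` fst c) (snd c) (chart_inv c)"

text \<open>Only used for open \<open>S\<close>.\<close>

definition C1_on :: "'a::real_normed_vector set \<Rightarrow> ('a \<Rightarrow> 'b::real_normed_vector) \<Rightarrow> bool" where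
  "C1_on S h \<longleftrightarrow> (\<exists>h' :: 'a \<Rightarrow> 'a \<Rightarrow>\<^sub>L 'b.
     (\<forall>x\<in>S. (h has_derivative blinfun_apply (h' x)) (at x)) \<and> continuous_on S h')"

definition C1_atlas ::
    "('m::topological_space, 'e::{real_normed_vector, heine_borel}) chart set \<Rightarrow> bool" where
  "C1_atlas A \<longleftrightarrow>
     (\<forall>c\<in>A. is_chart c) \<and> (\<Union>c\<in>A. fst c) = UNIV \<and>
     (\<forall>c\<in>A. \<forall>d\<in>A. C1_on (snd c ` (fst c \<inter> fst d)) (snd d \<circ> chart_inv c))"

definition C1_map ::
    "('m::topological_space, 'e::{real_normed_vector, heine_borel}) chart set \<Rightarrow> ('m \<Rightarrow> 'm) \<Rightarrow> bool"
where
  "C1_map A f \<longleftrightarrow> continuous_on UNIV f \<and>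
     (\<forall>c\<in>A. \<forall>d\<in>A. C1_on (snd c ` (fst c \<inter> f -` fst d)) (snd d \<circ> f \<circ> chart_inv c))"

definition C1_diffeo ::
    "('m::topological_space, 'e::{real_normed_vector, heine_borel}) chart set \<Rightarrow> ('m \<Rightarrow> 'm) \<Rightarrow> bool"
where
  "C1_diffeo A f \<longleftrightarrow> bij f \<and> C1_map A f \<and> C1_map A (inv f)"


section \<open>Tangent spaces and derivatives\<close>

text \<open>
  Each point \<open>x\<close> is given a preferred chart \<open>chart_at A x\<close>, and the tangent space at \<open>x\<close>
  is the model space \<open>'e\<close>, a tangent vector being written in the coordinates of that chart.
  As the preferred chart may jump with \<open>x\<close>, continuity of a field of tangent vectors, subspaces
  or forms is never expressed in these coordinates but always in those of one fixed chart \<open>c\<close>: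
  \<open>tangent_of A c x v\<close> is the tangent vector at \<open>x\<close> whose coordinates with respect to \<open>c\<close> are \<open>v\<close>.
\<close>

definition chart_at :: "('m, 'e) chart set \<Rightarrow> 'm \<Rightarrow> ('m, 'e) chart" where
  "chart_at A x = (SOME c. c \<in> A \<and> x \<in> fst c)"

definition tangent_of ::
    "('m, 'e::real_normed_vector) chart set \<Rightarrow> ('m, 'e) chart \<Rightarrow> 'm \<Rightarrow> 'e \<Rightarrow> 'e" where
  "tangent_of A c x = frechet_derivative (snd (chart_at A x) \<circ> chart_inv c) (at (snd c x))"

definition tangent_map ::
    "('m, 'e::real_normed_vector) chart set \<Rightarrow> ('m \<Rightarrow> 'm) \<Rightarrow> 'm \<Rightarrow> 'e \<Rightarrow> 'e" where
  "tangent_map A f x =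
     frechet_derivative (snd (chart_at A (f x)) \<circ> f \<circ> chart_inv (chart_at A x))
       (at (snd (chart_at A x) x))"

text \<open>A field of tangent subspaces is continuous if locally it is spanned by a continuous frame.\<close>

definition continuous_subspace_field ::
    "('m::topological_space, 'e::real_normed_vector) chart set \<Rightarrow> ('m \<Rightarrow> 'e set) \<Rightarrow> bool" where
  "continuous_subspace_field A S \<longleftrightarrow>
     (\<forall>x0. \<exists>c\<in>A. \<exists>V k. \<exists>Y :: nat \<Rightarrow> 'm \<Rightarrow> 'e.
        open V \<and> x0 \<in> V \<and> V \<subseteq> fst c \<and> (\<forall>i<k. continuous_on V (Y i)) \<and>
        (\<forall>x\<in>V. inj_on (\<lambda>i. Y i x) {..<k} \<and> independent ((\<lambda>i. Y i x) ` {..<k}) \<and>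
               S x = tangent_of A c x ` span ((\<lambda>i. Y i x) ` {..<k})))"


section \<open>Riemannian metrics and the Riemannian distance\<close>

text \<open>
  On a \<open>C\<^sup>1\<close> manifold the tangent bundle is only a continuous bundle, so a Riemannian metric is
  a continuous field of inner products.
\<close>

definition riemannian_metric ::
    "('m::topological_space, 'e::real_normed_vector) chart set \<Rightarrow> ('m \<Rightarrow> 'e \<Rightarrow> 'e \<Rightarrow> real) \<Rightarrow> bool"
where
  "riemannian_metric A g \<longleftrightarrow>
     (\<forall>x. bilinear (g x) \<and> (\<forall>v w. g x v w = g x w v) \<and> (\<forall>v. v \<noteq> 0 \<longrightarrow> g x v v > 0)) \<and>
     (\<forall>c\<in>A. \<forall>v w. continuous_on (fst c) (\<lambda>x. g x (tangent_of A c x v) (tangent_of A c x w)))"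

definition tangent_norm :: "('m \<Rightarrow> 'e \<Rightarrow> 'e \<Rightarrow> real) \<Rightarrow> 'm \<Rightarrow> 'e \<Rightarrow> real" where
  "tangent_norm g x v = sqrt (g x v v)"

definition C1_curve_on ::
    "('m::topological_space, 'e::real_normed_vector) chart set \<Rightarrow> real \<Rightarrow> real \<Rightarrow> (real \<Rightarrow> 'm) \<Rightarrow> bool"
where
  "C1_curve_on A a b \<gamma> \<longleftrightarrow> continuous_on {a..b} \<gamma> \<and>
     (\<forall>c\<in>A. \<exists>w. continuous_on ({a..b} \<inter> \<gamma> -` fst c) w \<and>
        (\<forall>t\<in>{a..b} \<inter> \<gamma> -` fst c. ((snd c \<circ> \<gamma>) has_vector_derivative w t) (at t within {a..b})))"

definition piecewise_C1_curve ::
    "('m::topological_space, 'e::real_normed_vector) chart set \<Rightarrow> (real \<Rightarrow> 'm) \<Rightarrow> bool" where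
  "piecewise_C1_curve A \<gamma> \<longleftrightarrow>
     (\<exists>(k::nat) t. t 0 = 0 \<and> t k = 1 \<and>
        (\<forall>i<k. t i < t (Suc i) \<and> C1_curve_on A (t i) (t (Suc i)) \<gamma>))"

text \<open>
  The velocity is the two-sided derivative, which is meaningful except at the finitely many
  endpoints of the pieces; these do not affect the integral defining the length.
\<close>

definition velocity ::
    "('m, 'e::real_normed_vector) chart set \<Rightarrow> (real \<Rightarrow> 'm) \<Rightarrow> real \<Rightarrow> 'e" where
  "velocity A \<gamma> t = vector_derivative (snd (chart_at A (\<gamma> t)) \<circ> \<gamma>) (at t)"

definition curve_length ::
    "('m, 'e::real_normed_vector) chart set \<Rightarrow> ('m \<Rightarrow> 'e \<Rightarrow> 'e \<Rightarrow> real) \<Rightarrow> (real \<Rightarrow> 'm) \<Rightarrow> ennreal"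
where
  "curve_length A g \<gamma> =
     (\<integral>\<^sup>+ t\<in>{0..1}. ennreal (tangent_norm g (\<gamma> t) (velocity A \<gamma> t)) \<partial>lborel)"

text \<open>
  The manifold need not be connected; points in different components have distance \<open>\<infinity>\<close>
  (the infimum of the empty set).
\<close>

definition riemannian_dist ::
    "('m::topological_space, 'e::real_normed_vector) chart set \<Rightarrow> ('m \<Rightarrow> 'e \<Rightarrow> 'e \<Rightarrow> real) \<Rightarrow>
     'm \<Rightarrow> 'm \<Rightarrow> ennreal"
where
  "riemannian_dist A g x y =
     (INF \<gamma>\<in>{\<gamma>. piecewise_C1_curve A \<gamma> \<and> \<gamma> 0 = x \<and> \<gamma> 1 = y}. curve_length A g \<gamma>)"


section \<open>Anosov diffeomorphisms\<close>

definition iter :: "('m \<Rightarrow> 'm) \<Rightarrow> int \<Rightarrow> 'm \<Rightarrow> 'm" where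
  "iter f n = (if n \<ge> 0 then f ^^ nat n else inv f ^^ nat (- n))"

definition anosov ::
    "('m::topological_space, 'e::{real_normed_vector, heine_borel}) chart set \<Rightarrow>
     ('m \<Rightarrow> 'e \<Rightarrow> 'e \<Rightarrow> real) \<Rightarrow> ('m \<Rightarrow> 'm) \<Rightarrow> bool"
where
  "anosov A g f \<longleftrightarrow> C1_diffeo A f \<and>
     (\<exists>(K::real) (\<kappa>::real) S U.
        K > 0 \<and> 0 < \<kappa> \<and> \<kappa> < 1 \<and>
        (\<forall>x. subspace (S x) \<and> subspace (U x) \<and>
             S x \<inter> U x = {0} \<and> {s + u | s u. s \<in> S x \<and> u \<in> U x} = UNIV) \<and>
        continuous_subspace_field A S \<and> continuous_subspace_field A U \<and>
        (\<forall>x. tangent_map A f x ` S x = S (f x) \<and> tangent_map A f x ` U x = U (f x)) \<and>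
        (\<forall>x. \<forall>s\<in>S x. \<forall>n\<ge>0.
           tangent_norm g (iter f n x) (tangent_map A (iter f n) x s)
             \<le> K * \<kappa> powi n * tangent_norm g x s) \<and>
        (\<forall>x. \<forall>u\<in>U x. \<forall>n\<le>0.
           tangent_norm g (iter f n x) (tangent_map A (iter f n) x u)
             \<le> K * \<kappa> powi (- n) * tangent_norm g x u))"


section \<open>Local product structure, rectangles and Markov partitions\<close>

text \<open>In this section \<open>d\<close> stands for the (extended) distance on \<open>'m\<close>.\<close>

definition expansivity_constant ::
    "('m \<Rightarrow> 'm \<Rightarrow> ennreal) \<Rightarrow> ('m \<Rightarrow> 'm) \<Rightarrow> real \<Rightarrow> bool" where
  "expansivity_constant d f \<rho> \<longleftrightarrow> \<rho> > 0 \<and>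
     (\<forall>x y. (\<forall>n. d (iter f n x) (iter f n y) \<le> ennreal \<rho>) \<longleftrightarrow> x = y)"

definition Ws :: "('m \<Rightarrow> 'm \<Rightarrow> ennreal) \<Rightarrow> ('m \<Rightarrow> 'm) \<Rightarrow> real \<Rightarrow> 'm \<Rightarrow> 'm set" where
  "Ws d f \<eta> x = {y. \<forall>n\<ge>0. d (iter f n x) (iter f n y) \<le> ennreal \<eta>}"

definition Wu :: "('m \<Rightarrow> 'm \<Rightarrow> ennreal) \<Rightarrow> ('m \<Rightarrow> 'm) \<Rightarrow> real \<Rightarrow> 'm \<Rightarrow> 'm set" where
  "Wu d f \<eta> x = {y. \<forall>n\<le>0. d (iter f n x) (iter f n y) \<le> ennreal \<eta>}"

definition local_product ::
    "('m \<Rightarrow> 'm \<Rightarrow> ennreal) \<Rightarrow> ('m \<Rightarrow> 'm) \<Rightarrow> real \<Rightarrow> real \<Rightarrow> bool" where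
  "local_product d f \<epsilon> \<delta> \<longleftrightarrow> \<delta> > 0 \<and>
     (\<forall>x y. d x y < ennreal \<delta> \<longrightarrow> (\<exists>!z. z \<in> Ws d f \<epsilon> x \<inter> Wu d f \<epsilon> y))"

definition bracket ::
    "('m \<Rightarrow> 'm \<Rightarrow> ennreal) \<Rightarrow> ('m \<Rightarrow> 'm) \<Rightarrow> real \<Rightarrow> 'm \<Rightarrow> 'm \<Rightarrow> 'm" where
  "bracket d f \<epsilon> x y = (THE z. z \<in> Ws d f \<epsilon> x \<inter> Wu d f \<epsilon> y)"

definition ediameter :: "('m \<Rightarrow> 'm \<Rightarrow> ennreal) \<Rightarrow> 'm set \<Rightarrow> ennreal" where
  "ediameter d R = (SUP x\<in>R. SUP y\<in>R. d x y)"

definition rectangle ::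
    "('m \<Rightarrow> 'm \<Rightarrow> ennreal) \<Rightarrow> ('m \<Rightarrow> 'm) \<Rightarrow> real \<Rightarrow> real \<Rightarrow> 'm set \<Rightarrow> bool" where
  "rectangle d f \<epsilon> \<delta> R \<longleftrightarrow> R \<noteq> {} \<and> ediameter d R < ennreal \<delta> \<and>
     (\<forall>x\<in>R. \<forall>y\<in>R. bracket d f \<epsilon> x y \<in> R)"

definition proper :: "'m::topological_space set \<Rightarrow> bool" where
  "proper R \<longleftrightarrow> R = closure (interior R)"

definition Ws_in ::
    "('m \<Rightarrow> 'm \<Rightarrow> ennreal) \<Rightarrow> ('m \<Rightarrow> 'm) \<Rightarrow> real \<Rightarrow> 'm \<Rightarrow> 'm set \<Rightarrow> 'm set" where
  "Ws_in d f \<epsilon> x R = Ws d f \<epsilon> x \<inter> R"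

definition Wu_in ::
    "('m \<Rightarrow> 'm \<Rightarrow> ennreal) \<Rightarrow> ('m \<Rightarrow> 'm) \<Rightarrow> real \<Rightarrow> 'm \<Rightarrow> 'm set \<Rightarrow> 'm set" where
  "Wu_in d f \<epsilon> x R = Wu d f \<epsilon> x \<inter> R"

definition closed_partition :: "'m::topological_space set set \<Rightarrow> bool" where
  "closed_partition P \<longleftrightarrow> finite P \<and> \<Union>P = UNIV \<and> (\<forall>R\<in>P. closed R) \<and>
     (\<forall>R\<in>P. \<forall>R'\<in>P. R \<noteq> R' \<longrightarrow> interior R \<inter> interior R' = {})"

definition partition_diameter :: "('m \<Rightarrow> 'm \<Rightarrow> ennreal) \<Rightarrow> 'm set set \<Rightarrow> ennreal" where
  "partition_diameter d P = Max (ediameter d ` P)"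

definition markov_partition ::
    "('m::topological_space \<Rightarrow> 'm \<Rightarrow> ennreal) \<Rightarrow> ('m \<Rightarrow> 'm) \<Rightarrow> real \<Rightarrow> real \<Rightarrow> 'm set set \<Rightarrow> bool"
where
  "markov_partition d f \<epsilon> \<delta> P \<longleftrightarrow> closed_partition P \<and>
     (\<forall>R\<in>P. rectangle d f \<epsilon> \<delta> R \<and> proper R) \<and>
     (\<forall>R\<in>P. \<forall>R'\<in>P. \<forall>x \<in> interior R \<inter> f -` interior R'.
        f ` Ws_in d f \<epsilon> x R \<subseteq> Ws_in d f \<epsilon> (f x) R' \<and>
        f ` Wu_in d f \<epsilon> x R \<supseteq> Wu_in d f \<epsilon> (f x) R')"

end

theory Submission
  imports Defs
begin

text \<open>
  The manifold is covered by small closed rectangles that \<open>f\<close> maps across each other in the Markov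
  way, and the overlaps of this cover are then cut apart without destroying the Markov property.

  The cover comes from symbolic dynamics.  Take a fine finite net \<open>P\<close> and the bi-infinite
  pseudo-orbits \<open>q\<close> of \<open>f\<close> in \<open>P\<close>.  By compactness, expansivity is uniform (\<open>uniform_expansive\<close>), so a
  point whose orbit stays within \<open>3 / 4 * \<rho>\<close> of a sufficiently fine pseudo-orbit stays within any
  prescribed \<open>e\<close> of it (\<open>shadowing_improves\<close>).  Let \<open>T s\<close> consist of the points that \<open>e\<close>-shadow some
  \<open>q\<close> with \<open>q 0 = s\<close>.  If \<open>x\<close> shadows \<open>q\<close>, \<open>y\<close> shadows \<open>q'\<close> and \<open>q 0 = q' 0\<close>, then the bracket of
  \<open>x\<close> and \<open>y\<close> roughly shadows the future of \<open>q\<close> glued to the past of \<open>q'\<close>, hence \<open>e\<close>-shadows it.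
  So \<open>T s\<close> is a rectangle, and the same gluing gives the inclusions for stable and unstable
  slices from \<open>T (q 0)\<close> to \<open>T (q 1)\<close> (\<open>markov_cover_exists\<close>).  The sets \<open>T s\<close> cover because every true
  orbit shadows a pseudo-orbit in \<open>P\<close>.

  For the cut, think of a rectangle \<open>T k\<close> near \<open>x\<close> as a product of an unstable and a stable slice.  One
  coordinate of \<open>x\<close> lies in the corresponding slice iff \<open>[x, p] \<in> T k\<close>, the other one iff
  \<open>[p, x] \<in> T k\<close>, and this does not depend on \<open>p \<in> T k\<close>.  The type of \<open>x\<close> records which \<open>T j\<close>
  contain \<open>x\<close>, and both coordinate conditions for all \<open>T k\<close> that meet such a \<open>T j\<close>.  The set of points of one
  type is closed under the bracket (\<open>cell_type_br\<close>), and if \<open>x\<close> and \<open>y\<close> have the same type and \<open>y\<close> is on the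
  local stable set of \<open>x\<close>, then \<open>f x\<close> and \<open>f y\<close> have the same type (\<open>cell_type_f\<close>); the unstable half
  is the stable half for the inverse of \<open>f\<close>.  Thus the finitely many cells satisfy the Markov property pointwise.
  They are Boolean combinations of closed sets, so their interiors have dense union, and
  the closures of the nonempty interiors are the Markov partition (\<open>markov_partition_exists\<close>).

  All of this takes place in a compact Hausdorff space with a continuous metric.  That
  the Riemannian distance is one follows from a comparison with the norm in a chart
  (\<open>chart_norm_bounds\<close>): the upper bound makes coordinate segments short, and the
  lower bound gives a positive length to every curve that leaves a coordinate ball.
\<close>

section \<open>Bilinear forms on a finite-dimensional space\<close>

text \<open>
  The members of a finite \<open>1 / 2\<close>-net \<open>B\<close> of the unit ball span the
  space with controlled coefficients: approximate \<open>v\<close> by a nearby member, double the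
  error and repeat. The resulting geometric series of members of \<open>B\<close> is collected
  into one coefficient for each member. The coefficients are neither unique nor linear in
  \<open>v\<close>, but bounds are all that is asked of them.
\<close>

lemma bounded_coordinates:
  "\<exists>B. finite B \<and> (\<forall>v :: 'e::{real_normed_vector, heine_borel}.
     \<exists>a. v = (\<Sum>b\<in>B. a b *\<^sub>R b) \<and> (\<forall>b\<in>B. \<bar>a b\<bar> \<le> 2 * norm v))"
proof -
  have "compact (cball (0 :: 'e) 1)"
    by (simp add: compact_eq_bounded_closed)
  moreover have "cball 0 1 \<subseteq> (\<Union>b\<in>cball (0 :: 'e) 1. ball b (1 / 2))" by force
  ultimately obtain B where B: "finite B" "B \<subseteq> cball (0 :: 'e) 1" "cball 0 1 \<subseteq> (\<Union>b\<in>B. ball b (1 / 2))"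
    by (metis compactE_image open_ball)
  have "\<forall>v. \<exists>b. norm v \<le> 1 \<longrightarrow> b \<in> B \<and> norm (v - b) \<le> 1 / 2"
    using B(3) by (force simp: subset_iff dist_norm norm_minus_commute)
  then obtain r where r: "\<And>v. norm v \<le> 1 \<Longrightarrow> r v \<in> B" "\<And>v. norm v \<le> 1 \<Longrightarrow> norm (v - r v) \<le> 1 / 2"
    by metis
  have unit: "\<exists>a. v = (\<Sum>b\<in>B. a b *\<^sub>R b) \<and> (\<forall>b\<in>B. \<bar>a b\<bar> \<le> 2)" if v: "norm v \<le> 1" for v :: 'e
  proof -
    define u where "u = rec_nat v (\<lambda>_ x. 2 *\<^sub>R (x - r x))"
    have u0: "u 0 = v" and uS: "u (Suc n) = 2 *\<^sub>R (u n - r (u n))" for n by (simp_all add: u_def)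
    have u1: "norm (u n) \<le> 1" for n
    proof (induction n)
      case (Suc n) then show ?case using r(2)[of "u n"] by (simp add: uS)
    qed (use v u0 in simp)
    have part: "v = (\<Sum>k<n. (1 / 2) ^ k *\<^sub>R r (u k)) + (1 / 2) ^ n *\<^sub>R u n" for n
    proof (induction n)
      case (Suc n)
      have "(1 / 2) ^ Suc n *\<^sub>R u (Suc n) = (1 / 2) ^ n *\<^sub>R (u n - r (u n))" by (simp add: uS)
      then show ?case using Suc by (simp add: algebra_simps)
    qed (simp add: u0)
    define a where "a b = (\<Sum>k. (1 / 2) ^ k * of_bool (r (u k) = b) :: real)" for b
    have summ: "summable (\<lambda>k. (1 / 2) ^ k * of_bool (r (u k) = b) :: real)" for b
      by (rule summable_comparison_test'[of "\<lambda>k. (1 / 2) ^ k" 0]) (auto simp: summable_geometric_iff)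
    have "(\<lambda>n. \<Sum>b\<in>B. (\<Sum>k<n. (1 / 2) ^ k * of_bool (r (u k) = b)) *\<^sub>R b) \<longlonglongrightarrow> (\<Sum>b\<in>B. a b *\<^sub>R b)"
      unfolding a_def by (intro tendsto_sum tendsto_scaleR tendsto_const summable_LIMSEQ summ)
    moreover have "(\<Sum>b\<in>B. (\<Sum>k<n. (1 / 2) ^ k * of_bool (r (u k) = b)) *\<^sub>R b) = v - (1 / 2) ^ n *\<^sub>R u n" for n
    proof -
      have "(\<Sum>b\<in>B. (\<Sum>k<n. (1 / 2) ^ k * of_bool (r (u k) = b)) *\<^sub>R b) =
          (\<Sum>k<n. \<Sum>b\<in>B. ((1 / 2) ^ k * of_bool (r (u k) = b)) *\<^sub>R b)"
        by (simp only: scaleR_left.sum) (rule sum.swap)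
      also have "\<dots> = (\<Sum>k<n. (1 / 2) ^ k *\<^sub>R r (u k))"
      proof (rule sum.cong[OF refl])
        fix k
        have "(\<Sum>b\<in>B. ((1 / 2) ^ k * of_bool (r (u k) = b)) *\<^sub>R b) =
            (\<Sum>b\<in>B. if r (u k) = b then (1 / 2) ^ k *\<^sub>R b else 0)"
          by (intro sum.cong) auto
        also have "\<dots> = (1 / 2) ^ k *\<^sub>R r (u k)"
          using B(1) r(1)[OF u1] by (simp add: sum.delta)
        finally show "(\<Sum>b\<in>B. ((1 / 2) ^ k * of_bool (r (u k) = b)) *\<^sub>R b) = (1 / 2) ^ k *\<^sub>R r (u k)" .
      qed
      also have "\<dots> = v - (1 / 2) ^ n *\<^sub>R u n" using part[of n] by (simp add: algebra_simps)
      finally show ?thesis .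
    qed
    moreover have "(\<lambda>n. v - (1 / 2) ^ n *\<^sub>R u n) \<longlonglongrightarrow> v - 0"
    proof (rule tendsto_diff[OF tendsto_const Lim_null_comparison])
      show "\<forall>\<^sub>F n in sequentially. norm ((1 / 2) ^ n *\<^sub>R u n) \<le> (1 / 2) ^ n"
        using u1 by (auto intro!: always_eventually mult_left_le)
      show "(\<lambda>n. (1 / 2) ^ n :: real) \<longlonglongrightarrow> 0" by (rule LIMSEQ_power_zero) simp
    qed
    ultimately have "v = (\<Sum>b\<in>B. a b *\<^sub>R b)"
      by (simp add: LIMSEQ_unique)
    moreover have "\<bar>a b\<bar> \<le> 2" for b
    proof -
      have "a b \<le> (\<Sum>k. (1 / 2) ^ k)" unfolding a_def
        by (intro suminf_le summ) (auto simp: summable_geometric_iff)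
      moreover have "0 \<le> a b" unfolding a_def by (intro suminf_nonneg summ) auto
      ultimately show ?thesis by (simp add: suminf_geometric)
    qed
    ultimately show ?thesis by blast
  qed
  have "\<exists>a. v = (\<Sum>b\<in>B. a b *\<^sub>R b) \<and> (\<forall>b\<in>B. \<bar>a b\<bar> \<le> 2 * norm v)" for v :: 'e
  proof (cases "v = 0")
    case True
    then show ?thesis by (intro exI[of _ "\<lambda>_. 0"]) auto
  next
    case False
    obtain a where a: "v /\<^sub>R norm v = (\<Sum>b\<in>B. a b *\<^sub>R b)" "\<forall>b\<in>B. \<bar>a b\<bar> \<le> 2"
      using unit[of "v /\<^sub>R norm v"] False by auto
    have "v = norm v *\<^sub>R (v /\<^sub>R norm v)" using False by simp
    also have "\<dots> = (\<Sum>b\<in>B. (norm v * a b) *\<^sub>R b)" unfolding a(1) by (simp add: scaleR_sum_right)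
    finally show ?thesis using a(2) by (intro exI[of _ "\<lambda>b. norm v * a b"]) (auto simp: abs_mult mult.commute[of _ "norm v"] intro!: mult_left_mono)
  qed
  with B(1) show ?thesis by blast
qed

text \<open>
  A single finite \<open>B\<close> serves all bilinear forms. A continuous field of forms is
  therefore bounded locally uniformly as soon as its finitely many values on \<open>B\<close> are
  continuous.
\<close>

lemma bilinear_form_bound:
  "\<exists>B. finite B \<and> (\<forall>(h :: 'e::{real_normed_vector, heine_borel} \<Rightarrow> 'e \<Rightarrow> real) v w. bilinear h \<longrightarrow>
     \<bar>h v w\<bar> \<le> 4 * (\<Sum>b\<in>B. \<Sum>c\<in>B. \<bar>h b c\<bar>) * norm v * norm w)"
proof -
  obtain B where B: "finite B" and coord: "\<And>v :: 'e. \<exists>a. v = (\<Sum>b\<in>B. a b *\<^sub>R b) \<and> (\<forall>b\<in>B. \<bar>a b\<bar> \<le> 2 * norm v)"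
    using bounded_coordinates by blast
  have "\<bar>h v w\<bar> \<le> 4 * (\<Sum>b\<in>B. \<Sum>c\<in>B. \<bar>h b c\<bar>) * norm v * norm w"
    if h: "bilinear h" for h :: "'e \<Rightarrow> 'e \<Rightarrow> real" and v w
  proof -
    obtain a where a: "v = (\<Sum>b\<in>B. a b *\<^sub>R b)" "\<forall>b\<in>B. \<bar>a b\<bar> \<le> 2 * norm v"
      using coord by blast
    obtain a' where a': "w = (\<Sum>b\<in>B. a' b *\<^sub>R b)" "\<forall>b\<in>B. \<bar>a' b\<bar> \<le> 2 * norm w"
      using coord by blast
    have "h v w = h (\<Sum>b\<in>B. a b *\<^sub>R b) (\<Sum>b\<in>B. a' b *\<^sub>R b)"
      using a(1) a'(1) by simp
    also have "\<dots> = (\<Sum>(b, c)\<in>B \<times> B. h (a b *\<^sub>R b) (a' c *\<^sub>R c))"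
      by (rule bilinear_sum[OF h])
    also have "\<dots> = (\<Sum>b\<in>B. \<Sum>c\<in>B. a b * a' c * h b c)"
      by (simp add: sum.cartesian_product bilinear_lmul[OF h] bilinear_rmul[OF h] case_prod_unfold mult_ac)
    finally have "\<bar>h v w\<bar> \<le> (\<Sum>b\<in>B. \<Sum>c\<in>B. \<bar>a b * a' c * h b c\<bar>)"
      using order_trans[OF sum_abs sum_mono[OF sum_abs]] by simp
    also have "\<dots> \<le> (\<Sum>b\<in>B. \<Sum>c\<in>B. (2 * norm v) * (2 * norm w) * \<bar>h b c\<bar>)"
    proof (intro sum_mono)
      fix b c assume "b \<in> B" "c \<in> B"
      then have "\<bar>a b\<bar> * \<bar>a' c\<bar> \<le> (2 * norm v) * (2 * norm w)"
        using a(2) a'(2) by (intro mult_mono) auto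
      then show "\<bar>a b * a' c * h b c\<bar> \<le> (2 * norm v) * (2 * norm w) * \<bar>h b c\<bar>"
        unfolding abs_mult by (rule mult_right_mono) simp
    qed
    also have "\<dots> = 4 * (\<Sum>b\<in>B. \<Sum>c\<in>B. \<bar>h b c\<bar>) * norm v * norm w"
      by (simp add: sum_distrib_left sum_distrib_right mult_ac)
    finally show ?thesis .
  qed
  with B show ?thesis by blast
qed

section \<open>The Riemannian norm in a chart\<close>

locale riemannian =
  fixes A :: "('m::t2_space, 'e::{real_normed_vector, heine_borel}) chart set"
    and g :: "'m \<Rightarrow> 'e \<Rightarrow> 'e \<Rightarrow> real"
  assumes atlas: "C1_atlas A" and metric: "riemannian_metric A g"
begin

lemma charts: "c \<in> A \<Longrightarrow> is_chart c"
  using atlas by (simp add: C1_atlas_def)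

lemma open_dom: "c \<in> A \<Longrightarrow> open (fst c)" and open_ran: "c \<in> A \<Longrightarrow> open (snd c ` fst c)"
  using charts by (auto simp: is_chart_def)

lemma continuous_chart: "c \<in> A \<Longrightarrow> continuous_on (fst c) (snd c)"
  and continuous_chart_inv: "c \<in> A \<Longrightarrow> continuous_on (snd c ` fst c) (chart_inv c)"
  and chart_inv_chart [simp]: "\<lbrakk>c \<in> A; x \<in> fst c\<rbrakk> \<Longrightarrow> chart_inv c (snd c x) = x"
  and chart_chart_inv [simp]: "\<lbrakk>c \<in> A; p \<in> snd c ` fst c\<rbrakk> \<Longrightarrow> snd c (chart_inv c p) = p"
  and chart_inv_dom: "\<lbrakk>c \<in> A; p \<in> snd c ` fst c\<rbrakk> \<Longrightarrow> chart_inv c p \<in> fst c"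
  using charts unfolding is_chart_def homeomorphism_def by blast+

lemma open_chart_image:
  assumes "c \<in> A" "open V"
  shows "open (snd c ` (fst c \<inter> V))"
proof -
  have "snd c ` (fst c \<inter> V) = chart_inv c -` V \<inter> snd c ` fst c"
    using assms(1) by (auto simp: chart_inv_dom)
  then show ?thesis
    using continuous_on_open_vimage[OF open_ran[OF assms(1)]] continuous_chart_inv assms by metis
qed

lemma ex_chart: "\<exists>c\<in>A. x \<in> fst c"
  using atlas by (auto simp: C1_atlas_def)

lemma chart_at: "chart_at A x \<in> A" "x \<in> fst (chart_at A x)"
  using someI_ex[of "\<lambda>c. c \<in> A \<and> x \<in> fst c"] ex_chart[of x] unfolding chart_at_def by blast+

lemma transition:
  assumes "c \<in> A" "c' \<in> A"
  shows "\<exists>D :: 'e \<Rightarrow> 'e \<Rightarrow>\<^sub>L 'e. continuous_on (snd c ` (fst c \<inter> fst c')) D \<and>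
    (\<forall>p\<in>snd c ` (fst c \<inter> fst c'). (snd c' \<circ> chart_inv c has_derivative blinfun_apply (D p)) (at p))"
  using atlas assms unfolding C1_atlas_def C1_on_def by blast

lemma transition_has_derivative:
  assumes "c \<in> A" "c' \<in> A" "x \<in> fst c" "x \<in> fst c'"
  shows "(snd c' \<circ> chart_inv c has_derivative
    frechet_derivative (snd c' \<circ> chart_inv c) (at (snd c x))) (at (snd c x))"
proof -
  have "snd c' \<circ> chart_inv c differentiable at (snd c x)"
    using transition[OF assms(1,2)] assms(3,4) unfolding differentiable_def by blast
  then show ?thesis by (simp add: frechet_derivative_works)
qed

lemma tangent_of_has_derivative:
  assumes "c \<in> A" "x \<in> fst c"
  shows "(snd (chart_at A x) \<circ> chart_inv c has_derivative tangent_of A c x) (at (snd c x))"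
  unfolding tangent_of_def by (rule transition_has_derivative) (use assms chart_at in auto)

lemma linear_tangent_of: "\<lbrakk>c \<in> A; x \<in> fst c\<rbrakk> \<Longrightarrow> linear (tangent_of A c x)"
  using tangent_of_has_derivative has_derivative_linear by blast

text \<open>
  The transition maps of the two charts are inverse to each other, so their derivatives are.
\<close>

lemma tangent_of_eq_0:
  assumes c: "c \<in> A" "x \<in> fst c" and v: "tangent_of A c x v = 0"
  shows "v = 0"
proof -
  let ?c' = "chart_at A x"
  let ?E = "frechet_derivative (snd c \<circ> chart_inv ?c') (at (snd ?c' x))"
  have E: "(snd c \<circ> chart_inv ?c' has_derivative ?E) (at (snd ?c' x))"
    by (rule transition_has_derivative) (use c chart_at in auto)
  have "((snd c \<circ> chart_inv ?c') \<circ> (snd ?c' \<circ> chart_inv c) has_derivative ?E \<circ> tangent_of A c x) (at (snd c x))"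
    by (rule diff_chain_at[OF tangent_of_has_derivative[OF c]]) (use c E in simp)
  moreover have "((snd c \<circ> chart_inv ?c') \<circ> (snd ?c' \<circ> chart_inv c) has_derivative id) (at (snd c x))"
  proof (rule has_derivative_transform_within_open[of id id])
    show "(id has_derivative id) (at (snd c x))" by (rule has_derivative_id)
    show "open (snd c ` (fst c \<inter> fst ?c'))"
      using c chart_at open_dom by (intro open_chart_image) auto
    show "snd c x \<in> snd c ` (fst c \<inter> fst ?c')" using c chart_at by blast
    show "id p = ((snd c \<circ> chart_inv ?c') \<circ> (snd ?c' \<circ> chart_inv c)) p" if "p \<in> snd c ` (fst c \<inter> fst ?c')" for p
      using that c chart_at by auto
  qed
  ultimately have "?E \<circ> tangent_of A c x = id" by (rule has_derivative_unique)
  then have "v = ?E (tangent_of A c x v)" by (metis comp_apply id_apply)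
  also have "\<dots> = 0" using v linear_0[OF has_derivative_linear[OF E]] by simp
  finally show ?thesis .
qed

text \<open>
  The metric in the coordinates of one fixed chart, where its dependence on the point is
  continuous.
\<close>

definition form :: "('m, 'e) chart \<Rightarrow> 'm \<Rightarrow> 'e \<Rightarrow> 'e \<Rightarrow> real" where
  "form c x v w = g x (tangent_of A c x v) (tangent_of A c x w)"

lemma bilinear_g: "bilinear (g x)"
  using metric by (simp add: riemannian_metric_def)

lemma bilinear_form:
  assumes "c \<in> A" "x \<in> fst c"
  shows "bilinear (form c x)"
  using linear_compose[OF linear_tangent_of[OF assms]] bilinear_g[of x]
  unfolding bilinear_def form_def o_def by auto

lemma form_pos: "\<lbrakk>c \<in> A; x \<in> fst c; v \<noteq> 0\<rbrakk> \<Longrightarrow> 0 < form c x v v"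
  using metric tangent_of_eq_0[of c x v] unfolding riemannian_metric_def form_def by blast

lemma continuous_form: "c \<in> A \<Longrightarrow> continuous_on (fst c) (\<lambda>x. form c x v w)"
  using metric by (auto simp: riemannian_metric_def form_def)

end

lemma open_preimage:
  "\<lbrakk>open S; continuous_on S h; open V\<rbrakk> \<Longrightarrow> open (h -` V \<inter> S)"
  using continuous_on_open_vimage by blast

context riemannian
begin

lemma form_bound:
  assumes c: "c \<in> A" "x0 \<in> fst c"
  shows "\<exists>V C. open V \<and> x0 \<in> V \<and> V \<subseteq> fst c \<and> 0 < C \<and>
    (\<forall>x\<in>V. \<forall>v w. \<bar>form c x v w\<bar> \<le> C * norm v * norm w)"
proof -
  obtain B where B: "\<And>(h :: 'e \<Rightarrow> 'e \<Rightarrow> real) v w. bilinear h \<Longrightarrow>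
      \<bar>h v w\<bar> \<le> 4 * (\<Sum>b\<in>B. \<Sum>c\<in>B. \<bar>h b c\<bar>) * norm v * norm w"
    using bilinear_form_bound by metis
  define K where "K x = (\<Sum>b\<in>B. \<Sum>b'\<in>B. \<bar>form c x b b'\<bar>)" for x
  have K: "continuous_on (fst c) K"
    unfolding K_def by (intro continuous_on_sum continuous_on_rabs continuous_form c)
  have K0: "0 \<le> K x" for x unfolding K_def by (intro sum_nonneg) auto
  let ?V = "K -` {..<K x0 + 1} \<inter> fst c"
  have "open ?V"
    by (intro open_preimage open_dom c K open_lessThan)
  moreover have "\<bar>form c x v w\<bar> \<le> 4 * (K x0 + 1) * norm v * norm w" if "x \<in> ?V" for x v w
  proof -
    have "\<bar>form c x v w\<bar> \<le> 4 * K x * norm v * norm w"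
      unfolding K_def using that c by (intro B bilinear_form) auto
    also have "\<dots> \<le> 4 * (K x0 + 1) * norm v * norm w"
      using that by (intro mult_right_mono) auto
    finally show ?thesis .
  qed
  ultimately show ?thesis
    using c K0[of x0] by (intro exI[of _ ?V] exI[of _ "4 * (K x0 + 1)"]) auto
qed

lemma form_algebra:
  assumes "c \<in> A" "x \<in> fst c"
  shows "form c x v v - form c x w w = form c x (v - w) v + form c x w (v - w)"
    and "form c x (r *\<^sub>R v) (r *\<^sub>R v) = r\<^sup>2 * form c x v v"
  using bilinear_form[OF assms]
  by (simp_all add: bilinear_lsub bilinear_rsub bilinear_lmul bilinear_rmul power2_eq_square)

definition chart_norm :: "('m, 'e) chart \<Rightarrow> 'm \<Rightarrow> 'e \<Rightarrow> real" where
  "chart_norm c x v = tangent_norm g x (tangent_of A c x v)"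

lemma chart_norm_eq: "chart_norm c x v = sqrt (form c x v v)"
  by (simp add: chart_norm_def tangent_norm_def form_def)

text \<open>
  For the lower bound, cover the unit sphere by balls around finitely many \<open>u\<close>, so
  small that the form changes by at most a quarter of its value \<open>\<mu> u\<close> at
  \<open>u\<close>. Keeping the form at these \<open>u\<close> above \<open>\<mu> u / 2\<close> is
  an open condition on the point and bounds the form from below on the whole sphere.
\<close>

lemma chart_norm_bounds:
  assumes c: "c \<in> A" "x0 \<in> fst c"
  shows "\<exists>V m M. open V \<and> x0 \<in> V \<and> V \<subseteq> fst c \<and> 0 < m \<and> 0 < M \<and>
    (\<forall>x\<in>V. \<forall>v. m * norm v \<le> chart_norm c x v \<and> chart_norm c x v \<le> M * norm v)"
proof -
  obtain V C where V: "open V" "x0 \<in> V" "V \<subseteq> fst c" and C: "0 < C"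
    "\<And>x v w. x \<in> V \<Longrightarrow> \<bar>form c x v w\<bar> \<le> C * norm v * norm w"
    using form_bound[OF c] by blast
  define \<mu> where "\<mu> u = form c x0 u u" for u
  have \<mu>: "0 < \<mu> u" if "norm u = 1" for u
  proof -
    have "u \<noteq> 0" using that by force
    then show ?thesis unfolding \<mu>_def by (rule form_pos[OF c])
  qed
  have "closed {u :: 'e. norm u = 1}"
    by (intro closed_Collect_eq continuous_on_norm continuous_on_id continuous_on_const)
  moreover have "sphere (0 :: 'e) 1 = {u. norm u = 1}" by auto
  moreover have "bounded (sphere (0 :: 'e) 1)"
    by (rule bounded_subset[OF bounded_cball[of 0 1]]) auto
  ultimately have cpt: "compact (sphere (0 :: 'e) 1)" by (simp add: compact_eq_bounded_closed)
  have cov: "sphere 0 1 \<subseteq> (\<Union>u\<in>sphere (0 :: 'e) 1. ball u (\<mu> u / (8 * C)))"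
    using \<mu> C by (fastforce intro!: divide_pos_pos)
  obtain D where D: "D \<subseteq> sphere (0 :: 'e) 1" "finite D" "sphere 0 1 \<subseteq> (\<Union>u\<in>D. ball u (\<mu> u / (8 * C)))"
    by (rule compactE_image[OF cpt open_ball cov])
  \<comment> \<open>The element 1 covers the case of dimension 0, where the sphere is empty.\<close>
  define m where "m = Min (insert 1 ((\<lambda>u. \<mu> u / 4) ` D))"
  have m0: "0 < m" using D(1,2) \<mu> by (auto simp: m_def subset_iff)
  have m1: "m \<le> \<mu> u / 4" if "u \<in> D" for u
    unfolding m_def using D(2) that by (intro Min_le) auto
  note m = m0 m1
  let ?V = "V \<inter> (\<Inter>u\<in>D. (\<lambda>x. form c x u u) -` {\<mu> u / 2<..} \<inter> fst c)"
  have "open ?V"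
    by (intro open_Int[OF V(1) open_INT[OF D(2)]] ballI open_preimage open_dom c continuous_form open_greaterThan)
  moreover have "x0 \<in> ?V" using V c \<mu> D(1) by (force simp: \<mu>_def)
  moreover have "m * (norm v)\<^sup>2 \<le> form c x v v" if x: "x \<in> ?V" for x v
  proof (cases "v = 0")
    case True
    then show ?thesis using bilinear_lzero[OF bilinear_form, of c x 0] c x V by auto
  next
    case False
    have xc: "x \<in> fst c" using x V by blast
    define w where "w = v /\<^sub>R norm v"
    have w: "norm w = 1" "v = norm v *\<^sub>R w" using False by (simp_all add: w_def)
    then obtain u where u: "u \<in> D" "dist u w < \<mu> u / (8 * C)" using D(3) by (force simp: subset_iff)
    then have u1: "norm u = 1" using D(1) by auto
    have "\<bar>form c x w w - form c x u u\<bar> \<le> \<bar>form c x (w - u) w\<bar> + \<bar>form c x u (w - u)\<bar>"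
      using form_algebra(1)[OF c(1) xc] by (metis abs_triangle_ineq)
    also have "\<dots> \<le> C * norm (w - u) * norm w + C * norm u * norm (w - u)"
      using C(2) x by (intro add_mono) auto
    also have "\<dots> = 2 * C * dist u w" using w(1) u1 by (simp add: dist_norm norm_minus_commute)
    also have "\<dots> \<le> 2 * C * (\<mu> u / (8 * C))" using u(2) C(1) by (intro mult_left_mono) auto
    also have "\<dots> = \<mu> u / 4" using C(1) by simp
    finally have "\<bar>form c x w w - form c x u u\<bar> \<le> \<mu> u / 4" .
    moreover have "x \<in> (\<lambda>x. form c x u u) -` {\<mu> u / 2<..}" using x u(1) by blast
    then have "\<mu> u / 2 < form c x u u" by simp
    ultimately have "m \<le> form c x w w" using m(2)[OF u(1)] by linarith
    then have "m * (norm v)\<^sup>2 \<le> form c x w w * (norm v)\<^sup>2" by (rule mult_right_mono) simp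
    also have "\<dots> = form c x v v" using form_algebra(2)[OF c(1) xc, of "norm v" w] w(2) by (metis mult.commute)
    finally show ?thesis .
  qed
  then have "sqrt m * norm v \<le> chart_norm c x v" if "x \<in> ?V" for x v
    using that real_sqrt_le_mono[of "m * (norm v)\<^sup>2"] by (force simp: chart_norm_eq real_sqrt_mult)
  moreover have "chart_norm c x v \<le> sqrt C * norm v" if "x \<in> ?V" for x v
  proof -
    have "form c x v v \<le> C * (norm v)\<^sup>2"
      using C(2)[of x v v] that by (simp add: power2_eq_square mult.assoc)
    from real_sqrt_le_mono[OF this] show ?thesis by (simp add: chart_norm_eq real_sqrt_mult)
  qed
  ultimately show ?thesis using m C V
    by (intro exI[of _ ?V] exI[of _ "sqrt m"] exI[of _ "sqrt C"]) auto
qed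

lemma continuous_chart_norm:
  fixes \<gamma> :: "real \<Rightarrow> 'm"
  assumes c: "c \<in> A" and \<gamma>: "continuous_on S \<gamma>" "\<gamma> ` S \<subseteq> fst c" and w: "continuous_on S w"
  shows "continuous_on S (\<lambda>t. chart_norm c (\<gamma> t) (w t))"
proof -
  have "continuous_on S (\<lambda>t. form c (\<gamma> t) (w t) (w t))"
    unfolding continuous_on
  proof
    fix t assume t: "t \<in> S"
    let ?F = "at t within S"
    have tc: "\<gamma> t \<in> fst c" using \<gamma> t by blast
    obtain V C where V: "open V" "\<gamma> t \<in> V" "V \<subseteq> fst c" and C: "0 < C"
      "\<And>x v w. x \<in> V \<Longrightarrow> \<bar>form c x v w\<bar> \<le> C * norm v * norm w"
      using form_bound[OF c tc] by blast
    have lim\<gamma>: "(\<gamma> \<longlongrightarrow> \<gamma> t) ?F" and limw: "(w \<longlongrightarrow> w t) ?F"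
      using \<gamma> w t by (auto simp: continuous_on)
    have ev: "\<forall>\<^sub>F s in ?F. \<gamma> s \<in> V" using lim\<gamma> V by (auto dest: topological_tendstoD)
    have "continuous_on S (\<lambda>s. form c (\<gamma> s) (w t) (w t))"
      using continuous_on_compose2[OF continuous_form[OF c] \<gamma>] .
    then have 1: "((\<lambda>s. form c (\<gamma> s) (w t) (w t)) \<longlongrightarrow> form c (\<gamma> t) (w t) (w t)) ?F"
      using t by (auto simp: continuous_on)
    have 2: "((\<lambda>s. form c (\<gamma> s) (w s) (w s) - form c (\<gamma> s) (w t) (w t)) \<longlongrightarrow> 0) ?F"
    proof (rule Lim_null_comparison)
      show "\<forall>\<^sub>F s in ?F. norm (form c (\<gamma> s) (w s) (w s) - form c (\<gamma> s) (w t) (w t))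
          \<le> C * norm (w s - w t) * norm (w s) + C * norm (w t) * norm (w s - w t)"
        using ev
      proof eventually_elim
        case (elim s)
        have "norm (form c (\<gamma> s) (w s) (w s) - form c (\<gamma> s) (w t) (w t))
            \<le> \<bar>form c (\<gamma> s) (w s - w t) (w s)\<bar> + \<bar>form c (\<gamma> s) (w t) (w s - w t)\<bar>"
          using form_algebra(1)[OF c, of "\<gamma> s" "w s" "w t"] elim V by (simp add: subset_iff)
        also have "\<dots> \<le> C * norm (w s - w t) * norm (w s) + C * norm (w t) * norm (w s - w t)"
          using C(2)[OF elim] by (intro add_mono)
        finally show ?case .
      qed
      have "((\<lambda>s. C * norm (w s - w t) * norm (w s) + C * norm (w t) * norm (w s - w t)) \<longlongrightarrow>
          C * norm (w t - w t) * norm (w t) + C * norm (w t) * norm (w t - w t)) ?F"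
        by (intro tendsto_add tendsto_mult tendsto_norm tendsto_diff tendsto_const limw)
      then show "((\<lambda>s. C * norm (w s - w t) * norm (w s) + C * norm (w t) * norm (w s - w t)) \<longlongrightarrow> 0) ?F"
        by simp
    qed
    from tendsto_add[OF 1 2] show "((\<lambda>s. form c (\<gamma> s) (w s) (w s)) \<longlongrightarrow> form c (\<gamma> t) (w t) (w t)) ?F"
      by simp
  qed
  then show ?thesis unfolding chart_norm_eq by (rule continuous_on_real_sqrt)
qed

section \<open>Length of piecewise smooth curves\<close>

definition speed :: "(real \<Rightarrow> 'm) \<Rightarrow> real \<Rightarrow> real" where
  "speed \<gamma> t = tangent_norm g (\<gamma> t) (velocity A \<gamma> t)"

lemma speed_chart:
  assumes c: "c \<in> A" "\<gamma> t \<in> fst c" and \<gamma>: "isCont \<gamma> t"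
    and w: "((snd c \<circ> \<gamma>) has_vector_derivative w) (at t)"
  shows "speed \<gamma> t = chart_norm c (\<gamma> t) w"
proof -
  let ?c' = "chart_at A (\<gamma> t)"
  have "(((snd ?c' \<circ> chart_inv c) \<circ> (snd c \<circ> \<gamma>)) has_derivative
      tangent_of A c (\<gamma> t) \<circ> (\<lambda>h. h *\<^sub>R w)) (at t)"
    using w tangent_of_has_derivative[OF c] by (intro diff_chain_at) (auto simp: has_vector_derivative_def)
  moreover have "\<forall>\<^sub>F s in at t. \<gamma> s \<in> fst c"
    using \<gamma> topological_tendstoD[OF _ open_dom[OF c(1)] c(2)] by (simp add: isCont_def)
  then have "\<forall>\<^sub>F s in at t. ((snd ?c' \<circ> chart_inv c) \<circ> (snd c \<circ> \<gamma>)) s = (snd ?c' \<circ> \<gamma>) s"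
    by eventually_elim (use c in auto)
  ultimately have "((snd ?c' \<circ> \<gamma>) has_derivative tangent_of A c (\<gamma> t) \<circ> (\<lambda>h. h *\<^sub>R w)) (at t)"
    by (rule has_derivative_transform_eventually) (use c in auto)
  moreover have "tangent_of A c (\<gamma> t) \<circ> (\<lambda>h. h *\<^sub>R w) = (\<lambda>h. h *\<^sub>R tangent_of A c (\<gamma> t) w)"
    using linear_tangent_of[OF c] by (auto simp: linear_cmul)
  ultimately have "velocity A \<gamma> t = tangent_of A c (\<gamma> t) w"
    unfolding velocity_def by (intro vector_derivative_at) (simp add: has_vector_derivative_def)
  then show ?thesis by (simp add: speed_def chart_norm_def)
qed

text \<open>
  At these points \<open>vector_derivative\<close> returns an actual derivative in every chart, so
  that the speed obeys the chain rule. A piecewise smooth curve has only finitely many other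
  points.
\<close>

definition regular :: "(real \<Rightarrow> 'm) \<Rightarrow> real \<Rightarrow> bool" where
  "regular \<gamma> t \<longleftrightarrow> isCont \<gamma> t \<and> (\<exists>c\<in>A. \<gamma> t \<in> fst c \<and> (\<exists>w. ((snd c \<circ> \<gamma>) has_vector_derivative w) (at t)))"

lemma C1_interior:
  assumes "C1_curve_on A a b \<gamma>" "c \<in> A"
  shows "\<exists>w. continuous_on ({a..b} \<inter> \<gamma> -` fst c) w \<and>
    (\<forall>t\<in>{a<..<b} \<inter> \<gamma> -` fst c. isCont \<gamma> t \<and> ((snd c \<circ> \<gamma>) has_vector_derivative w t) (at t) \<and>
      speed \<gamma> t = chart_norm c (\<gamma> t) (w t))"
proof -
  have \<gamma>: "continuous_on {a..b} \<gamma>" using assms by (simp add: C1_curve_on_def)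
  obtain w where w: "continuous_on ({a..b} \<inter> \<gamma> -` fst c) w"
    "\<And>t. t \<in> {a..b} \<inter> \<gamma> -` fst c \<Longrightarrow> ((snd c \<circ> \<gamma>) has_vector_derivative w t) (at t within {a..b})"
    using assms unfolding C1_curve_on_def by blast
  have "isCont \<gamma> t \<and> ((snd c \<circ> \<gamma>) has_vector_derivative w t) (at t)"
    if t: "t \<in> {a<..<b} \<inter> \<gamma> -` fst c" for t
  proof
    have "continuous_on {a<..<b} \<gamma>" using \<gamma> by (rule continuous_on_subset) auto
    then show "isCont \<gamma> t" using t by (simp add: continuous_on_eq_continuous_at[OF open_greaterThanLessThan])
    have "at t within {a..b} = at t" using t by (simp add: at_within_Icc_at)
    then show "((snd c \<circ> \<gamma>) has_vector_derivative w t) (at t)" using w(2)[of t] t by auto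
  qed
  moreover from this have "speed \<gamma> t = chart_norm c (\<gamma> t) (w t)" if "t \<in> {a<..<b} \<inter> \<gamma> -` fst c" for t
    using that by (intro speed_chart[OF assms(2)]) auto
  ultimately show ?thesis using w(1) by blast
qed

lemma C1_regular:
  assumes "C1_curve_on A a b \<gamma>" "t \<in> {a<..<b}"
  shows "regular \<gamma> t"
  using C1_interior[OF assms(1) chart_at(1)[of "\<gamma> t"]] chart_at[of "\<gamma> t"] assms(2)
  unfolding regular_def by blast

lemma C1_continuous_speed:
  assumes C1: "C1_curve_on A a b \<gamma>"
  shows "continuous_on {a<..<b} (speed \<gamma>)"
proof (rule continuous_at_imp_continuous_on, rule ballI)
  fix t assume t: "t \<in> {a<..<b}"
  let ?c = "chart_at A (\<gamma> t)"
  obtain w where w: "continuous_on ({a..b} \<inter> \<gamma> -` fst ?c) w"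
    "\<And>t. t \<in> {a<..<b} \<inter> \<gamma> -` fst ?c \<Longrightarrow> speed \<gamma> t = chart_norm ?c (\<gamma> t) (w t)"
    using C1_interior[OF C1 chart_at(1)[of "\<gamma> t"]] by blast
  have \<gamma>: "continuous_on {a<..<b} \<gamma>"
    using C1 by (auto simp: C1_curve_on_def intro: continuous_on_subset)
  let ?S = "{a<..<b} \<inter> \<gamma> -` fst ?c"
  have "open (\<gamma> -` fst ?c \<inter> {a<..<b})"
    by (intro open_preimage open_greaterThanLessThan \<gamma> open_dom chart_at)
  then have S: "open ?S" by (simp add: Int_commute)
  have "continuous_on ?S (\<lambda>t. chart_norm ?c (\<gamma> t) (w t))"
    by (intro continuous_chart_norm chart_at) (auto intro: continuous_on_subset[OF \<gamma>] continuous_on_subset[OF w(1)])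
  then have "continuous_on ?S (speed \<gamma>)" by (rule continuous_on_eq) (use w(2) in auto)
  then show "isCont (speed \<gamma>) t"
    unfolding continuous_on_eq_continuous_at[OF S] using t chart_at(2)[of "\<gamma> t"] by simp
qed

end

context riemannian
begin

text \<open>
  Building the curve piece by piece, instead of indexing all break points, makes concatenation,
  reparametrization and the estimates of length plain inductions.
\<close>

inductive piecewise :: "(real \<Rightarrow> 'm) \<Rightarrow> real \<Rightarrow> real \<Rightarrow> bool" for \<gamma> a where
  piecewise_refl: "piecewise \<gamma> a a"
| piecewise_step: "\<lbrakk>piecewise \<gamma> a b; b < c; C1_curve_on A b c \<gamma>\<rbrakk> \<Longrightarrow> piecewise \<gamma> a c"

lemma piecewise_iff: "piecewise_C1_curve A \<gamma> \<longleftrightarrow> piecewise \<gamma> 0 1"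
proof
  assume "piecewise_C1_curve A \<gamma>"
  then obtain k :: nat and t where t: "t 0 = 0" "t k = 1"
    "\<And>i. i < k \<Longrightarrow> t i < t (Suc i) \<and> C1_curve_on A (t i) (t (Suc i)) \<gamma>"
    by (auto simp: piecewise_C1_curve_def)
  have "i \<le> k \<Longrightarrow> piecewise \<gamma> 0 (t i)" for i
  proof (induction i)
    case (Suc i)
    then show ?case using t(3)[of i] by (auto intro: piecewise_step)
  qed (simp add: t piecewise_refl)
  then show "piecewise \<gamma> 0 1" using t(2) by force
next
  have "\<exists>(k::nat) t. t 0 = a \<and> t k = b \<and> (\<forall>i<k. t i < t (Suc i) \<and> C1_curve_on A (t i) (t (Suc i)) \<gamma>)"
    if "piecewise \<gamma> a b" for a b
    using that
  proof induction
    case piecewise_refl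
    then show ?case by (intro exI[of _ 0] exI[of _ "\<lambda>_. a"]) simp
  next
    case (piecewise_step b c)
    then obtain k :: nat and t where t: "t 0 = a" "t k = b"
      "\<forall>i<k. t i < t (Suc i) \<and> C1_curve_on A (t i) (t (Suc i)) \<gamma>" by blast
    then show ?case using piecewise_step
      by (intro exI[of _ "Suc k"] exI[of _ "t(Suc k := c)"]) (auto simp: less_Suc_eq)
  qed
  then show "piecewise \<gamma> 0 1 \<Longrightarrow> piecewise_C1_curve A \<gamma>"
    unfolding piecewise_C1_curve_def by blast
qed

lemma piecewise_le: "piecewise \<gamma> a b \<Longrightarrow> a \<le> b"
  by (induction rule: piecewise.induct) auto

lemma piecewise_trans: "\<lbrakk>piecewise \<gamma> b c; piecewise \<gamma> a b\<rbrakk> \<Longrightarrow> piecewise \<gamma> a c"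
  by (induction rule: piecewise.induct) (auto intro: piecewise_step)

lemma piecewise_single: "\<lbrakk>b < c; C1_curve_on A b c \<gamma>\<rbrakk> \<Longrightarrow> piecewise \<gamma> b c"
  by (rule piecewise_step[OF piecewise_refl])

lemma C1_affine:
  assumes "C1_curve_on A a' b' \<gamma>" and im: "\<And>t. t \<in> {a..b} \<Longrightarrow> s + r * t \<in> {a'..b'}"
  shows "C1_curve_on A a b (\<lambda>t. \<gamma> (s + r * t))"
  unfolding C1_curve_on_def
proof (intro conjI ballI)
  let ?\<sigma> = "\<lambda>t. s + r * t"
  have \<sigma>: "continuous_on S ?\<sigma>" for S by (intro continuous_intros)
  have im': "?\<sigma> ` {a..b} \<subseteq> {a'..b'}" using im by blast
  show "continuous_on {a..b} (\<lambda>t. \<gamma> (s + r * t))"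
    by (rule continuous_on_compose2[OF _ \<sigma> im']) (use assms(1) in \<open>simp add: C1_curve_on_def\<close>)
  fix c assume "c \<in> A"
  then obtain w where w: "continuous_on ({a'..b'} \<inter> \<gamma> -` fst c) w"
    "\<And>t. t \<in> {a'..b'} \<inter> \<gamma> -` fst c \<Longrightarrow> ((snd c \<circ> \<gamma>) has_vector_derivative w t) (at t within {a'..b'})"
    using assms(1) unfolding C1_curve_on_def by blast
  have "continuous_on ({a..b} \<inter> (\<lambda>t. \<gamma> (s + r * t)) -` fst c) (\<lambda>t. r *\<^sub>R w (?\<sigma> t))"
    by (rule continuous_on_scaleR[OF continuous_on_const continuous_on_compose2[OF w(1) \<sigma>]]) (use im in auto)
  moreover have "((snd c \<circ> (\<lambda>t. \<gamma> (s + r * t))) has_vector_derivative r *\<^sub>R w (?\<sigma> t)) (at t within {a..b})"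
    if "t \<in> {a..b} \<inter> (\<lambda>t. \<gamma> (s + r * t)) -` fst c" for t
  proof -
    have "(?\<sigma> has_vector_derivative r) (at t within {a..b})"
      by (auto intro!: derivative_eq_intros)
    moreover have "((snd c \<circ> \<gamma>) has_vector_derivative w (?\<sigma> t)) (at (?\<sigma> t) within ?\<sigma> ` {a..b})"
      by (rule has_vector_derivative_within_subset[OF w(2) im']) (use that im in auto)
    ultimately show ?thesis
      using vector_diff_chain_within[of ?\<sigma> r t "{a..b}" "snd c \<circ> \<gamma>"] by (simp add: o_def)
  qed
  ultimately show "\<exists>w. continuous_on ({a..b} \<inter> (\<lambda>t. \<gamma> (s + r * t)) -` fst c) w \<and>
      (\<forall>t\<in>{a..b} \<inter> (\<lambda>t. \<gamma> (s + r * t)) -` fst c.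
        ((snd c \<circ> (\<lambda>t. \<gamma> (s + r * t))) has_vector_derivative w t) (at t within {a..b}))"
    by blast
qed

lemma piecewise_affine:
  assumes "0 < r"
  shows "piecewise \<gamma> a b \<Longrightarrow> piecewise (\<lambda>t. \<gamma> (s + r * t)) ((a - s) / r) ((b - s) / r)"
proof (induction rule: piecewise.induct)
  case (piecewise_step b c)
  have "C1_curve_on A ((b - s) / r) ((c - s) / r) (\<lambda>t. \<gamma> (s + r * t))"
    by (rule C1_affine[OF piecewise_step(3)]) (use assms in \<open>auto simp: field_simps\<close>)
  then show ?case
    by (rule piecewise.intros(2)[OF piecewise_step(4), rotated])
      (use piecewise_step(2) assms in \<open>auto simp: divide_strict_right_mono\<close>)
qed (rule piecewise_refl)

lemma piecewise_reverse:
  "piecewise \<gamma> a b \<Longrightarrow> piecewise (\<lambda>t. \<gamma> (s - t)) (s - b) (s - a)"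
proof (induction rule: piecewise.induct)
  case (piecewise_step b c)
  have "C1_curve_on A (s - c) (s - b) (\<lambda>t. \<gamma> (s + - 1 * t))"
    by (rule C1_affine[OF piecewise_step(3)]) auto
  then show ?case
    using piecewise_step(2) by (intro piecewise_trans[OF piecewise_step(4) piecewise_single]) auto
qed (rule piecewise_refl)

lemma piecewise_cong:
  "\<lbrakk>piecewise \<gamma> a b; \<And>t. t \<in> {a..b} \<Longrightarrow> \<gamma>' t = \<gamma> t\<rbrakk> \<Longrightarrow> piecewise \<gamma>' a b"
proof (induction rule: piecewise.induct)
  case (piecewise_step b c)
  have ab: "a \<le> b" using piecewise_step(1) by (rule piecewise_le)
  have eq: "\<gamma>' t = \<gamma> t" if "t \<in> {b..c}" for t using piecewise_step(5) ab that by auto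
  have C1: "C1_curve_on A b c \<gamma>'"
    unfolding C1_curve_on_def
  proof (intro conjI ballI)
    have "continuous_on {b..c} \<gamma>" using piecewise_step(3) by (simp add: C1_curve_on_def)
    then show "continuous_on {b..c} \<gamma>'" by (rule continuous_on_eq) (use eq in auto)
    fix C assume "C \<in> A"
    then obtain w where w: "continuous_on ({b..c} \<inter> \<gamma> -` fst C) w"
      "\<And>t. t \<in> {b..c} \<inter> \<gamma> -` fst C \<Longrightarrow> ((snd C \<circ> \<gamma>) has_vector_derivative w t) (at t within {b..c})"
      using piecewise_step(3) unfolding C1_curve_on_def by blast
    have dom: "{b..c} \<inter> \<gamma>' -` fst C = {b..c} \<inter> \<gamma> -` fst C" using eq by auto
    have "((snd C \<circ> \<gamma>') has_vector_derivative w t) (at t within {b..c})" if "t \<in> {b..c} \<inter> \<gamma> -` fst C" for t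
      by (rule has_vector_derivative_transform[OF _ _ w(2)[OF that]]) (use that eq in auto)
    with w(1) show "\<exists>w. continuous_on ({b..c} \<inter> \<gamma>' -` fst C) w \<and>
        (\<forall>t\<in>{b..c} \<inter> \<gamma>' -` fst C. ((snd C \<circ> \<gamma>') has_vector_derivative w t) (at t within {b..c}))"
      unfolding dom by blast
  qed
  have "piecewise \<gamma>' a b" using piecewise_step(2,4,5) by auto
  then show ?case by (rule piecewise.intros(2)[OF _ piecewise_step(2) C1])
qed (rule piecewise_refl)

lemma piecewise_regular:
  "piecewise \<gamma> a b \<Longrightarrow> \<exists>X. finite X \<and> (\<forall>t\<in>{a..b} - X. regular \<gamma> t)"
proof (induction rule: piecewise.induct)
  case piecewise_refl
  then show ?case by (intro exI[of _ "{a}"]) auto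
next
  case (piecewise_step b c)
  then obtain X where "finite X" "\<forall>t\<in>{a..b} - X. regular \<gamma> t" by blast
  then show ?case
    using C1_regular[OF piecewise_step(3)] by (intro exI[of _ "X \<union> {b, c}"]) force
qed

definition len :: "(real \<Rightarrow> 'm) \<Rightarrow> real \<Rightarrow> real \<Rightarrow> ennreal" where
  "len \<gamma> a b = (\<integral>\<^sup>+ t\<in>{a..b}. ennreal (speed \<gamma> t) \<partial>lborel)"

abbreviation speed_measurable where
  "speed_measurable \<gamma> a b \<equiv> (\<lambda>t. ennreal (speed \<gamma> t) * indicator {a..b} t) \<in> borel_measurable borel"

lemma AE_finite: "finite (X :: real set) \<Longrightarrow> AE t in lborel. t \<notin> X"
  by (intro AE_not_in countable_imp_null_set_lborel countable_finite)

lemma C1_speed_measurable: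
  assumes "C1_curve_on A a b \<gamma>"
  shows "speed_measurable \<gamma> a b"
proof (rule measurable_discrete_difference[of "\<lambda>t. ennreal (indicator {a<..<b} t *\<^sub>R speed \<gamma> t)" _ _ "{a, b}"])
  show "(\<lambda>t. ennreal (indicator {a<..<b} t *\<^sub>R speed \<gamma> t)) \<in> borel_measurable borel"
    by (intro measurable_compose[OF borel_measurable_continuous_on_indicator measurable_ennreal]
        C1_continuous_speed assms) auto
qed (auto simp: indicator_def)

lemma len_split:
  assumes "a \<le> b" "b \<le> c" and m: "speed_measurable \<gamma> a b" "speed_measurable \<gamma> b c"
  shows "speed_measurable \<gamma> a c" and "len \<gamma> a c = len \<gamma> a b + len \<gamma> b c"
proof -
  let ?F = "\<lambda>a b t. ennreal (speed \<gamma> t) * indicator {a..b} t"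
  have eq: "?F a b t + ?F b c t = ?F a c t" if "t \<noteq> b" for t
    using assms(1,2) that by (auto simp: indicator_def)
  have m': "(\<lambda>t. ?F a b t + ?F b c t) \<in> borel_measurable borel" using m by (rule borel_measurable_add)
  show "speed_measurable \<gamma> a c"
    by (rule measurable_discrete_difference[OF m', of "{b}"]) (use eq in auto)
  have "len \<gamma> a c = (\<integral>\<^sup>+t. ?F a b t + ?F b c t \<partial>lborel)"
    unfolding len_def using AE_finite[of "{b}"] eq by (intro nn_integral_cong_AE) auto
  also have "\<dots> = len \<gamma> a b + len \<gamma> b c"
    unfolding len_def using m by (intro nn_integral_add) auto
  finally show "len \<gamma> a c = len \<gamma> a b + len \<gamma> b c" .
qed

lemma point_speed_measurable: "speed_measurable \<gamma> a a"
  by (rule measurable_discrete_difference[of "\<lambda>_. 0" _ _ "{a}"]) auto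

lemma piecewise_speed_measurable: "piecewise \<gamma> a b \<Longrightarrow> speed_measurable \<gamma> a b"
proof (induction rule: piecewise.induct)
  case (piecewise_step b c)
  then show ?case using piecewise_le[of \<gamma> a b] C1_speed_measurable[of b c \<gamma>] by (intro len_split(1)[of a b c]) auto
qed (rule point_speed_measurable)

lemma len_trans:
  "\<lbrakk>piecewise \<gamma> a b; piecewise \<gamma> b c\<rbrakk> \<Longrightarrow> len \<gamma> a c = len \<gamma> a b + len \<gamma> b c"
  by (intro len_split(2) piecewise_le piecewise_speed_measurable)

lemma regular_affine:
  assumes "regular \<gamma> (s + r * t)"
  shows "speed (\<lambda>t. \<gamma> (s + r * t)) t = \<bar>r\<bar> * speed \<gamma> (s + r * t)"
proof -
  obtain c w where c: "c \<in> A" "\<gamma> (s + r * t) \<in> fst c" and \<gamma>: "isCont \<gamma> (s + r * t)"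
    and w: "((snd c \<circ> \<gamma>) has_vector_derivative w) (at (s + r * t))"
    using assms unfolding regular_def by blast
  have "((\<lambda>t. s + r * t) has_vector_derivative r) (at t)"
    by (auto intro!: derivative_eq_intros)
  from vector_diff_chain_at[OF this w]
  have w': "((snd c \<circ> (\<lambda>t. \<gamma> (s + r * t))) has_vector_derivative r *\<^sub>R w) (at t)" by (simp add: o_def)
  have "isCont (\<lambda>t. \<gamma> (s + r * t)) t"
    by (rule isCont_o2[where f = "\<lambda>t. s + r * t" and g = \<gamma>]) (use \<gamma> in \<open>auto intro!: continuous_intros\<close>)
  then have "speed (\<lambda>t. \<gamma> (s + r * t)) t = chart_norm c (\<gamma> (s + r * t)) (r *\<^sub>R w)"
    using speed_chart[OF c(1), of "\<lambda>t. \<gamma> (s + r * t)" t] c(2) w' by simp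
  also have "\<dots> = \<bar>r\<bar> * chart_norm c (\<gamma> (s + r * t)) w"
    using form_algebra(2)[OF c] by (simp add: chart_norm_eq real_sqrt_mult)
  finally show ?thesis using speed_chart[OF c \<gamma> w] by simp
qed

text \<open>
  Substitution in the integral; the speed is multiplied by the modulus of the slope, except at the
  preimages of the finitely many points where the curve is not regular.
\<close>

lemma len_affine:
  assumes pw: "piecewise \<gamma> a' b'" and r: "r \<noteq> 0"
    and ab: "\<And>t. t \<in> {a..b} \<longleftrightarrow> s + r * t \<in> {a'..b'}"
  shows "len (\<lambda>t. \<gamma> (s + r * t)) a b = len \<gamma> a' b'"
proof -
  let ?F = "\<lambda>t. ennreal (speed \<gamma> t) * indicator {a'..b'} t"
  obtain X where X: "finite X" "\<forall>t\<in>{a'..b'} - X. regular \<gamma> t" using piecewise_regular[OF pw] by blast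
  have m: "?F \<in> borel_measurable borel" by (rule piecewise_speed_measurable[OF pw])
  have m': "(\<lambda>t. ?F (s + r * t)) \<in> borel_measurable borel"
    by (rule measurable_compose[OF _ m]) simp
  have "len \<gamma> a' b' = \<bar>r\<bar> * (\<integral>\<^sup>+t. ?F (s + r * t) \<partial>lborel)"
    unfolding len_def by (rule nn_integral_real_affine[OF m r])
  also have "\<dots> = (\<integral>\<^sup>+t. \<bar>r\<bar> * ?F (s + r * t) \<partial>lborel)"
    using m' by (intro nn_integral_cmult[symmetric]) simp
  also have "\<dots> = len (\<lambda>t. \<gamma> (s + r * t)) a b"
    unfolding len_def
  proof (rule nn_integral_cong_AE)
    have "inj (\<lambda>t. s + r * t)" using r by (auto simp: inj_on_def)
    then have "finite ((\<lambda>t. s + r * t) -` X)" by (rule finite_vimageI[OF X(1)])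
    from AE_finite[OF this]
    show "AE t in lborel. ennreal \<bar>r\<bar> * ?F (s + r * t) =
        ennreal (speed (\<lambda>t. \<gamma> (s + r * t)) t) * indicator {a..b} t"
    proof eventually_elim
      case (elim t)
      show ?case
      proof (cases "t \<in> {a..b}")
        case True
        then have "s + r * t \<in> {a'..b'}" using ab by blast
        then show ?thesis
          using True elim X(2) regular_affine[of \<gamma> s r t] by (simp add: ennreal_mult')
      qed (use ab[of t] in \<open>auto simp: indicator_def\<close>)
    qed
  qed
  finally show ?thesis by simp
qed

text \<open>
  The values of the curves outside the interval influence the two-sided derivative only at the end
  points.
\<close>

lemma len_cong:
  assumes pw: "piecewise \<gamma> a b" and eq: "\<And>t. t \<in> {a..b} \<Longrightarrow> \<gamma>' t = \<gamma> t"
  shows "len \<gamma>' a b = len \<gamma> a b"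
proof -
  obtain X where X: "finite X" "\<forall>t\<in>{a..b} - X. regular \<gamma> t" using piecewise_regular[OF pw] by blast
  have "AE t in lborel. t \<notin> X \<union> {a, b}" using X(1) by (intro AE_finite) simp
  then have "AE t in lborel. ennreal (speed \<gamma>' t) * indicator {a..b} t = ennreal (speed \<gamma> t) * indicator {a..b} t"
  proof eventually_elim
    case (elim t)
    show ?case
    proof (cases "t \<in> {a<..<b}")
      case True
      then have "regular \<gamma> t" using X(2) elim by auto
      then obtain c w where c: "c \<in> A" "\<gamma> t \<in> fst c" and \<gamma>: "isCont \<gamma> t"
        and w: "((snd c \<circ> \<gamma>) has_vector_derivative w) (at t)"
        unfolding regular_def by blast
      have w': "((snd c \<circ> \<gamma>') has_vector_derivative w) (at t)"
        by (rule has_vector_derivative_transform_within_open[OF w open_greaterThanLessThan True]) (use eq in auto)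
      have "\<forall>\<^sub>F s in nhds t. s \<in> {a<..<b}"
        by (rule eventually_nhds_in_open[OF open_greaterThanLessThan True])
      then have "\<forall>\<^sub>F s in nhds t. \<gamma> s = \<gamma>' s" by eventually_elim (use eq in auto)
      then have "isCont \<gamma>' t" using \<gamma> isCont_cong by metis
      then have "speed \<gamma>' t = speed \<gamma> t"
        using speed_chart[OF c \<gamma> w] speed_chart[OF c(1) _ _ w'] c(2) eq[of t] True by simp
      then show ?thesis by simp
    qed (use elim in \<open>auto simp: indicator_def\<close>)
  qed
  then show ?thesis unfolding len_def by (rule nn_integral_cong_AE)
qed

section \<open>The Riemannian distance as a metric\<close>

abbreviation dist_g where "dist_g \<equiv> riemannian_dist A g"

lemma dist_g_eq: "dist_g x y = (INF \<gamma>\<in>{\<gamma>. piecewise \<gamma> 0 1 \<and> \<gamma> 0 = x \<and> \<gamma> 1 = y}. len \<gamma> 0 1)"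
  unfolding riemannian_dist_def piecewise_iff curve_length_def len_def speed_def by simp

lemma dist_g_le: "\<lbrakk>piecewise \<gamma> 0 1; \<gamma> 0 = x; \<gamma> 1 = y\<rbrakk> \<Longrightarrow> dist_g x y \<le> len \<gamma> 0 1"
  unfolding dist_g_eq by (rule INF_lower) simp

lemma dist_g_sym: "dist_g x y = dist_g y x"
proof -
  have "dist_g x y \<le> dist_g y x" for x y
    unfolding dist_g_eq[of y x]
  proof (rule INF_greatest, clarify)
    fix \<gamma> assume \<gamma>: "piecewise \<gamma> 0 1"
    have "len (\<lambda>t. \<gamma> (1 + - 1 * t)) 0 1 = len \<gamma> 0 1"
      by (rule len_affine[OF \<gamma>]) auto
    moreover have "piecewise (\<lambda>t. \<gamma> (1 + - 1 * t)) 0 1"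
      using piecewise_reverse[OF \<gamma>, of 1] by simp
    ultimately show "dist_g (\<gamma> 1) (\<gamma> 0) \<le> len \<gamma> 0 1"
      using dist_g_le[of "\<lambda>t. \<gamma> (1 + - 1 * t)" "\<gamma> 1" "\<gamma> 0"] by simp
  qed
  then show ?thesis by (intro antisym)
qed

lemma dist_g_triangle: "dist_g x z \<le> dist_g x y + dist_g y z"
proof (rule ennreal_le_epsilon)
  fix e :: real assume fin: "dist_g x y + dist_g y z < top" and e: "0 < e"
  have less: "u < u + ennreal (e / 2)" if "u < top" for u
    using that e by (cases u) (auto simp: ennreal_less_iff simp flip: ennreal_plus)
  have "dist_g x y < dist_g x y + ennreal (e / 2)" "dist_g y z < dist_g y z + ennreal (e / 2)"
    using fin e by (auto intro!: less)
  then obtain \<gamma>1 \<gamma>2 where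
    1: "piecewise \<gamma>1 0 1" "\<gamma>1 0 = x" "\<gamma>1 1 = y" "len \<gamma>1 0 1 < dist_g x y + ennreal (e / 2)" and
    2: "piecewise \<gamma>2 0 1" "\<gamma>2 0 = y" "\<gamma>2 1 = z" "len \<gamma>2 0 1 < dist_g y z + ennreal (e / 2)"
    unfolding dist_g_eq[of x y] dist_g_eq[of y z] INF_less_iff by auto
  define \<gamma> where "\<gamma> t = (if t \<le> 1 / 2 then \<gamma>1 (0 + 2 * t) else \<gamma>2 (- 1 + 2 * t))" for t
  have p1: "piecewise (\<lambda>t. \<gamma>1 (0 + 2 * t)) 0 (1 / 2)" "piecewise (\<lambda>t. \<gamma>2 (- 1 + 2 * t)) (1 / 2) 1"
    using piecewise_affine[OF _ 1(1), of 2 0] piecewise_affine[OF _ 2(1), of 2 "- 1"] by simp_all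
  have eq: "\<gamma> t = \<gamma>1 (0 + 2 * t)" if "t \<in> {0..1 / 2}" for t using that by (simp add: \<gamma>_def)
  have eq': "\<gamma> t = \<gamma>2 (- 1 + 2 * t)" if "t \<in> {1 / 2..1}" for t
  proof (cases "t = 1 / 2")
    case True
    show ?thesis unfolding True \<gamma>_def using 1(3) 2(2) by simp
  qed (use that in \<open>simp add: \<gamma>_def\<close>)
  have p: "piecewise \<gamma> 0 (1 / 2)" "piecewise \<gamma> (1 / 2) 1"
    using piecewise_cong[OF p1(1) eq] piecewise_cong[OF p1(2) eq'] by auto
  have "len \<gamma> 0 1 = len \<gamma>1 0 1 + len \<gamma>2 0 1"
  proof -
    have "len \<gamma> 0 (1 / 2) = len \<gamma>1 0 1"
      by (rule trans[OF len_cong[OF p1(1) eq] len_affine[OF 1(1)]]) auto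
    moreover have "len \<gamma> (1 / 2) 1 = len \<gamma>2 0 1"
      by (rule trans[OF len_cong[OF p1(2) eq'] len_affine[OF 2(1)]]) auto
    ultimately show ?thesis using len_trans[OF p] by simp
  qed
  moreover have "dist_g x z \<le> len \<gamma> 0 1"
    using piecewise_trans[OF p(2,1)] 1(2) 2(3) by (intro dist_g_le) (auto simp: \<gamma>_def)
  ultimately have "dist_g x z \<le> len \<gamma>1 0 1 + len \<gamma>2 0 1" by simp
  also have "\<dots> \<le> (dist_g x y + ennreal (e / 2)) + (dist_g y z + ennreal (e / 2))"
    using 1(4) 2(4) by (intro add_mono less_imp_le)
  also have "\<dots> = dist_g x y + dist_g y z + (ennreal (e / 2) + ennreal (e / 2))" by (simp add: add_ac)
  also have "ennreal (e / 2) + ennreal (e / 2) = ennreal e"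
    using e ennreal_plus[of "e / 2" "e / 2"] by simp
  finally show "dist_g x z \<le> dist_g x y + dist_g y z + ennreal e" .
qed

end

context riemannian
begin

lemma C1_chart_segment:
  assumes c: "c \<in> A" and seg: "\<And>t. t \<in> {0..1} \<Longrightarrow> p + t *\<^sub>R v \<in> snd c ` fst c"
  shows "C1_curve_on A 0 1 (\<lambda>t. chart_inv c (p + t *\<^sub>R v))"
  unfolding C1_curve_on_def
proof (intro conjI ballI)
  let ?l = "\<lambda>t. p + t *\<^sub>R v"
  let ?\<gamma> = "\<lambda>t. chart_inv c (?l t)"
  have l: "continuous_on S ?l" for S by (intro continuous_intros)
  show "continuous_on {0..1} ?\<gamma>"
    by (rule continuous_on_compose2[OF continuous_chart_inv[OF c] l]) (use seg in auto)
  fix c' assume c': "c' \<in> A"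
  obtain D :: "'e \<Rightarrow> 'e \<Rightarrow>\<^sub>L 'e" where D: "continuous_on (snd c ` (fst c \<inter> fst c')) D"
    "\<And>q. q \<in> snd c ` (fst c \<inter> fst c') \<Longrightarrow> (snd c' \<circ> chart_inv c has_derivative blinfun_apply (D q)) (at q)"
    using transition[OF c c'] by blast
  have mem: "?l t \<in> snd c ` (fst c \<inter> fst c')" if t: "t \<in> {0..1} \<inter> ?\<gamma> -` fst c'" for t
  proof
    show "?l t = snd c (?\<gamma> t)" using seg t c by simp
    show "?\<gamma> t \<in> fst c \<inter> fst c'" using seg[of t] t c chart_inv_dom by auto
  qed
  have "continuous_on ({0..1} \<inter> ?\<gamma> -` fst c') (\<lambda>t. blinfun_apply (D (?l t)) v)"
    by (rule blinfun.continuous_on[OF continuous_on_compose2[OF D(1) l] continuous_on_const]) (use mem in auto)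
  moreover have "((snd c' \<circ> ?\<gamma>) has_vector_derivative blinfun_apply (D (?l t)) v) (at t within {0..1})"
    if "t \<in> {0..1} \<inter> ?\<gamma> -` fst c'" for t
  proof -
    have "(?l has_derivative (\<lambda>h. h *\<^sub>R v)) (at t within {0..1})"
      by (auto intro!: derivative_eq_intros)
    then have "((snd c' \<circ> chart_inv c) \<circ> ?l has_derivative blinfun_apply (D (?l t)) \<circ> (\<lambda>h. h *\<^sub>R v)) (at t within {0..1})"
      by (rule diff_chain_within) (rule has_derivative_at_withinI[OF D(2)[OF mem[OF that]]])
    then show ?thesis
      by (simp add: has_vector_derivative_def o_def blinfun.scaleR_right)
  qed
  ultimately show "\<exists>w. continuous_on ({0..1} \<inter> ?\<gamma> -` fst c') w \<and>
      (\<forall>t\<in>{0..1} \<inter> ?\<gamma> -` fst c'. ((snd c' \<circ> ?\<gamma>) has_vector_derivative w t) (at t within {0..1}))"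
    by blast
qed

text \<open>
  In a chart a segment of coordinate length \<open>norm v\<close> has length at most \<open>M *
  norm v\<close>.
\<close>

lemma dist_g_nbhd:
  assumes "0 < r"
  shows "\<exists>W. open W \<and> x \<in> W \<and> (\<forall>y\<in>W. dist_g x y < ennreal r)"
proof -
  let ?c = "chart_at A x"
  note c = chart_at[of x]
  let ?p = "snd ?c x"
  obtain V m M where V: "open V" "x \<in> V" "V \<subseteq> fst ?c" and M: "0 < M"
    "\<And>x v. x \<in> V \<Longrightarrow> chart_norm ?c x v \<le> M * norm v"
    using chart_norm_bounds[OF c] by blast
  have "open (snd ?c ` (fst ?c \<inter> V))" by (rule open_chart_image[OF c(1) V(1)])
  moreover have "?p \<in> snd ?c ` (fst ?c \<inter> V)" using c V by blast
  ultimately obtain r0 where r0: "0 < r0" "ball ?p r0 \<subseteq> snd ?c ` (fst ?c \<inter> V)"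
    by (meson openE)
  define s where "s = min r0 (r / M)"
  have s: "0 < s" "s \<le> r0" "M * s \<le> r" using r0 M assms by (auto simp: s_def min_def field_simps)
  let ?W = "snd ?c -` ball ?p s \<inter> fst ?c"
  have "open ?W" by (intro open_preimage open_dom continuous_chart c open_ball)
  moreover have "x \<in> ?W" using c s by simp
  moreover have "dist_g x y < ennreal r" if y: "y \<in> ?W" for y
  proof -
    define v where "v = snd ?c y - ?p"
    let ?\<gamma> = "\<lambda>t. chart_inv ?c (?p + t *\<^sub>R v)"
    have v: "norm v < s" using y by (simp add: v_def dist_norm norm_minus_commute)
    have seg: "?p + t *\<^sub>R v \<in> snd ?c ` (fst ?c \<inter> V)" if t: "t \<in> {0..1}" for t
    proof -
      have "norm (t *\<^sub>R v) \<le> norm v" using t by (simp add: mult_left_le_one_le)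
      then have "?p + t *\<^sub>R v \<in> ball ?p r0" using v s by (simp add: dist_norm)
      then show ?thesis using r0 by blast
    qed
    have C1: "C1_curve_on A 0 1 ?\<gamma>"
      by (rule C1_chart_segment[OF c(1)]) (use seg in blast)
    have inV: "?\<gamma> t \<in> V" "snd ?c (?\<gamma> t) = ?p + t *\<^sub>R v" if "t \<in> {0..1}" for t
      using seg[OF that] c(1) by auto
    have "AE t in lborel. t \<notin> {0, 1 :: real}" by (rule AE_finite) simp
    then have "AE t in lborel. ennreal (speed ?\<gamma> t) * indicator {0..1} t \<le> ennreal (M * norm v) * indicator {0..1} t"
    proof eventually_elim
      case (elim t)
      show ?case
      proof (cases "t \<in> {0<..<1}")
        case True
        obtain w where "isCont ?\<gamma> t"
          using C1_interior[OF C1 c(1)] inV(1)[of t] V True by fastforce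
        moreover have "((\<lambda>t. ?p + t *\<^sub>R v) has_vector_derivative v) (at t)"
          by (auto intro!: derivative_eq_intros)
        then have "((snd ?c \<circ> ?\<gamma>) has_vector_derivative v) (at t)"
          by (rule has_vector_derivative_transform_within_open[OF _ open_greaterThanLessThan True]) (use inV in auto)
        ultimately have "speed ?\<gamma> t = chart_norm ?c (?\<gamma> t) v"
          using inV(1)[of t] V True by (intro speed_chart[OF c(1)]) auto
        also have "\<dots> \<le> M * norm v" using inV(1)[of t] True by (intro M) auto
        finally show ?thesis by (intro mult_right_mono ennreal_leI) auto
      qed (use elim in \<open>auto simp: indicator_def\<close>)
    qed
    then have "len ?\<gamma> 0 1 \<le> (\<integral>\<^sup>+t. ennreal (M * norm v) * indicator {0..1} (t :: real) \<partial>lborel)"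
      unfolding len_def by (rule nn_integral_mono_AE)
    also have "\<dots> = ennreal (M * norm v)" by (simp add: nn_integral_cmult_indicator)
    also have "\<dots> < ennreal r"
    proof (rule ennreal_lessI[OF assms])
      have "M * norm v < M * s" using v M by simp
      then show "M * norm v < r" using s by simp
    qed
    finally have "len ?\<gamma> 0 1 < ennreal r" .
    moreover have "dist_g x y \<le> len ?\<gamma> 0 1"
      by (rule dist_g_le[OF piecewise_single[OF _ C1]]) (use c y in \<open>auto simp: v_def\<close>)
    ultimately show ?thesis by (rule le_less_trans[rotated])
  qed
  ultimately show ?thesis by blast
qed

lemma len_mono:
  assumes "a \<le> a'" "b' \<le> b"
  shows "len \<gamma> a' b' \<le> len \<gamma> a b"
  unfolding len_def using assms by (intro nn_integral_mono mult_left_mono) (auto simp: indicator_def)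

text \<open>
  As long as the curve stays in a region where the Riemannian norm is at least \<open>m\<close>
  times the coordinate norm, its length is at least \<open>m\<close> times the integral of the
  coordinate speed, which dominates the coordinate displacement.
\<close>

lemma len_lower_bound:
  assumes C1: "C1_curve_on A a b \<gamma>" and \<tau>: "a \<le> \<tau>" "\<tau> \<le> b" and c: "c \<in> A"
    and V: "\<And>t. t \<in> {a..\<tau>} \<Longrightarrow> \<gamma> t \<in> V" "V \<subseteq> fst c"
    and m: "0 \<le> m" "\<And>x v. x \<in> V \<Longrightarrow> m * norm v \<le> chart_norm c x v"
  shows "ennreal (m * norm (snd c (\<gamma> \<tau>) - snd c (\<gamma> a))) \<le> len \<gamma> a b"
proof (cases "a = \<tau>")
  case False
  then have a\<tau>: "a < \<tau>" using \<tau> by simp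
  have dom: "\<gamma> t \<in> fst c" if "t \<in> {a..\<tau>}" for t using V(1)[OF that] V(2) by blast
  then have sub: "{a..\<tau>} \<subseteq> {a..b} \<inter> \<gamma> -` fst c" using \<tau> by auto
  obtain w where w: "continuous_on ({a..b} \<inter> \<gamma> -` fst c) w"
    "\<And>t. t \<in> {a<..<b} \<inter> \<gamma> -` fst c \<Longrightarrow> ((snd c \<circ> \<gamma>) has_vector_derivative w t) (at t) \<and>
      speed \<gamma> t = chart_norm c (\<gamma> t) (w t)"
    using C1_interior[OF C1 c] by blast
  have cw: "continuous_on {a..\<tau>} (\<lambda>t. norm (w t))"
    by (rule continuous_on_norm[OF continuous_on_subset[OF w(1) sub]])
  define \<Phi> where "\<Phi> t = integral {a..t} (\<lambda>t. norm (w t))" for t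
  have \<Phi>: "(\<Phi> has_real_derivative norm (w t)) (at t within {a..\<tau>})" if "t \<in> {a..\<tau>}" for t
    unfolding \<Phi>_def by (rule integral_has_real_derivative[OF cw that])
  have "norm ((snd c \<circ> \<gamma>) \<tau> - (snd c \<circ> \<gamma>) a) \<le> \<Phi> \<tau> - \<Phi> a"
  proof (rule differentiable_bound_general[OF a\<tau>])
    have "continuous_on {a..\<tau>} \<gamma>"
      using C1 \<tau> by (auto simp: C1_curve_on_def intro: continuous_on_subset)
    then show "continuous_on {a..\<tau>} (snd c \<circ> \<gamma>)"
      by (rule continuous_on_compose) (use dom in \<open>auto intro: continuous_on_subset[OF continuous_chart[OF c]]\<close>)
    show "continuous_on {a..\<tau>} \<Phi>"
      using \<Phi> by (rule DERIV_continuous_on)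
    fix t assume t: "a < t" "t < \<tau>"
    show "((snd c \<circ> \<gamma>) has_vector_derivative w t) (at t)" using w(2)[of t] t \<tau> dom[of t] by auto
    have "at t within {a..\<tau>} = at t" using t by (simp add: at_within_Icc_at)
    then show "(\<Phi> has_vector_derivative norm (w t)) (at t)"
      using \<Phi>[of t] t by (simp add: has_real_derivative_iff_has_vector_derivative)
  qed simp
  then have "ennreal (m * norm (snd c (\<gamma> \<tau>) - snd c (\<gamma> a))) \<le> ennreal (m * (\<Phi> \<tau> - \<Phi> a))"
    using m by (intro ennreal_leI mult_left_mono) auto
  also have "\<dots> = (\<integral>\<^sup>+t. ennreal (indicator {a..\<tau>} t *\<^sub>R (m * norm (w t))) \<partial>lborel)"
  proof (rule nn_integral_has_integral_lborel[symmetric])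
    have "((\<lambda>t. norm (w t)) has_integral \<Phi> \<tau>) {a..\<tau>}"
      unfolding \<Phi>_def using integrable_continuous_interval[OF cw] by (rule integrable_integral)
    then have "((\<lambda>t. m * norm (w t)) has_integral m * \<Phi> \<tau>) {a..\<tau>}"
      by (rule has_integral_mult_right)
    then have "((\<lambda>t. if t \<in> {a..\<tau>} then m * norm (w t) else 0) has_integral m * \<Phi> \<tau>) UNIV"
      by (simp only: has_integral_restrict_UNIV)
    moreover have "(\<lambda>t. if t \<in> {a..\<tau>} then m * norm (w t) else 0) = (\<lambda>t. indicator {a..\<tau>} t *\<^sub>R (m * norm (w t)))"
      by (auto simp: fun_eq_iff indicator_def)
    moreover have "\<Phi> a = 0" by (simp add: \<Phi>_def)
    ultimately show "((\<lambda>t. indicator {a..\<tau>} t *\<^sub>R (m * norm (w t))) has_integral m * (\<Phi> \<tau> - \<Phi> a)) UNIV"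
      by (simp only: diff_zero)
    show "(\<lambda>t. indicator {a..\<tau>} t *\<^sub>R (m * norm (w t))) \<in> borel_measurable borel"
      by (intro borel_measurable_continuous_on_indicator continuous_on_mult_left cw) simp
  qed (use m in auto)
  also have "\<dots> \<le> len \<gamma> a \<tau>"
    unfolding len_def
  proof (rule nn_integral_mono_AE)
    have "AE t in lborel. t \<notin> {a, \<tau>}" by (rule AE_finite) simp
    then show "AE t in lborel. ennreal (indicator {a..\<tau>} t *\<^sub>R (m * norm (w t)))
        \<le> ennreal (speed \<gamma> t) * indicator {a..\<tau>} t"
    proof eventually_elim
      case (elim t)
      show ?case
      proof (cases "t \<in> {a<..<\<tau>}")
        case True
        then have "speed \<gamma> t = chart_norm c (\<gamma> t) (w t)" using w(2)[of t] dom[of t] \<tau> by auto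
        moreover have "m * norm (w t) \<le> chart_norm c (\<gamma> t) (w t)"
          using True by (intro m(2) V(1)) auto
        ultimately show ?thesis by (auto simp: indicator_def intro: ennreal_leI)
      qed (use elim in \<open>auto simp: indicator_def\<close>)
    qed
  qed
  also have "\<dots> \<le> len \<gamma> a b" using \<tau> by (intro len_mono) auto
  finally show ?thesis .
qed simp

text \<open>
  Take a closed coordinate ball \<open>K\<close> of radius \<open>r\<close> around
  \<open>x\<close> that does not contain \<open>y\<close>. A curve from \<open>x\<close> to
  \<open>y\<close> has to cross the shell between the centre and the boundary, which costs at
  least \<open>m * r\<close>.
\<close>

lemma dist_g_eq_0:
  assumes "dist_g x y = 0"
  shows "x = y"
proof (rule ccontr)
  assume "x \<noteq> y"
  let ?c = "chart_at A x"
  note c = chart_at[of x]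
  let ?p = "snd ?c x"
  obtain V m where V: "open V" "x \<in> V" "V \<subseteq> fst ?c" and m: "0 < m"
    "\<And>x v. x \<in> V \<Longrightarrow> m * norm v \<le> chart_norm ?c x v"
    using chart_norm_bounds[OF c] by blast
  have "open (snd ?c ` (fst ?c \<inter> (V - {y})))"
    by (rule open_chart_image[OF c(1)]) (use V in auto)
  moreover have "?p \<in> snd ?c ` (fst ?c \<inter> (V - {y}))" using c V \<open>x \<noteq> y\<close> by blast
  ultimately obtain r where r: "0 < r" "cball ?p r \<subseteq> snd ?c ` (fst ?c \<inter> (V - {y}))"
    using open_contains_cball by blast
  define U where "U = snd ?c -` ball ?p r \<inter> fst ?c"
  define K where "K = chart_inv ?c ` cball ?p r"
  have oU: "open U" unfolding U_def by (intro open_preimage open_dom continuous_chart c open_ball)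
  have "compact (cball ?p r)" by (simp add: compact_eq_bounded_closed)
  then have "compact K" unfolding K_def
    by (rule compact_continuous_image[rotated])
      (use r c in \<open>blast intro: continuous_on_subset[OF continuous_chart_inv]\<close>)
  then have cK: "closed K" by (rule compact_imp_closed)
  have K: "z \<in> V - {y} \<and> dist ?p (snd ?c z) \<le> r" if "z \<in> K" for z
  proof -
    obtain q where q: "q \<in> cball ?p r" "z = chart_inv ?c q" using \<open>z \<in> K\<close> by (auto simp: K_def)
    then obtain z' where "z' \<in> fst ?c \<inter> (V - {y})" "q = snd ?c z'" using r by blast
    then show ?thesis using q c by auto
  qed
  have UK: "U \<subseteq> K"
  proof
    fix z assume z: "z \<in> U"
    then have "z = chart_inv ?c (snd ?c z)" using c by (simp add: U_def)
    then show "z \<in> K" unfolding K_def using z by (intro image_eqI[of _ _ "snd ?c z"]) (auto simp: U_def)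
  qed
  \<comment> \<open>Up to time \<open>b\<close> the curve either has paid for its displacement or has paid for a whole radius.
    The case distinction makes the claim inductive over the pieces.\<close>
  have exit: "(\<gamma> b \<in> U \<and> ennreal (m * norm (snd ?c (\<gamma> b) - ?p)) \<le> len \<gamma> a b) \<or> ennreal (m * r) \<le> len \<gamma> a b"
    if "piecewise \<gamma> a b" "\<gamma> a = x" for \<gamma> a b
    using that
  proof (induction rule: piecewise.induct)
    case piecewise_refl
    then show ?case using c r by (simp add: U_def)
  next
    case (piecewise_step b b')
    have split: "len \<gamma> a b' = len \<gamma> a b + len \<gamma> b b'"
      by (rule len_trans[OF piecewise_step(1) piecewise_single[OF piecewise_step(2,3)]])
    consider "ennreal (m * r) \<le> len \<gamma> a b"
      | "\<gamma> b \<in> U" "ennreal (m * norm (snd ?c (\<gamma> b) - ?p)) \<le> len \<gamma> a b"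
      using piecewise_step by blast
    then show ?case
    proof cases
      case 1
      then show ?thesis using split by (metis add_increasing2 zero_le)
    next
      case 2
      have \<gamma>: "continuous_on {b..b'} \<gamma>" using piecewise_step(3) by (simp add: C1_curve_on_def)
      have arc: "ennreal (m * norm (snd ?c (\<gamma> \<tau>) - ?p)) \<le> len \<gamma> a b'"
        if \<tau>: "b \<le> \<tau>" "\<tau> \<le> b'" "\<And>t. t \<in> {b..\<tau>} \<Longrightarrow> \<gamma> t \<in> K" for \<tau>
      proof -
        have le: "norm (snd ?c (\<gamma> \<tau>) - ?p) \<le> norm (snd ?c (\<gamma> b) - ?p) + norm (snd ?c (\<gamma> \<tau>) - snd ?c (\<gamma> b))"
          using norm_triangle_ineq[of "snd ?c (\<gamma> b) - ?p" "snd ?c (\<gamma> \<tau>) - snd ?c (\<gamma> b)"] by simp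
        have "ennreal (m * norm (snd ?c (\<gamma> \<tau>) - ?p)) \<le>
            ennreal (m * norm (snd ?c (\<gamma> b) - ?p) + m * norm (snd ?c (\<gamma> \<tau>) - snd ?c (\<gamma> b)))"
          using mult_left_mono[OF le, of m] m by (intro ennreal_leI) (simp add: distrib_left)
        also have "\<dots> = ennreal (m * norm (snd ?c (\<gamma> b) - ?p)) + ennreal (m * norm (snd ?c (\<gamma> \<tau>) - snd ?c (\<gamma> b)))"
          using m by (intro ennreal_plus) auto
        also have "\<dots> \<le> len \<gamma> a b + len \<gamma> b b'"
        proof (intro add_mono 2(2))
          show "ennreal (m * norm (snd ?c (\<gamma> \<tau>) - snd ?c (\<gamma> b))) \<le> len \<gamma> b b'"
            using \<tau> K V m by (intro len_lower_bound[OF piecewise_step(3) _ _ c(1), where V = V]) auto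
        qed
        finally show ?thesis using split by simp
      qed
      show ?thesis
      proof (cases "\<forall>t\<in>{b..b'}. \<gamma> t \<in> U")
        case True
        have "ennreal (m * norm (snd ?c (\<gamma> b') - ?p)) \<le> len \<gamma> a b'"
          by (rule arc) (use True UK piecewise_step(2) in auto)
        then show ?thesis using True piecewise_step(2) by auto
      next
        case False
        \<comment> \<open>The minimum \<open>\<tau>\<close> of \<open>?E\<close> is the first exit time from \<open>U\<close>; it lies on the boundary sphere.\<close>
        let ?E = "{b..b'} \<inter> \<gamma> -` (- U)"
        have "closed ?E"
          by (rule continuous_closed_preimage[OF \<gamma>]) (use oU in auto)
        then have "compact ?E" by (simp add: compact_eq_bounded_closed bounded_Int)
        moreover have "?E \<noteq> {}" using False by auto
        ultimately obtain \<tau> where \<tau>: "\<tau> \<in> ?E" "\<forall>t\<in>?E. \<tau> \<le> t"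
          by (rule compact_attains_inf[THEN bexE])
        have b\<tau>: "b < \<tau>" using \<tau>(1) 2(1) by (cases "b = \<tau>") auto
        have before: "\<gamma> t \<in> U" if "t \<in> {b..<\<tau>}" for t
        proof (rule ccontr)
          assume "\<gamma> t \<notin> U"
          with that \<tau>(1) have "t \<in> ?E" by auto
          with \<tau>(2) have "\<tau> \<le> t" by blast
          with that show False by simp
        qed
        have "\<gamma> ` closure {b..<\<tau>} \<subseteq> K"
        proof (rule image_closure_subset[OF _ cK])
          show "continuous_on (closure {b..<\<tau>}) \<gamma>"
            using \<tau>(1) b\<tau> by (intro continuous_on_subset[OF \<gamma>]) auto
        qed (use before UK in blast)
        then have inK: "\<gamma> t \<in> K" if "t \<in> {b..\<tau>}" for t
          using that b\<tau> by (auto simp: closure_atLeastLessThan)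
        have "\<not> dist ?p (snd ?c (\<gamma> \<tau>)) < r"
          using \<tau>(1) K[OF inK[of \<tau>]] V b\<tau> by (auto simp: U_def)
        then have "norm (snd ?c (\<gamma> \<tau>) - ?p) = r"
          using K[OF inK[of \<tau>]] b\<tau> by (simp add: dist_norm norm_minus_commute)
        moreover have "ennreal (m * norm (snd ?c (\<gamma> \<tau>) - ?p)) \<le> len \<gamma> a b'"
          by (rule arc) (use inK \<tau>(1) in auto)
        ultimately show ?thesis by simp
      qed
    qed
  qed
  have "ennreal (m * r) \<le> dist_g x y"
    unfolding dist_g_eq
  proof (rule INF_greatest, clarify)
    fix \<gamma> assume \<gamma>: "piecewise \<gamma> 0 1" "x = \<gamma> 0" "y = \<gamma> 1"
    have "\<gamma> 1 \<notin> U" using UK K \<gamma>(3) by blast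
    then show "ennreal (m * r) \<le> len \<gamma> 0 1" using exit[OF \<gamma>(1)] \<gamma>(2) by auto
  qed
  with assms m r show False by simp
qed

end

section \<open>Compactness\<close>

text \<open>
  The form in which compactness yields uniformity: a condition that fails in the limit fails at a
  finite stage.
\<close>

lemma compact_decreasing_empty:
  fixes C :: "nat \<Rightarrow> 'a::topological_space set"
  assumes "compact K" and "\<And>n. closed (C n)" and "decseq C" and "K \<inter> (\<Inter>n. C n) = {}"
  shows "\<exists>n. K \<inter> C n = {}"
proof (rule ccontr)
  assume no: "\<not> ?thesis"
  have "K \<inter> \<Inter>(C ` UNIV) \<noteq> {}"
  proof (rule compact_imp_fip_image[OF assms(1)])
    show "closed (C i)" for i by (rule assms(2))
    fix I :: "nat set" assume I: "finite I"
    have "C (Max (insert 0 I)) \<subseteq> C i" if "i \<in> I" for i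
      by (rule decseqD[OF \<open>decseq C\<close>]) (use I that in auto)
    then have "C (Max (insert 0 I)) \<subseteq> \<Inter>(C ` I)" by blast
    then show "K \<inter> \<Inter>(C ` I) \<noteq> {}" using no by blast
  qed
  with assms(4) show False by simp
qed

lemma compact_UNIV_fun:
  assumes "compact (UNIV :: 'b::topological_space set)"
  shows "compact (UNIV :: ('a \<Rightarrow> 'b) set)"
  using compactin_PiE[of "\<lambda>_. euclidean" UNIV "\<lambda>_::'a. UNIV :: 'b set"] assms
  by (simp add: euclidean_product_topology PiE_UNIV_domain Pi_UNIV)

text \<open>
  The closed graph theorem for a relation \<open>G\<close> that is a function over the open set
  \<open>U\<close> only: the points with a value outside the open set \<open>V\<close> are the
  projection of a compact set.
\<close>

lemma continuous_off_closed_graph: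
  fixes h :: "'a::t2_space \<Rightarrow> 'b::t2_space"
  assumes ca: "compact (UNIV :: 'a set)" and cb: "compact (UNIV :: 'b set)"
    and G: "closed G" and U: "open U"
    and graph: "\<And>x y. x \<in> U \<Longrightarrow> (x, y) \<in> G \<longleftrightarrow> y = h x"
  shows "continuous_on U h"
  unfolding continuous_on_open_vimage[OF U]
proof (intro allI impI)
  fix V :: "'b set" assume V: "open V"
  have "compact (UNIV :: ('a \<times> 'b) set)"
    using compact_Times[OF ca cb] by simp
  moreover have "closed (G \<inter> (UNIV \<times> - V))"
    using G V by (intro closed_Int closed_Times) auto
  ultimately have "compact (G \<inter> (UNIV \<times> - V))"
    by (metis compact_Int_closed inf_top_left)
  then have "closed (fst ` (G \<inter> (UNIV \<times> - V)))"
    by (intro compact_imp_closed compact_continuous_image continuous_intros)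
  moreover have "h -` V \<inter> U = U - fst ` (G \<inter> (UNIV \<times> - V))"
    using graph by (force simp: image_iff)
  ultimately show "open (h -` V \<inter> U)"
    using U by auto
qed

section \<open>Expansive homeomorphisms with local product structure\<close>

text \<open>
  The topological setting of the construction. The metric is extended: points in different
  components have distance \<open>\<infinity>\<close>. The topology enters as that of the type,
  and is compatible with \<open>d\<close> by \<open>d_nbhd\<close> and compactness.
\<close>

locale expansive_product =
  fixes d :: "'m::t2_space \<Rightarrow> 'm \<Rightarrow> ennreal" and f :: "'m \<Rightarrow> 'm" and \<rho> \<epsilon> \<delta> :: real
  assumes compact_M: "compact (UNIV :: 'm set)"
    and bij_f: "bij f"
    and cont_f: "continuous_on UNIV f" and cont_inv_f: "continuous_on UNIV (inv f)"
    and d_eq_0: "\<And>x y. d x y = 0 \<longleftrightarrow> x = y"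
    and d_sym: "\<And>x y. d x y = d y x"
    and d_triangle: "\<And>x y z. d x z \<le> d x y + d y z"
    and d_nbhd: "\<And>x r. 0 < r \<Longrightarrow> \<exists>V. open V \<and> x \<in> V \<and> (\<forall>y\<in>V. d x y < ennreal r)"
    and expansive: "expansivity_constant d f \<rho>"
    and eps: "0 < \<epsilon>" "\<epsilon> < \<rho> / 4"
    and product: "local_product d f \<epsilon> \<delta>"
begin

lemma delta_pos: "0 < \<delta>"
  using product by (simp add: local_product_def)

lemma d_refl [simp]: "d x x = 0"
  by (simp add: d_eq_0)

lemma d_triangle_le:
  assumes "d x y \<le> ennreal a" "d y z \<le> ennreal b" "0 \<le> a" "0 \<le> b" "a + b \<le> c"
  shows "d x z \<le> ennreal c"
proof -
  have "d x z \<le> ennreal a + ennreal b"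
    using d_triangle[of x z y] assms(1,2) by (meson add_mono order_trans)
  then show ?thesis
    using assms by (metis ennreal_leI ennreal_plus order_trans)
qed

lemma open_d_less: "open {(x, y). d x y < ennreal r}"
proof (subst open_prod_def, intro ballI, clarify)
  fix x y assume less: "d x y < ennreal r"
  then obtain u where u: "d x y = ennreal u" "0 \<le> u"
    by (cases "d x y") auto
  with less have ur: "u < r" by (simp add: ennreal_less_iff)
  define e where "e = (r - u) / 3"
  have e: "0 < e" using ur by (simp add: e_def)
  obtain V where V: "open V" "x \<in> V" "\<forall>z\<in>V. d x z < ennreal e"
    using d_nbhd[OF e] by blast
  obtain W where W: "open W" "y \<in> W" "\<forall>z\<in>W. d y z < ennreal e"
    using d_nbhd[OF e] by blast
  have "d x' y' < ennreal r" if "x' \<in> V" "y' \<in> W" for x' y'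
  proof -
    have 1: "d x' y \<le> ennreal (e + u)"
      by (rule d_triangle_le[of _ x e _ u]) (use V that u e d_sym[of x' x] in auto)
    have "d x' y' \<le> ennreal (e + u + e)"
      by (rule d_triangle_le[OF 1, of _ e]) (use W that u e in auto)
    also have "\<dots> < ennreal r"
      using ur u(2) e by (intro ennreal_lessI) (auto simp: e_def field_simps)
    finally show ?thesis .
  qed
  then show "\<exists>A B. open A \<and> open B \<and> (x, y) \<in> A \<times> B \<and> A \<times> B \<subseteq> {(x, y). d x y < ennreal r}"
    using V W by (intro exI[of _ V] exI[of _ W]) auto
qed

lemma closed_d_le:
  assumes "0 \<le> r"
  shows "closed {(x, y). d x y \<le> ennreal r}"
proof -
  have "open {(x, y). ennreal r < d x y}"
  proof (subst open_prod_def, intro ballI, clarify)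
    fix x y assume less: "ennreal r < d x y"
    have "\<exists>e>0. ennreal (e + r + e) < d x y"
    proof (cases "d x y")
      case (real u)
      then have "r < u" using less assms by (simp add: ennreal_less_iff)
      then show ?thesis using real assms
        by (intro exI[of _ "(u - r) / 3"]) (auto simp: ennreal_less_iff field_simps)
    next
      case top then show ?thesis by (intro exI[of _ 1]) auto
    qed
    then obtain e where e: "0 < e" "ennreal (e + r + e) < d x y" by blast
    obtain V where V: "open V" "x \<in> V" "\<forall>z\<in>V. d x z < ennreal e"
      using d_nbhd[OF e(1)] by blast
    obtain W where W: "open W" "y \<in> W" "\<forall>z\<in>W. d y z < ennreal e"
      using d_nbhd[OF e(1)] by blast
    have "ennreal r < d x' y'" if "x' \<in> V" "y' \<in> W" for x' y'
    proof (rule ccontr)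
      assume "\<not> ?thesis"
      then have le: "d x' y' \<le> ennreal r" by simp
      have 1: "d x y' \<le> ennreal (e + r)"
        by (rule d_triangle_le[of _ x' e _ r]) (use V that le e assms in auto)
      have "d x y \<le> ennreal (e + r + e)"
        by (rule d_triangle_le[OF 1, of _ e]) (use W that d_sym[of y y'] e assms in auto)
      then show False using e by auto
    qed
    then show "\<exists>A B. open A \<and> open B \<and> (x, y) \<in> A \<times> B \<and> A \<times> B \<subseteq> {(x, y). ennreal r < d x y}"
      using V W by (intro exI[of _ V] exI[of _ W]) auto
  qed
  moreover have "{(x, y). d x y \<le> ennreal r} = - {(x, y). ennreal r < d x y}"
    by auto
  ultimately show ?thesis by auto
qed

lemma compact_MM: "compact (UNIV :: ('m \<times> 'm) set)"
  using compact_Times[OF compact_M compact_M] by simp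

lemma small_distance:
  assumes "open W" and "\<And>x. (x, x) \<in> W"
  shows "\<exists>r>0. \<forall>x y. d x y \<le> ennreal r \<longrightarrow> (x, y) \<in> W"
proof -
  let ?C = "\<lambda>n::nat. {(x, y). d x y \<le> ennreal (1 / Suc n)}"
  have "\<exists>n. - W \<inter> ?C n = {}"
  proof (rule compact_decreasing_empty)
    show "compact (- W)"
      using compact_MM \<open>open W\<close> by (metis closed_Compl compact_Int_closed inf_top_left)
    show "closed (?C n)" for n by (rule closed_d_le) simp
    show "decseq ?C"
    proof (rule decseq_SucI)
      fix n
      have "ennreal (1 / Suc (Suc n)) \<le> ennreal (1 / Suc n)"
        by (intro ennreal_leI) (simp add: field_simps)
      then show "?C (Suc n) \<subseteq> ?C n" by (auto intro: order_trans)
    qed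
    have "x = y" if *: "\<And>n. d x y \<le> ennreal (1 / real (Suc n))" for x y
    proof (rule ccontr)
      assume "x \<noteq> y"
      then have pos: "0 < d x y" by (simp add: d_eq_0 zero_less_iff_neq_zero)
      have "d x y \<noteq> top" using *[of 0] by (auto simp: top_unique)
      then obtain u where u: "d x y = ennreal u" "u > 0"
        using pos by (cases "d x y") auto
      obtain n where "1 / real (Suc n) < u"
        using u(2) reals_Archimedean by (auto simp: inverse_eq_divide)
      with *[of n] u show False by (simp add: ennreal_le_iff2)
    qed
    then show "- W \<inter> (\<Inter>n. ?C n) = {}"
      using assms(2) by fastforce
  qed
  then obtain n where "- W \<inter> ?C n = {}" by blast
  then show ?thesis
    by (intro exI[of _ "1 / Suc n"]) auto
qed

abbreviation it where "it \<equiv> iter f"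

lemma it_0 [simp]: "it 0 = id"
  by (simp add: iter_def)

lemma f_inv [simp]: "f (inv f x) = x" and inv_f [simp]: "inv f (f x) = x"
  using bij_f by (simp_all add: bij_is_surj surj_f_inv_f bij_is_inj)

lemma it_add_1: "it (n + 1) x = it n (f x)"
proof (cases "n \<ge> 0")
  case True
  then show ?thesis
    by (simp add: iter_def nat_add_distrib funpow_swap1)
next
  case False
  then have "nat (- n) = Suc (nat (- (n + 1)))" by simp
  then show ?thesis using False
    by (auto simp: iter_def funpow_swap1)
qed

lemma it_diff_1: "it (n - 1) x = it n (inv f x)"
  using it_add_1[of "n - 1" "inv f x"] by simp

lemma it_add: "it (m + n) x = it m (it n x)"
proof (induction n arbitrary: x rule: int_induct[where k = 0])
  case (step1 n)
  show ?case using step1(2)[of "f x"] by (simp add: it_add_1 flip: add.assoc)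
next
  case (step2 n)
  have "it (m + (n - 1)) x = it ((m + n) - 1) x" by (simp add: algebra_simps)
  then show ?case using step2(2)[of "inv f x"] by (simp add: it_diff_1)
qed simp

lemma it_1 [simp]: "it 1 = f" and it_m1 [simp]: "it (-1) = inv f"
  by (simp_all add: iter_def)

lemma continuous_it: "continuous_on UNIV (it n)"
proof (induction n rule: int_induct[where k = 0])
  case (step1 n)
  have "it (n + 1) = it n \<circ> f" by (auto simp: it_add_1)
  then show ?case using step1(2) cont_f
    by (metis continuous_on_compose continuous_on_subset top_greatest)
next
  case (step2 n)
  have "it (n - 1) = it n \<circ> inv f" by (auto simp: it_diff_1)
  then show ?case using step2(2) cont_inv_f
    by (metis continuous_on_compose continuous_on_subset top_greatest)
qed (simp add: continuous_on_id)

lemma closed_it_le: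
  assumes "0 \<le> r" and "continuous_on UNIV h" "continuous_on UNIV k"
  shows "closed {z. d (h z) (k z) \<le> ennreal r}"
proof -
  have "{z. d (h z) (k z) \<le> ennreal r} = (\<lambda>z. (h z, k z)) -` {(x, y). d x y \<le> ennreal r}" by auto
  moreover have "closed \<dots>"
    using assms by (intro closed_vimage closed_d_le continuous_on_Pair)
  ultimately show ?thesis by simp
qed

lemma continuous_it_comp:
  "continuous_on S h \<Longrightarrow> continuous_on S (\<lambda>z. it n (h z))"
  using continuous_on_compose2[OF continuous_it] by blast

end

context expansive_product
begin

abbreviation ws where "ws \<equiv> Ws d f"
abbreviation wu where "wu \<equiv> Wu d f"
abbreviation br where "br \<equiv> bracket d f \<epsilon>"

lemma iter_inv: "iter (inv f) n = it (- n)"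
  using bij_f by (auto simp: iter_def inv_inv_eq)

lemma Ws_inv: "Ws d (inv f) \<eta> x = wu \<eta> x" and Wu_inv: "Wu d (inv f) \<eta> x = ws \<eta> x"
proof -
  have 1: "(\<forall>n\<ge>0. Q (- n)) \<longleftrightarrow> (\<forall>n\<le>0. Q n)" for Q :: "int \<Rightarrow> bool"
    by (metis minus_minus neg_0_le_iff_le)
  have 2: "(\<forall>n\<le>0. Q (- n)) \<longleftrightarrow> (\<forall>n\<ge>0. Q n)" for Q :: "int \<Rightarrow> bool"
    by (metis minus_minus neg_0_le_iff_le)
  show "Ws d (inv f) \<eta> x = wu \<eta> x" "Wu d (inv f) \<eta> x = ws \<eta> x"
    unfolding Ws_def Wu_def iter_inv
    by (simp_all add: 1[of "\<lambda>n. d (it n x) (it n _) \<le> _"] 2[of "\<lambda>n. d (it n x) (it n _) \<le> _"])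
qed

lemma bracket_inv: "bracket d (inv f) \<epsilon> x y = br y x"
  by (simp add: bracket_def Ws_inv Wu_inv Int_commute)

lemma dual: "expansive_product d (inv f) \<rho> \<epsilon> \<delta>"
proof
  show "bij (inv f)" using bij_f by (rule bij_imp_bij_inv)
  show "continuous_on UNIV (inv (inv f))" using cont_f bij_f by (simp add: inv_inv_eq)
  have "(\<forall>n. d (it (- n) x) (it (- n) y) \<le> ennreal \<rho>) \<longleftrightarrow> (\<forall>n. d (it n x) (it n y) \<le> ennreal \<rho>)" for x y
    by (metis minus_minus)
  then show "expansivity_constant d (inv f) \<rho>"
    using expansive unfolding expansivity_constant_def iter_inv by simp
  show "local_product d (inv f) \<epsilon> \<delta>"
    using product unfolding local_product_def Ws_inv Wu_inv
    by (simp add: Int_commute d_sym)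
qed (use compact_M cont_inv_f d_eq_0 d_triangle d_nbhd eps in \<open>auto intro: d_sym\<close>)

lemma wsI: "(\<And>n. 0 \<le> n \<Longrightarrow> d (it n x) (it n y) \<le> ennreal \<eta>) \<Longrightarrow> y \<in> ws \<eta> x"
  and wsD: "y \<in> ws \<eta> x \<Longrightarrow> 0 \<le> n \<Longrightarrow> d (it n x) (it n y) \<le> ennreal \<eta>"
  and wuI: "(\<And>n. n \<le> 0 \<Longrightarrow> d (it n x) (it n y) \<le> ennreal \<eta>) \<Longrightarrow> y \<in> wu \<eta> x"
  and wuD: "y \<in> wu \<eta> x \<Longrightarrow> n \<le> 0 \<Longrightarrow> d (it n x) (it n y) \<le> ennreal \<eta>"
  by (auto simp: Ws_def Wu_def)

lemma ws_sym: "y \<in> ws \<eta> x \<longleftrightarrow> x \<in> ws \<eta> y" and wu_sym: "y \<in> wu \<eta> x \<longleftrightarrow> x \<in> wu \<eta> y"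
  by (auto simp: Ws_def Wu_def d_sym)

lemma ws_refl [simp]: "x \<in> ws \<eta> x" and wu_refl [simp]: "x \<in> wu \<eta> x"
  by (auto simp: Ws_def Wu_def)

lemma ws_trans:
  "\<lbrakk>y \<in> ws a x; z \<in> ws b y; 0 \<le> a; 0 \<le> b; a + b \<le> c\<rbrakk> \<Longrightarrow> z \<in> ws c x"
  by (rule wsI) (rule d_triangle_le, auto dest: wsD)

lemma wu_trans:
  "\<lbrakk>y \<in> wu a x; z \<in> wu b y; 0 \<le> a; 0 \<le> b; a + b \<le> c\<rbrakk> \<Longrightarrow> z \<in> wu c x"
  by (rule wuI) (rule d_triangle_le, auto dest: wuD)

lemma ws_f: "y \<in> ws \<eta> x \<Longrightarrow> f y \<in> ws \<eta> (f x)"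
  by (rule wsI) (simp flip: it_add_1 add: wsD)

lemma wu_inv_f: "y \<in> wu \<eta> x \<Longrightarrow> inv f y \<in> wu \<eta> (inv f x)"
  by (rule wuI) (simp flip: it_diff_1 add: wuD)

lemma wu_f:
  assumes "y \<in> wu \<eta> x" "d (f x) (f y) \<le> ennreal \<eta>"
  shows "f y \<in> wu \<eta> (f x)"
proof (rule wuI)
  fix n :: int assume "n \<le> 0"
  then show "d (it n (f x)) (it n (f y)) \<le> ennreal \<eta>"
    using assms wuD[of y \<eta> x "n + 1"] by (cases "n = 0") (auto simp flip: it_add_1)
qed

lemma expansive_D: "\<forall>n. d (it n x) (it n y) \<le> ennreal \<rho> \<Longrightarrow> y = x"
  using expansive by (simp add: expansivity_constant_def)

lemma expansive_eq:
  assumes "y \<in> ws \<rho> x" "y \<in> wu \<rho> x"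
  shows "y = x"
proof -
  have "d (it n x) (it n y) \<le> ennreal \<rho>" for n
    using wsD[OF assms(1), of n] wuD[OF assms(2), of n] by linarith
  then show ?thesis by (intro expansive_D) simp
qed

lemma br_mem:
  assumes "d x y < ennreal \<delta>"
  shows br_ws: "br x y \<in> ws \<epsilon> x" and br_wu: "br x y \<in> wu \<epsilon> y"
proof -
  have "\<exists>!z. z \<in> ws \<epsilon> x \<inter> wu \<epsilon> y"
    using assms product unfolding local_product_def by blast
  then have "br x y \<in> ws \<epsilon> x \<inter> wu \<epsilon> y"
    unfolding bracket_def by (rule theI')
  then show "br x y \<in> ws \<epsilon> x" "br x y \<in> wu \<epsilon> y" by blast+
qed

text \<open>
  The orbits of \<open>z\<close> and of the bracket stay within \<open>4 * \<epsilon> <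
  \<rho>\<close> of each other, so that expansivity applies. The slack between
  \<open>\<epsilon>\<close> and \<open>3 * \<epsilon>\<close> is what makes nested brackets
  collapse.
\<close>

lemma br_eqI:
  assumes "d x y < ennreal \<delta>" "z \<in> ws a x" "z \<in> wu b y"
    "0 \<le> a" "a \<le> 3 * \<epsilon>" "0 \<le> b" "b \<le> 3 * \<epsilon>"
  shows "br x y = z"
proof (rule expansive_eq)
  show "br x y \<in> ws \<rho> z"
    by (rule ws_trans[OF _ br_ws[OF assms(1)], of a]) (use assms eps ws_sym in auto)
  show "br x y \<in> wu \<rho> z"
    by (rule wu_trans[OF _ br_wu[OF assms(1)], of b]) (use assms eps wu_sym in auto)
qed

lemma br_refl [simp]: "br x x = x"
  by (rule br_eqI[of _ _ _ \<epsilon> \<epsilon>]) (use delta_pos eps in auto)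

text \<open>
  In product coordinates the bracket forgets one coordinate of each argument.
\<close>

lemma br_left_cong:
  assumes "z \<in> ws a x" "0 \<le> a" "a \<le> 2 * \<epsilon>" "d z p < ennreal \<delta>" "d x p < ennreal \<delta>"
  shows "br z p = br x p"
proof (rule sym, rule br_eqI)
  show "br z p \<in> ws (3 * \<epsilon>) x"
    by (rule ws_trans[OF assms(1) br_ws[OF assms(4)]]) (use assms eps in auto)
  show "br z p \<in> wu \<epsilon> p" by (rule br_wu) fact
qed (use assms eps in auto)

lemma br_right_cong:
  assumes "z \<in> wu a y" "0 \<le> a" "a \<le> 2 * \<epsilon>" "d p z < ennreal \<delta>" "d p y < ennreal \<delta>"
  shows "br p z = br p y"
proof (rule sym, rule br_eqI)
  show "br p z \<in> wu (3 * \<epsilon>) y"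
    by (rule wu_trans[OF assms(1) br_wu[OF assms(4)]]) (use assms eps in auto)
  show "br p z \<in> ws \<epsilon> p" by (rule br_ws) fact
qed (use assms eps in auto)

lemma br_eq_right: "\<lbrakk>z \<in> wu \<epsilon> x; d z x < ennreal \<delta>\<rbrakk> \<Longrightarrow> br z x = z"
  by (rule br_eqI[of _ _ _ \<epsilon> \<epsilon>]) (use eps in auto)

lemma br_eq_left: "\<lbrakk>z \<in> ws \<epsilon> x; d x z < ennreal \<delta>\<rbrakk> \<Longrightarrow> br x z = z"
  by (rule br_eqI[of _ _ _ \<epsilon> \<epsilon>]) (use eps in auto)

lemma br_br:
  assumes "d x p < ennreal \<delta>" "d q x < ennreal \<delta>" "d (br x p) (br q x) < ennreal \<delta>"
  shows "br (br x p) (br q x) = x"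
  by (rule br_eqI[of _ _ _ \<epsilon> \<epsilon>]) (use assms br_ws[of x p] br_wu[of q x] ws_sym wu_sym eps in auto)

lemma closed_it: "0 \<le> r \<Longrightarrow> closed {z. d (it n (fst z)) (it n (snd z)) \<le> ennreal r}"
  by (rule closed_it_le[OF _ continuous_it_comp[OF continuous_on_fst[OF continuous_on_id]]
        continuous_it_comp[OF continuous_on_snd[OF continuous_on_id]]])

lemma closed_ws: "closed {(x, y). y \<in> ws \<epsilon> x}" and closed_wu: "closed {(x, y). y \<in> wu \<epsilon> x}"
proof -
  have *: "closed (\<Inter>n\<in>I. {z. d (it n (fst z)) (it n (snd z)) \<le> ennreal \<epsilon>})" for I :: "int set"
    by (intro closed_INT ballI closed_it) (use eps in auto)
  have "{(x, y). y \<in> ws \<epsilon> x} = (\<Inter>n\<in>{0..}. {z. d (it n (fst z)) (it n (snd z)) \<le> ennreal \<epsilon>})"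
    "{(x, y). y \<in> wu \<epsilon> x} = (\<Inter>n\<in>{..0}. {z. d (it n (fst z)) (it n (snd z)) \<le> ennreal \<epsilon>})"
    by (auto simp: Ws_def Wu_def)
  then show "closed {(x, y). y \<in> ws \<epsilon> x}" "closed {(x, y). y \<in> wu \<epsilon> x}"
    using * by simp_all
qed

text \<open>
  The relation \<open>z \<in> W\<^sup>s(x) \<inter> W\<^sup>u(y)\<close> is closed, and it is a
  function of \<open>(x, y)\<close> on the open domain of the bracket.
\<close>

lemma continuous_br: "continuous_on {(x, y). d x y < ennreal \<delta>} (\<lambda>(x, y). br x y)"
proof (rule continuous_off_closed_graph[OF compact_MM compact_M])
  let ?G = "{z :: ('m \<times> 'm) \<times> 'm. snd z \<in> ws \<epsilon> (fst (fst z))} \<inter>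
    {z. snd z \<in> wu \<epsilon> (snd (fst z))}"
  have "{z :: ('m \<times> 'm) \<times> 'm. snd z \<in> ws \<epsilon> (fst (fst z))} =
      (\<lambda>z. (fst (fst z), snd z)) -` {(x, y). y \<in> ws \<epsilon> x}"
    "{z :: ('m \<times> 'm) \<times> 'm. snd z \<in> wu \<epsilon> (snd (fst z))} =
      (\<lambda>z. (snd (fst z), snd z)) -` {(x, y). y \<in> wu \<epsilon> x}"
    by auto
  then show "closed ?G"
    by (simp only:) (intro closed_Int closed_vimage closed_ws closed_wu continuous_intros)
  show "open {(x, y). d x y < ennreal \<delta>}" by (rule open_d_less)
  show "(x, y) \<in> ?G \<longleftrightarrow> y = (\<lambda>(x, y). br x y) x" if "x \<in> {(x, y). d x y < ennreal \<delta>}" for x y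
    using that br_ws br_wu br_eqI[of _ _ _ \<epsilon> \<epsilon>] eps by (cases x) fastforce
qed

lemma uniform_expansive:
  assumes "0 < r"
  shows "\<exists>N. \<forall>x y. (\<forall>n. \<bar>n\<bar> \<le> int N \<longrightarrow> d (it n x) (it n y) \<le> ennreal \<rho>) \<longrightarrow> d x y \<le> ennreal r"
proof -
  let ?C = "\<lambda>N::nat. \<Inter>n\<in>{- int N..int N}. {z. d (it n (fst z)) (it n (snd z)) \<le> ennreal \<rho>}"
  have "\<exists>N. - {(x, y). d x y < ennreal r} \<inter> ?C N = {}"
  proof (rule compact_decreasing_empty)
    show "compact (- {(x, y). d x y < ennreal r})"
      using compact_MM open_d_less by (metis closed_Compl compact_Int_closed inf_top_left)
    show "closed (?C N)" for N
      by (intro closed_INT ballI closed_it) (use eps in auto)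
    show "decseq ?C" by (rule decseq_SucI) (rule INF_superset_mono, auto)
    have "x = y" if *: "\<forall>N. (x, y) \<in> ?C N" for x y
    proof -
      have "d (it n x) (it n y) \<le> ennreal \<rho>" for n
        using INT_D[OF *[rule_format, of "nat \<bar>n\<bar>"], of n] by simp linarith
      then show ?thesis by (intro expansive_D[symmetric]) simp
    qed
    then show "- {(x, y). d x y < ennreal r} \<inter> (\<Inter>N. ?C N) = {}"
      using assms by fastforce
  qed
  then obtain N where "- {(x, y). d x y < ennreal r} \<inter> ?C N = {}" by blast
  then show ?thesis
    by (intro exI[of _ N]) (force simp: abs_le_iff)
qed

end

section \<open>A Markov cover from pseudo-orbits\<close>

text \<open>
  \<open>forward\<close> and \<open>backward\<close> assert, for a successor \<open>T j\<close> of
  \<open>T k\<close> along the orbit of \<open>x\<close>, that \<open>f\<close> maps the stable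
  slice of \<open>T k\<close> into \<open>T j\<close>, and its inverse maps the unstable slice of
  \<open>T j\<close> into \<open>T k\<close>. The first finds a successor of a given \<open>T
  k\<close>, the second a predecessor of a given \<open>T j\<close>; the inverse of
  \<open>f\<close> exchanges them, so that the locale is invariant under time reversal. The
  remaining conditions keep all brackets that occur within their domain.
\<close>

locale markov_cover = expansive_product d f \<rho> \<epsilon> \<delta>
  for d :: "'m::t2_space \<Rightarrow> 'm \<Rightarrow> ennreal" and f \<rho> \<epsilon> \<delta> +
  fixes P :: "'k set" and T :: "'k \<Rightarrow> 'm set" and b :: real
  assumes finite_P: "finite P"
    and closed_T: "\<And>k. k \<in> P \<Longrightarrow> closed (T k)"
    and br_T: "\<And>k x y. \<lbrakk>k \<in> P; x \<in> T k; y \<in> T k\<rbrakk> \<Longrightarrow> br x y \<in> T k"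
    and cover: "\<And>x. \<exists>k\<in>P. x \<in> T k"
    and small: "\<And>k x y. \<lbrakk>k \<in> P; x \<in> T k; y \<in> T k\<rbrakk> \<Longrightarrow> d x y \<le> ennreal b"
    and b: "0 \<le> b" "2 * b < \<delta>"
    and small_br: "\<And>x p q. \<lbrakk>d x p \<le> ennreal (2 * b); d q x \<le> ennreal (2 * b)\<rbrakk> \<Longrightarrow>
      d (br x p) (br q x) < ennreal \<delta>"
    and small_f: "\<And>x y. d x y \<le> ennreal b \<Longrightarrow> d (f x) (f y) \<le> ennreal \<epsilon>"
    and small_inv_f: "\<And>x y. d x y \<le> ennreal b \<Longrightarrow> d (inv f x) (inv f y) \<le> ennreal \<epsilon>"
    and forward: "\<And>k x. \<lbrakk>k \<in> P; x \<in> T k\<rbrakk> \<Longrightarrow> \<exists>j\<in>P. f x \<in> T j \<and>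
      (\<forall>y\<in>T k \<inter> ws \<epsilon> x. f y \<in> T j) \<and> (\<forall>v\<in>T j \<inter> wu \<epsilon> (f x). inv f v \<in> T k)"
    and backward: "\<And>j x. \<lbrakk>j \<in> P; f x \<in> T j\<rbrakk> \<Longrightarrow> \<exists>k\<in>P. x \<in> T k \<and>
      (\<forall>y\<in>T k \<inter> ws \<epsilon> x. f y \<in> T j) \<and> (\<forall>v\<in>T j \<inter> wu \<epsilon> (f x). inv f v \<in> T k)"

context expansive_product
begin

lemma uniformly_continuous:
  assumes "continuous_on UNIV h" and "0 < r"
  shows "\<exists>s>0. \<forall>x y. d x y \<le> ennreal s \<longrightarrow> d (h x) (h y) \<le> ennreal r"
proof -
  have "open ((\<lambda>z. (h (fst z), h (snd z))) -` {(x, y). d x y < ennreal r})"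
    by (intro open_vimage open_d_less continuous_on_Pair continuous_on_compose2[OF assms(1)]
        continuous_on_fst continuous_on_snd continuous_on_id) auto
  from small_distance[OF this] \<open>0 < r\<close> show ?thesis by (auto intro: less_imp_le)
qed

lemma pseudo_orbit_close:
  "0 < r \<Longrightarrow> \<exists>\<alpha>>0. \<forall>q. (\<forall>n. d (f (q n)) (q (n + 1)) \<le> ennreal \<alpha>) \<longrightarrow>
    (\<forall>n. \<bar>n\<bar> \<le> int N \<longrightarrow> d (it n (q 0)) (q n) \<le> ennreal r)"
proof (induction N arbitrary: r)
  case 0
  then show ?case by (intro exI[of _ 1]) auto
next
  case (Suc N)
  obtain s where s: "0 < s" "\<And>x y. d x y \<le> ennreal s \<Longrightarrow> d (f x) (f y) \<le> ennreal (r / 2)"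
    using uniformly_continuous[OF cont_f, of "r / 2"] \<open>0 < r\<close> by auto
  obtain s' where s': "0 < s'" "\<And>x y. d x y \<le> ennreal s' \<Longrightarrow> d (inv f x) (inv f y) \<le> ennreal (r / 2)"
    using uniformly_continuous[OF cont_inv_f, of "r / 2"] \<open>0 < r\<close> by auto
  define t where "t = Min {r, s, s'}"
  have t: "0 < t" "t \<le> r" "t \<le> s" "t \<le> s'" using s s' \<open>0 < r\<close> by (auto simp: t_def)
  obtain \<alpha> where \<alpha>: "0 < \<alpha>" and IH: "\<And>q n. \<lbrakk>\<forall>n. d (f (q n)) (q (n + 1)) \<le> ennreal \<alpha>; \<bar>n\<bar> \<le> int N\<rbrakk> \<Longrightarrow>
      d (it n (q 0)) (q n) \<le> ennreal t"
    using Suc.IH[OF t(1)] by blast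
  define \<alpha>' where "\<alpha>' = Min {\<alpha>, s', r / 2}"
  have \<alpha>': "0 < \<alpha>'" "\<alpha>' \<le> \<alpha>" "\<alpha>' \<le> s'" "\<alpha>' \<le> r / 2" using \<alpha> s' \<open>0 < r\<close> by (auto simp: \<alpha>'_def)
  have "d (it n (q 0)) (q n) \<le> ennreal r"
    if q: "\<forall>n. d (f (q n)) (q (n + 1)) \<le> ennreal \<alpha>'" and n: "\<bar>n\<bar> \<le> int (Suc N)" for q :: "int \<Rightarrow> 'm" and n
  proof -
    have q\<alpha>: "\<forall>n. d (f (q n)) (q (n + 1)) \<le> ennreal \<alpha>"
      using q \<alpha>' by (meson ennreal_leI order_trans)
    note IH = IH[OF q\<alpha>]
    consider "\<bar>n\<bar> \<le> int N" | "n = int N + 1" | "n = - int N - 1" using n by linarith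
    then show ?thesis
    proof cases
      case 1
      then show ?thesis using IH t by (meson ennreal_leI order_trans)
    next
      case 2
      have "d (it (int N) (q 0)) (q (int N)) \<le> ennreal s"
        using IH[of "int N"] t by (simp add: ennreal_leI order_trans)
      then have "d (f (it (int N) (q 0))) (f (q (int N))) \<le> ennreal (r / 2)" by (rule s(2))
      moreover have "d (f (q (int N))) (q (int N + 1)) \<le> ennreal (r / 2)"
        using q \<alpha>' by (meson ennreal_leI order_trans)
      ultimately have "d (f (it (int N) (q 0))) (q (int N + 1)) \<le> ennreal r"
        by (rule d_triangle_le) (use \<open>0 < r\<close> in auto)
      moreover have "it n x = f (it (int N) x)" for x
        using it_add[of 1 "int N" x] by (simp add: 2 add.commute)
      ultimately show ?thesis by (simp add: 2)
    next
      case 3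
      have "d (it (- int N) (q 0)) (q (- int N)) \<le> ennreal s'"
        using IH[of "- int N"] t by (simp add: ennreal_leI order_trans)
      then have "d (inv f (it (- int N) (q 0))) (inv f (q (- int N))) \<le> ennreal (r / 2)" by (rule s'(2))
      moreover have "d (q (- int N)) (f (q (- int N - 1))) \<le> ennreal s'"
        using q[rule_format, of "- int N - 1"] \<alpha>' by (simp add: d_sym) (meson ennreal_leI order_trans)
      from s'(2)[OF this] have "d (inv f (q (- int N))) (q (- int N - 1)) \<le> ennreal (r / 2)" by simp
      ultimately have "d (inv f (it (- int N) (q 0))) (q (- int N - 1)) \<le> ennreal r"
        by (rule d_triangle_le) (use \<open>0 < r\<close> in auto)
      moreover have "it n x = inv f (it (- int N) x)" for x
      proof -
        have "n = -1 + - int N" using 3 by simp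
        then show ?thesis by (simp only: it_add it_m1)
      qed
      ultimately show ?thesis by (simp add: 3)
    qed
  qed
  then show ?case using \<alpha>'(1) by blast
qed

lemma finite_net:
  assumes "0 < r"
  shows "\<exists>P. finite P \<and> (\<forall>x. \<exists>p\<in>P. d x p \<le> ennreal r)"
proof -
  have op: "open {y. d p y < ennreal r}" for p
  proof -
    have "open (Pair p -` {(x, y). d x y < ennreal r})"
      by (intro open_vimage open_d_less continuous_on_Pair continuous_on_const continuous_on_id)
    then show ?thesis by (simp add: vimage_def)
  qed
  have "y \<in> (\<Union>p\<in>UNIV. {y. d p y < ennreal r})" for y
    by (rule UN_I[of y]) (use assms in auto)
  then have "UNIV \<subseteq> (\<Union>p\<in>UNIV. {y. d p y < ennreal r})" by blast
  then obtain P where "finite P" and P: "UNIV \<subseteq> (\<Union>p\<in>P. {y. d p y < ennreal r})"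
    using compactE_image[OF compact_M, of UNIV "\<lambda>p. {y. d p y < ennreal r}"] op by metis
  have "\<exists>p\<in>P. d x p \<le> ennreal r" for x
  proof -
    obtain p where "p \<in> P" "d p x < ennreal r"
      using P by blast
    then show ?thesis using d_sym[of p x] by (auto intro: less_imp_le)
  qed
  with \<open>finite P\<close> show ?thesis by blast
qed

definition pseudo_orbits :: "'m set \<Rightarrow> real \<Rightarrow> (int \<Rightarrow> 'm) set" where
  "pseudo_orbits P \<alpha> = {q. \<forall>n. q n \<in> P \<and> d (f (q n)) (q (n + 1)) \<le> ennreal \<alpha>}"

definition shadows :: "real \<Rightarrow> (int \<Rightarrow> 'm) \<Rightarrow> 'm \<Rightarrow> bool" where
  "shadows e q x \<longleftrightarrow> (\<forall>n. d (it n x) (q n) \<le> ennreal e)"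

lemma shadows_shift: "shadows e q x \<Longrightarrow> shadows e (\<lambda>n. q (n + m)) (it m x)"
  by (simp add: shadows_def flip: it_add)

lemma pseudo_orbits_shift: "q \<in> pseudo_orbits P \<alpha> \<Longrightarrow> (\<lambda>n. q (n + m)) \<in> pseudo_orbits P \<alpha>"
  by (auto simp: pseudo_orbits_def) (metis add.assoc add.commute)

text \<open>
  The pairs of a point and a pseudo-orbit that it shadows form a closed set in a product of
  compact spaces, and projections of compact sets are closed.
\<close>

lemma closed_shadowing_set:
  assumes "finite P" "0 \<le> \<alpha>" "0 \<le> e"
  shows "closed {x. \<exists>q\<in>pseudo_orbits P \<alpha>. q 0 = s \<and> shadows e q x}"
proof -
  let ?E = "{z :: 'm \<times> (int \<Rightarrow> 'm). snd z \<in> pseudo_orbits P \<alpha> \<and> snd z 0 = s \<and> shadows e (snd z) (fst z)}"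
  have coord: "continuous_on UNIV (\<lambda>z :: 'm \<times> (int \<Rightarrow> 'm). snd z n)" for n
    by (rule continuous_on_compose2[OF continuous_on_product_coordinates[of n]])
      (auto intro: continuous_on_snd continuous_on_id)
  have fcoord: "continuous_on UNIV (\<lambda>z :: 'm \<times> (int \<Rightarrow> 'm). f (snd z n))" for n
    by (rule continuous_on_compose2[OF cont_f coord]) auto
  have itc: "continuous_on UNIV (\<lambda>z :: 'm \<times> (int \<Rightarrow> 'm). it n (fst z))" for n
    by (intro continuous_it_comp continuous_on_fst continuous_on_id)
  have "?E = (\<Inter>n. (\<lambda>z. snd z n) -` P) \<inter> (\<Inter>n. {z. d (f (snd z n)) (snd z (n + 1)) \<le> ennreal \<alpha>}) \<inter>
      (\<lambda>z. snd z 0) -` {s} \<inter> (\<Inter>n. {z. d (it n (fst z)) (snd z n) \<le> ennreal e})"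
    by (auto simp: pseudo_orbits_def shadows_def)
  moreover have "closed \<dots>"
  proof (intro closed_Int closed_INT ballI)
    show "closed ((\<lambda>z :: 'm \<times> (int \<Rightarrow> 'm). snd z n) -` P)" for n
      by (rule closed_vimage[OF finite_imp_closed[OF assms(1)] coord])
    show "closed {z :: 'm \<times> (int \<Rightarrow> 'm). d (f (snd z n)) (snd z (n + 1)) \<le> ennreal \<alpha>}" for n
      by (rule closed_it_le[OF assms(2) fcoord coord])
    show "closed ((\<lambda>z :: 'm \<times> (int \<Rightarrow> 'm). snd z 0) -` {s})"
      by (rule closed_vimage[OF closed_singleton coord])
    show "closed {z :: 'm \<times> (int \<Rightarrow> 'm). d (it n (fst z)) (snd z n) \<le> ennreal e}" for n
      by (rule closed_it_le[OF assms(3) itc coord])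
  qed
  ultimately have "closed ?E" by (simp only:)
  moreover have "compact (UNIV :: ('m \<times> (int \<Rightarrow> 'm)) set)"
    using compact_Times[OF compact_M compact_UNIV_fun[OF compact_M]] by simp
  ultimately have "compact ?E" using compact_Int_closed[of UNIV ?E] by simp
  then have "closed (fst ` ?E)"
    by (intro compact_imp_closed compact_continuous_image continuous_on_fst continuous_on_id)
  moreover have "fst ` ?E = {x. \<exists>q\<in>pseudo_orbits P \<alpha>. q 0 = s \<and> shadows e q x}"
  proof (intro equalityI subsetI)
    fix x assume "x \<in> {x. \<exists>q\<in>pseudo_orbits P \<alpha>. q 0 = s \<and> shadows e q x}"
    then obtain q where "(x, q) \<in> ?E" by auto
    then show "x \<in> fst ` ?E" by (rule image_eqI[rotated]) simp
  qed auto
  ultimately show ?thesis by simp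
qed

definition splice :: "(int \<Rightarrow> 'm) \<Rightarrow> (int \<Rightarrow> 'm) \<Rightarrow> int \<Rightarrow> 'm" where
  "splice q q' n = (if 0 \<le> n then q n else q' n)"

lemma splice_pseudo_orbits:
  assumes "q \<in> pseudo_orbits P \<alpha>" "q' \<in> pseudo_orbits P \<alpha>" "q 0 = q' 0"
  shows "splice q q' \<in> pseudo_orbits P \<alpha>"
proof -
  have "d (f (splice q q' n)) (splice q q' (n + 1)) \<le> ennreal \<alpha>" for n
  proof (cases "n = -1")
    case True
    have "d (f (q' (-1))) (q' (-1 + 1)) \<le> ennreal \<alpha>" using assms(2) unfolding pseudo_orbits_def by blast
    then show ?thesis using assms(3) by (simp add: splice_def True)
  qed (use assms in \<open>auto simp: pseudo_orbits_def splice_def\<close>)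
  then show ?thesis using assms by (auto simp: pseudo_orbits_def splice_def)
qed

text \<open>
  The shadowed pseudo-orbit stays near the true orbit of its initial point \<open>q 0\<close> for
  the window of time that \<open>uniform_expansive\<close> requires. So the orbits of
  \<open>z\<close> and \<open>q 0\<close> are within \<open>\<rho>\<close> of each other on this
  window, which forces \<open>z\<close> to be close to \<open>q 0\<close>. Shifting the time gives
  the same for all other positions.
\<close>

lemma shadowing_improves:
  assumes "0 < e"
  shows "\<exists>\<alpha>>0. \<forall>P q z. q \<in> pseudo_orbits P \<alpha> \<longrightarrow> shadows (3 / 4 * \<rho>) q z \<longrightarrow> shadows e q z"
proof -
  have \<rho>: "0 < \<rho>" using eps by simp
  obtain N where N: "\<And>x y. (\<forall>n. \<bar>n\<bar> \<le> int N \<longrightarrow> d (it n x) (it n y) \<le> ennreal \<rho>) \<Longrightarrow> d x y \<le> ennreal e"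
    using uniform_expansive[OF assms] by blast
  obtain \<alpha> where \<alpha>: "0 < \<alpha>" and close: "\<And>q n. \<lbrakk>\<forall>n. d (f (q n)) (q (n + 1)) \<le> ennreal \<alpha>; \<bar>n\<bar> \<le> int N\<rbrakk> \<Longrightarrow>
      d (it n (q 0)) (q n) \<le> ennreal (\<rho> / 4)"
    using pseudo_orbit_close[of "\<rho> / 4" N] \<rho> by auto
  have "d z (q 0) \<le> ennreal e" if q: "q \<in> pseudo_orbits P \<alpha>" and z: "shadows (3 / 4 * \<rho>) q z" for P q z
  proof (rule N, intro allI impI)
    fix n :: int assume n: "\<bar>n\<bar> \<le> int N"
    show "d (it n z) (it n (q 0)) \<le> ennreal \<rho>"
    proof (rule d_triangle_le)
      show "d (it n z) (q n) \<le> ennreal (3 / 4 * \<rho>)" using z by (simp add: shadows_def)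
      show "d (q n) (it n (q 0)) \<le> ennreal (\<rho> / 4)"
        using close[of q n] q n d_sym by (simp add: pseudo_orbits_def)
    qed (use \<rho> in auto)
  qed
  then have "d (it m z) (q m) \<le> ennreal e" if "q \<in> pseudo_orbits P \<alpha>" "shadows (3 / 4 * \<rho>) q z" for P q z m
    using pseudo_orbits_shift[OF that(1), of m] shadows_shift[OF that(2), of m] by fastforce
  then show ?thesis using \<alpha> by (auto simp: shadows_def)
qed

end

context expansive_product
begin

lemma small_bracket:
  assumes "0 < r"
  shows "\<exists>s>0. \<forall>x p. d x p \<le> ennreal s \<longrightarrow> d x (br x p) < ennreal r \<and> d x (br p x) < ennreal r"
proof -
  let ?D = "{(x, y). d x y < ennreal \<delta>}"
  have cont: "continuous_on ?D (\<lambda>z. br (fst z) (snd z))"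
    using continuous_br by (simp add: case_prod_unfold)
  have "continuous_on ?D (\<lambda>z. (fst z, br (fst z) (snd z)))"
    "continuous_on ?D (\<lambda>z. (snd z, br (fst z) (snd z)))"
    by (intro continuous_on_Pair continuous_on_fst continuous_on_snd continuous_on_id cont)+
  then have "open ((\<lambda>z. (fst z, br (fst z) (snd z))) -` {(x, y). d x y < ennreal r} \<inter> ?D)"
    "open ((\<lambda>z. (snd z, br (fst z) (snd z))) -` {(x, y). d x y < ennreal r} \<inter> ?D)"
    using open_d_less continuous_on_open_vimage[OF open_d_less] by blast+
  note op = this
  have pos: "0 < ennreal r" "0 < ennreal \<delta>" using assms delta_pos by auto
  obtain s1 where s1: "0 < s1" "\<And>x p. d x p \<le> ennreal s1 \<Longrightarrow> d x (br x p) < ennreal r"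
    using small_distance[OF op(1)] pos by auto
  obtain s2 where s2: "0 < s2" "\<And>x p. d p x \<le> ennreal s2 \<Longrightarrow> d x (br p x) < ennreal r"
    using small_distance[OF op(2)] pos by auto
  have "d x (br x p) < ennreal r \<and> d x (br p x) < ennreal r" if "d x p \<le> ennreal (min s1 s2)" for x p
  proof -
    have "d x p \<le> ennreal s1" "d p x \<le> ennreal s2"
      using that d_sym[of p x] by (metis ennreal_leI min.cobounded1 min.cobounded2 order_trans)+
    with s1(2) s2(2) show ?thesis by blast
  qed
  then show ?thesis using s1(1) s2(1) by (intro exI[of _ "min s1 s2"]) auto
qed

text \<open>
  The scales are chosen in the order: \<open>e\<close> small enough for brackets and
  \<open>f\<close> on sets of diameter \<open>2 * e\<close>, then \<open>\<alpha>\<close> so that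
  shadowing improves to \<open>e\<close>, then the mesh \<open>\<gamma>\<close> of the net so that
  true orbits are \<open>e\<close>-shadowed by \<open>\<alpha>\<close>-pseudo-orbits in it.
\<close>

theorem markov_cover_exists:
  assumes "0 < \<beta>"
  shows "\<exists>(P :: 'm set) T b. b < \<beta> \<and> markov_cover d f \<rho> \<epsilon> \<delta> P T b"
proof -
  obtain s1 where s1: "0 < s1" "\<And>x p. d x p \<le> ennreal s1 \<Longrightarrow>
      d x (br x p) < ennreal (\<delta> / 2) \<and> d x (br p x) < ennreal (\<delta> / 2)"
    using small_bracket[of "\<delta> / 2"] delta_pos by auto
  obtain s2 where s2: "0 < s2" "\<And>x y. d x y \<le> ennreal s2 \<Longrightarrow> d (f x) (f y) \<le> ennreal \<epsilon>"
    using uniformly_continuous[OF cont_f eps(1)] by blast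
  obtain s3 where s3: "0 < s3" "\<And>x y. d x y \<le> ennreal s3 \<Longrightarrow> d (inv f x) (inv f y) \<le> ennreal \<epsilon>"
    using uniformly_continuous[OF cont_inv_f eps(1)] by blast
  define e where "e = Min {s1, s2, s3, \<beta>, \<delta>, \<epsilon>} / 5"
  have e: "0 < e" "2 * (2 * e) \<le> s1" "2 * e \<le> s2" "2 * e \<le> s3" "2 * e < \<beta>" "2 * (2 * e) < \<delta>" "e \<le> \<epsilon>"
  proof -
    have "0 < Min {s1, s2, s3, \<beta>, \<delta>, \<epsilon>}" using s1 s2 s3 assms delta_pos eps by simp
    moreover have "Min {s1, s2, s3, \<beta>, \<delta>, \<epsilon>} \<le> t" if "t \<in> {s1, s2, s3, \<beta>, \<delta>, \<epsilon>}" for t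
      using that by (intro Min_le) auto
    ultimately have "0 < e" "5 * e \<le> s1" "5 * e \<le> s2" "5 * e \<le> s3" "5 * e \<le> \<beta>" "5 * e \<le> \<delta>" "5 * e \<le> \<epsilon>"
      by (simp_all add: e_def)
    then show "0 < e" "2 * (2 * e) \<le> s1" "2 * e \<le> s2" "2 * e \<le> s3" "2 * e < \<beta>" "2 * (2 * e) < \<delta>" "e \<le> \<epsilon>"
      by simp_all
  qed
  obtain \<alpha> where \<alpha>: "0 < \<alpha>" and
    improve: "\<And>P q z. \<lbrakk>q \<in> pseudo_orbits P \<alpha>; shadows (3 / 4 * \<rho>) q z\<rbrakk> \<Longrightarrow> shadows e q z"
    using shadowing_improves[OF e(1)] by blast
  obtain \<gamma>0 where \<gamma>0: "0 < \<gamma>0" "\<And>x y. d x y \<le> ennreal \<gamma>0 \<Longrightarrow> d (f x) (f y) \<le> ennreal (\<alpha> / 2)"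
    using uniformly_continuous[OF cont_f, of "\<alpha> / 2"] \<alpha> by auto
  define \<gamma> where "\<gamma> = Min {\<gamma>0, \<alpha> / 2, e}"
  have \<gamma>: "0 < \<gamma>" "\<gamma> \<le> \<gamma>0" "\<gamma> \<le> \<alpha> / 2" "\<gamma> \<le> e" using \<gamma>0 \<alpha> e by (auto simp: \<gamma>_def)
  obtain P where P: "finite P" "\<And>x. \<exists>p\<in>P. d x p \<le> ennreal \<gamma>"
    using finite_net[OF \<gamma>(1)] by blast
  define T where "T s = {x. \<exists>q\<in>pseudo_orbits P \<alpha>. q 0 = s \<and> shadows e q x}" for s

  have TI: "x \<in> T s" if "q \<in> pseudo_orbits P \<alpha>" "shadows e q x" "q 0 = s" for q x s
    using that by (auto simp: T_def)
  \<comment> \<open>A point on the stable set of \<open>x\<close> and the unstable set of \<open>y\<close> is within \<open>\<epsilon> + e\<close> of the glued pseudo-orbit.\<close>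
  have splice: "shadows e (splice q q') z"
    if "q \<in> pseudo_orbits P \<alpha>" "shadows e q x" "q' \<in> pseudo_orbits P \<alpha>" "shadows e q' y" "q 0 = q' 0"
      "z \<in> ws \<epsilon> x" "z \<in> wu \<epsilon> y" for q q' x y z
  proof (rule improve[OF splice_pseudo_orbits])
    have "d (it n z) (splice q q' n) \<le> ennreal (3 / 4 * \<rho>)" for n
    proof (cases "0 \<le> n")
      case True
      show ?thesis
        by (rule d_triangle_le[of _ "it n x" \<epsilon> _ e])
          (use that True eps e d_sym wsD[of z \<epsilon> x n] in \<open>auto simp: splice_def shadows_def\<close>)
    next
      case False
      show ?thesis
        by (rule d_triangle_le[of _ "it n y" \<epsilon> _ e])
          (use that False eps e d_sym wuD[of z \<epsilon> y n] in \<open>auto simp: splice_def shadows_def\<close>)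
    qed
    then show "shadows (3 / 4 * \<rho>) (splice q q') z" by (simp add: shadows_def)
  qed fact+
  have small_T: "d x y \<le> ennreal (2 * e)" if "x \<in> T k" "y \<in> T k" for x y k
  proof -
    have "d z k \<le> ennreal e" if "z \<in> T k" for z
      using that by (auto simp: T_def shadows_def dest: spec[of _ 0])
    then have "d x k \<le> ennreal e" "d k y \<le> ennreal e"
      using that d_sym by metis+
    then show ?thesis by (rule d_triangle_le) (use e in auto)
  qed
  have step: "f x \<in> T (q 1) \<and> (\<forall>y\<in>T (q 0) \<inter> ws \<epsilon> x. f y \<in> T (q 1)) \<and>
      (\<forall>v\<in>T (q 1) \<inter> wu \<epsilon> (f x). inv f v \<in> T (q 0))"
    if q: "q \<in> pseudo_orbits P \<alpha>" "shadows e q x" for q x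
  proof (intro conjI ballI; (elim IntE)?)
    let ?q1 = "\<lambda>n. q (n + 1)"
    have q1: "?q1 \<in> pseudo_orbits P \<alpha>" "shadows e ?q1 (f x)"
      using pseudo_orbits_shift[OF q(1), of 1] shadows_shift[OF q(2), of 1] by auto
    then show "f x \<in> T (q 1)" by (rule TI) simp
    fix y assume "y \<in> T (q 0)" and y: "y \<in> ws \<epsilon> x"
    then obtain q' where q': "q' \<in> pseudo_orbits P \<alpha>" "q 0 = q' 0" "shadows e q' y"
      by (auto simp: T_def)
    have "shadows e (splice q q') y"
      by (rule splice[OF q q'(1,3,2) y wu_refl])
    from shadows_shift[OF this, of 1]
    have "shadows e (\<lambda>n. splice q q' (n + 1)) (f y)" by simp
    with pseudo_orbits_shift[OF splice_pseudo_orbits[OF q(1) q'(1,2)], of 1]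
    show "f y \<in> T (q 1)" by (rule TI) (simp add: splice_def)
  next
    let ?q1 = "\<lambda>n. q (n + 1)"
    have q1: "?q1 \<in> pseudo_orbits P \<alpha>" "shadows e ?q1 (f x)"
      using pseudo_orbits_shift[OF q(1), of 1] shadows_shift[OF q(2), of 1] by auto
    fix v assume "v \<in> T (q 1)" and v: "v \<in> wu \<epsilon> (f x)"
    then obtain r where r: "r \<in> pseudo_orbits P \<alpha>" "r 0 = ?q1 0" "shadows e r v"
      by (auto simp: T_def)
    have "shadows e (splice r ?q1) v"
      by (rule splice[OF r(1,3) q1 r(2) ws_refl v])
    from shadows_shift[OF this, of "-1"]
    have "shadows e (\<lambda>n. splice r ?q1 (n + -1)) (inv f v)" by simp
    with pseudo_orbits_shift[OF splice_pseudo_orbits[OF r(1) q1(1) r(2)], of "-1"]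
    show "inv f v \<in> T (q 0)" by (rule TI) (simp add: splice_def)
  qed
  have "markov_cover d f \<rho> \<epsilon> \<delta> P T (2 * e)"
  proof
    show "finite P" by fact
    show "closed (T k)" for k
      unfolding T_def using P(1) \<alpha> e by (intro closed_shadowing_set) auto
    show "br x y \<in> T k" if k: "k \<in> P" "x \<in> T k" "y \<in> T k" for k x y
    proof -
      obtain q q' where q: "q \<in> pseudo_orbits P \<alpha>" "q 0 = k" "shadows e q x"
        and q': "q' \<in> pseudo_orbits P \<alpha>" "q' 0 = k" "shadows e q' y"
        using k by (auto simp: T_def)
      have "d x y < ennreal \<delta>"
        by (rule le_less_trans[OF small_T[OF k(2,3)]]) (use e delta_pos in \<open>auto intro!: ennreal_lessI\<close>)
      then have "shadows e (splice q q') (br x y)"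
        using q q' br_ws br_wu by (intro splice[of q x q' y]) auto
      with splice_pseudo_orbits[OF q(1) q'(1)] show ?thesis
        by (rule TI) (use q(2) q'(2) in \<open>auto simp: splice_def\<close>)
    qed
    show "\<exists>k\<in>P. x \<in> T k" for x
    proof -
      have "\<forall>n. \<exists>p. p \<in> P \<and> d (it n x) p \<le> ennreal \<gamma>" using P(2) by blast
      then obtain q where q: "\<And>n. q n \<in> P" "\<And>n. d (it n x) (q n) \<le> ennreal \<gamma>"
        by metis
      have "d (f (q n)) (q (n + 1)) \<le> ennreal \<alpha>" for n
      proof (rule d_triangle_le)
        have "d (q n) (it n x) \<le> ennreal \<gamma>0"
          using q(2)[of n] d_sym \<gamma>(2) by (metis ennreal_leI order_trans)
        from \<gamma>0(2)[OF this] show "d (f (q n)) (f (it n x)) \<le> ennreal (\<alpha> / 2)" .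
        have "f (it n x) = it (n + 1) x" using it_add[of 1 n x] by (simp add: add.commute)
        then show "d (f (it n x)) (q (n + 1)) \<le> ennreal \<gamma>" using q(2)[of "n + 1"] by simp
      qed (use \<alpha> \<gamma> in auto)
      then have "q \<in> pseudo_orbits P \<alpha>" using q by (auto simp: pseudo_orbits_def)
      moreover have "shadows e q x"
        using q(2) \<gamma>(4) by (auto simp: shadows_def intro: order_trans ennreal_leI)
      ultimately show ?thesis using q(1) unfolding T_def by blast
    qed
    show "d (br x p) (br q x) < ennreal \<delta>"
      if "d x p \<le> ennreal (2 * (2 * e))" "d q x \<le> ennreal (2 * (2 * e))" for x p q
    proof -
      have "d x p \<le> ennreal s1" "d x q \<le> ennreal s1"
        using that e(2) d_sym by (metis ennreal_leI order_trans)+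
      then have "d (br x p) x < ennreal (\<delta> / 2)" "d x (br q x) < ennreal (\<delta> / 2)"
        using s1(2) d_sym by metis+
      then have "d (br x p) x + d x (br q x) < ennreal (\<delta> / 2) + ennreal (\<delta> / 2)"
        by (rule add_strict_mono)
      also have "\<dots> = ennreal \<delta>" using delta_pos by (simp flip: ennreal_plus)
      finally show ?thesis using d_triangle by (rule le_less_trans[rotated])
    qed
    show "\<exists>j\<in>P. f x \<in> T j \<and> (\<forall>y\<in>T k \<inter> ws \<epsilon> x. f y \<in> T j) \<and> (\<forall>v\<in>T j \<inter> wu \<epsilon> (f x). inv f v \<in> T k)"
      if k: "k \<in> P" "x \<in> T k" for k x
    proof -
      obtain q where "q \<in> pseudo_orbits P \<alpha>" "q 0 = k" "shadows e q x"
        using k by (auto simp: T_def)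
      with step[of q x] show ?thesis by (intro bexI[of _ "q 1"]) (auto simp: pseudo_orbits_def)
    qed
    show "\<exists>k\<in>P. x \<in> T k \<and> (\<forall>y\<in>T k \<inter> ws \<epsilon> x. f y \<in> T j) \<and> (\<forall>v\<in>T j \<inter> wu \<epsilon> (f x). inv f v \<in> T k)"
      if j: "j \<in> P" "f x \<in> T j" for j x
    proof -
      obtain r where r: "r \<in> pseudo_orbits P \<alpha>" "r 0 = j" "shadows e r (f x)"
        using j by (auto simp: T_def)
      let ?q = "\<lambda>n. r (n + - 1)"
      have q: "?q \<in> pseudo_orbits P \<alpha>" "shadows e ?q x"
        using pseudo_orbits_shift[OF r(1), of "-1"] shadows_shift[OF r(3), of "-1"] by auto
      have "x \<in> T (?q 0)" by (rule TI[OF q]) simp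
      moreover have "?q 0 \<in> P" using q(1) by (simp only: pseudo_orbits_def mem_Collect_eq)
      ultimately show ?thesis
        using step[OF q] r(2) by (intro bexI[of _ "?q 0"]) auto
    qed
    show "d (f x) (f y) \<le> ennreal \<epsilon>" "d (inv f x) (inv f y) \<le> ennreal \<epsilon>"
      if "d x y \<le> ennreal (2 * e)" for x y
      using that e s2(2) s3(2) by (meson ennreal_leI order_trans)+
  qed (use e small_T in auto)
  then show ?thesis using e(5) by blast
qed

end

section \<open>Cells of the cover\<close>

context markov_cover
begin

definition members :: "'m \<Rightarrow> 'k set" where
  "members x = {k \<in> P. x \<in> T k}"

definition neighbours :: "'m \<Rightarrow> 'k set" where
  "neighbours x = {k \<in> P. \<exists>j\<in>members x. T j \<inter> T k \<noteq> {}}"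

text \<open>
  The coordinate conditions: the local stable set of \<open>x\<close> meets \<open>T k\<close> (in
  \<open>[x, p]\<close>), respectively the local unstable set does. The explicit bound on \<open>d
  x p\<close> keeps the bracket within the domain where it is continuous, which makes both sets
  closed.
\<close>

definition s_hits :: "'k \<Rightarrow> 'm set" where
  "s_hits k = {x. \<exists>p\<in>T k. d x p \<le> ennreal (2 * b) \<and> br x p \<in> T k}"

definition u_hits :: "'k \<Rightarrow> 'm set" where
  "u_hits k = {x. \<exists>p\<in>T k. d x p \<le> ennreal (2 * b) \<and> br p x \<in> T k}"

text \<open>
  Only rectangles in \<open>neighbours x\<close> are consulted. For these the brackets of
  \<open>x\<close> with all points of \<open>T k\<close> are defined, whereas a bound on the
  distance from \<open>x\<close> would create new boundaries that are unrelated to the dynamics.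
\<close>

definition cell_type :: "'m \<Rightarrow> 'k set \<times> 'k set \<times> 'k set" where
  "cell_type x = (members x, {k \<in> neighbours x. x \<in> s_hits k}, {k \<in> neighbours x. x \<in> u_hits k})"

lemma cell_type_eq_iff:
  "cell_type x = cell_type y \<longleftrightarrow> members x = members y \<and>
    (\<forall>k\<in>neighbours x. (x \<in> s_hits k \<longleftrightarrow> y \<in> s_hits k) \<and> (x \<in> u_hits k \<longleftrightarrow> y \<in> u_hits k))"
proof -
  have "neighbours x = neighbours y" if "members x = members y"
    using that by (simp add: neighbours_def)
  then show ?thesis unfolding cell_type_def by auto
qed

lemma near_delta:
  assumes "d x p \<le> ennreal (2 * b)"
  shows "d x p < ennreal \<delta>" "d p x < ennreal \<delta>"
proof -
  show "d x p < ennreal \<delta>"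
    by (rule le_less_trans[OF assms]) (use b in \<open>auto intro!: ennreal_lessI\<close>)
  then show "d p x < ennreal \<delta>" by (simp add: d_sym)
qed

lemma near_b: "d x p \<le> ennreal b \<Longrightarrow> d x p \<le> ennreal (2 * b)"
  using b by (auto intro: order_trans ennreal_leI)

lemma neighbours_near:
  assumes "k \<in> neighbours x" "p \<in> T k"
  shows "d x p \<le> ennreal (2 * b)"
proof -
  obtain j z where j: "j \<in> P" "x \<in> T j" "z \<in> T j" "z \<in> T k" "k \<in> P"
    using assms by (auto simp: neighbours_def members_def)
  show ?thesis
    by (rule d_triangle_le[OF small[OF j(1,2,3)] small[OF j(5,4) assms(2)]]) (use b in auto)
qed

lemma neighbours_nonempty: "k \<in> neighbours x \<Longrightarrow> \<exists>p. p \<in> T k"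
  by (auto simp: neighbours_def)

lemma members_neighbours: "k \<in> members x \<Longrightarrow> k \<in> neighbours x"
  by (auto simp: neighbours_def members_def)

text \<open>
  Independence of the witness: \<open>[[x, q], p] = [x, p]\<close>, and \<open>T k\<close> is
  closed under the bracket.
\<close>

lemma s_hits_iff:
  assumes k: "k \<in> neighbours x" and p: "p \<in> T k"
  shows "x \<in> s_hits k \<longleftrightarrow> br x p \<in> T k"
proof
  assume "x \<in> s_hits k"
  then obtain q where q: "q \<in> T k" "br x q \<in> T k" by (auto simp: s_hits_def)
  have "k \<in> P" using k by (simp add: neighbours_def)
  have xp: "d x p < ennreal \<delta>" and xq: "d x q < ennreal \<delta>"
    using near_delta neighbours_near k p q by auto
  have "d (br x q) p < ennreal \<delta>"
    using near_delta near_b small \<open>k \<in> P\<close> p q by blast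
  then have "br (br x q) p = br x p"
    using br_ws[OF xq] xp eps by (intro br_left_cong[of _ \<epsilon>]) auto
  then show "br x p \<in> T k" using br_T[OF \<open>k \<in> P\<close> q(2) p] by simp
qed (use assms neighbours_near in \<open>auto simp: s_hits_def\<close>)

lemma u_hits_iff:
  assumes k: "k \<in> neighbours x" and p: "p \<in> T k"
  shows "x \<in> u_hits k \<longleftrightarrow> br p x \<in> T k"
proof
  assume "x \<in> u_hits k"
  then obtain q where q: "q \<in> T k" "br q x \<in> T k" by (auto simp: u_hits_def)
  have "k \<in> P" using k by (simp add: neighbours_def)
  have px: "d p x < ennreal \<delta>" and qx: "d q x < ennreal \<delta>"
    using near_delta neighbours_near k p q by auto
  have "d p (br q x) < ennreal \<delta>"
    using near_delta near_b small \<open>k \<in> P\<close> p q by blast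
  then have "br p (br q x) = br p x"
    using br_wu[OF qx] px eps by (intro br_right_cong[of _ \<epsilon>]) auto
  then show "br p x \<in> T k" using br_T[OF \<open>k \<in> P\<close> p q(2)] by simp
qed (use assms neighbours_near in \<open>auto simp: u_hits_def\<close>)

text \<open>
  A point is recovered from its two coordinates: \<open>x = [[x, p], [p, x]]\<close>.
\<close>

lemma mem_T_iff:
  assumes k: "k \<in> neighbours x"
  shows "x \<in> T k \<longleftrightarrow> x \<in> s_hits k \<and> x \<in> u_hits k"
proof
  assume "x \<in> T k"
  then show "x \<in> s_hits k \<and> x \<in> u_hits k"
    using s_hits_iff u_hits_iff k by auto
next
  assume *: "x \<in> s_hits k \<and> x \<in> u_hits k"
  have "k \<in> P" using k by (simp add: neighbours_def)
  obtain p where p: "p \<in> T k" using k neighbours_nonempty by blast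
  have xp: "d x p \<le> ennreal (2 * b)" using neighbours_near k p by blast
  have "br (br x p) (br p x) = x"
    using xp near_delta small_br d_sym by (intro br_br) auto
  then show "x \<in> T k"
    using * s_hits_iff u_hits_iff k p br_T[OF \<open>k \<in> P\<close>] by metis
qed

lemma s_hits_cong:
  assumes "y \<in> ws \<epsilon> x" "k \<in> neighbours x" "k \<in> neighbours y"
  shows "x \<in> s_hits k \<longleftrightarrow> y \<in> s_hits k"
proof -
  obtain p where p: "p \<in> T k" using assms neighbours_nonempty by blast
  have "br y p = br x p"
    by (rule br_left_cong[OF assms(1)]) (use p assms neighbours_near near_delta eps in auto)
  then show ?thesis using s_hits_iff assms p by simp
qed

lemma u_hits_cong:
  assumes "y \<in> wu \<epsilon> x" "k \<in> neighbours x" "k \<in> neighbours y"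
  shows "x \<in> u_hits k \<longleftrightarrow> y \<in> u_hits k"
proof -
  obtain p where p: "p \<in> T k" using assms neighbours_nonempty by blast
  have "br p y = br p x"
    by (rule br_right_cong[OF assms(1)]) (use p assms neighbours_near near_delta eps in auto)
  then show ?thesis using u_hits_iff assms p by simp
qed

lemma cell_type_near:
  assumes "cell_type x = cell_type y"
  shows "d x y \<le> ennreal b"
proof -
  obtain j where "j \<in> P" "x \<in> T j" using cover by blast
  moreover have "y \<in> T j" using assms calculation by (auto simp: cell_type_eq_iff members_def)
  ultimately show ?thesis by (rule small)
qed

text \<open>
  The bracket \<open>z\<close> of \<open>x\<close> and \<open>y\<close> lies in every \<open>T
  j\<close> that contains both, has the stable coordinate conditions of \<open>x\<close> and the
  unstable ones of \<open>y\<close>. By \<open>mem_T_iff\<close> these conditions also exclude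
  further memberships.
\<close>

lemma cell_type_br:
  assumes xy: "cell_type x = cell_type y"
  shows "cell_type (br x y) = cell_type x"
proof -
  let ?z = "br x y"
  have m: "members x = members y" and n: "neighbours x = neighbours y"
    using xy by (auto simp: cell_type_eq_iff neighbours_def)
  have dxy: "d x y < ennreal \<delta>"
    using cell_type_near[OF xy] near_b near_delta by blast
  have zx: "?z \<in> ws \<epsilon> x" and zy: "?z \<in> wu \<epsilon> y" using br_ws br_wu dxy by auto
  have sub: "members x \<subseteq> members ?z"
    using m br_T by (fastforce simp: members_def)
  then have nsub: "neighbours x \<subseteq> neighbours ?z" by (auto simp: neighbours_def)
  have hits: "(?z \<in> s_hits k \<longleftrightarrow> x \<in> s_hits k) \<and> (?z \<in> u_hits k \<longleftrightarrow> x \<in> u_hits k)" if "k \<in> neighbours x" for k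
    using that s_hits_cong[OF zx, of k] u_hits_cong[OF zy, of k] nsub n xy
    by (auto simp: cell_type_eq_iff)
  have "members ?z \<subseteq> members x"
  proof
    fix k assume k: "k \<in> members ?z"
    obtain j where "j \<in> members x" using cover by (auto simp: members_def)
    with k sub have kx: "k \<in> neighbours x" by (auto simp: neighbours_def members_def)
    have "?z \<in> s_hits k" "?z \<in> u_hits k"
      using k mem_T_iff[OF members_neighbours[OF k]] by (auto simp: members_def)
    with hits[OF kx] have "x \<in> T k" using mem_T_iff[OF kx] by blast
    with k show "k \<in> members x" by (simp add: members_def)
  qed
  with sub have "members ?z = members x" by blast
  then show ?thesis using hits by (auto simp: cell_type_eq_iff neighbours_def)
qed

text \<open>
  The members containing \<open>f x\<close> and the conditions \<open>s_hits\<close> transfer at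
  once along the stable set. For \<open>u_hits k\<close> suppose that the unstable set of \<open>f
  x\<close> meets \<open>T k\<close> in \<open>v\<close>. Pull \<open>v\<close> back to
  \<open>z\<close> and choose a predecessor \<open>T t\<close> of \<open>T k\<close> containing
  \<open>z\<close>. It neighbours \<open>x\<close>, and the unstable set of \<open>x\<close> meets
  it in \<open>z\<close>. As \<open>y\<close> has the type of \<open>x\<close>, the unstable set
  of \<open>y\<close> meets \<open>T t\<close> in \<open>[z, y]\<close>. This point lies on the
  stable slice of \<open>T t\<close> through \<open>z\<close>, so that its image is in \<open>T
  k\<close>, and it witnesses that the unstable set of \<open>f y\<close> meets \<open>T
  k\<close>.
\<close>

lemma cell_type_f:
  assumes xy: "cell_type x = cell_type y" and y: "y \<in> ws \<epsilon> x"
  shows "cell_type (f x) = cell_type (f y)"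
proof -
  have m_sub: "members (f x) \<subseteq> members (f y)"
    if xy: "members x = members y" and y: "y \<in> ws \<epsilon> x" for x y
  proof
    fix j assume "j \<in> members (f x)"
    then have j: "j \<in> P" "f x \<in> T j" by (auto simp: members_def)
    obtain k where k: "k \<in> P" "x \<in> T k" "\<forall>y\<in>T k \<inter> ws \<epsilon> x. f y \<in> T j"
      using backward[OF j] by blast
    with xy have "y \<in> T k" by (auto simp: members_def)
    with k y j show "j \<in> members (f y)" by (auto simp: members_def)
  qed
  have mem: "members (f x) = members (f y)"
    using m_sub[of x y] m_sub[of y x] xy y ws_sym by (auto simp: cell_type_eq_iff)
  then have nb: "neighbours (f x) = neighbours (f y)" by (simp add: neighbours_def)
  have u: "f y \<in> u_hits k"
    if xy: "cell_type x = cell_type y" and y: "y \<in> ws \<epsilon> x" and mem: "members (f x) = members (f y)"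
      and k: "k \<in> neighbours (f x)" and hit: "f x \<in> u_hits k" for x y k
  proof -
    obtain j p where j: "j \<in> P" "f x \<in> T j" "p \<in> T j" "p \<in> T k" and kP: "k \<in> P"
      using k by (auto simp: neighbours_def members_def)
    have px: "d p (f x) < ennreal \<delta>" using small[OF j(1,3,2)] near_b near_delta by blast
    define v where "v = br p (f x)"
    have v: "v \<in> T k" "v \<in> T j" "v \<in> wu \<epsilon> (f x)"
      using hit u_hits_iff[OF k j(4)] br_T[OF j(1,3,2)] br_wu[OF px] by (auto simp: v_def)
    define z where "z = inv f v"
    have fz: "f z = v" by (simp add: z_def)
    obtain s where s: "s \<in> P" "x \<in> T s" "\<forall>w\<in>T j \<inter> wu \<epsilon> (f x). inv f w \<in> T s"
      using backward[OF j(1,2)] by blast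
    have zs: "z \<in> T s" using s v by (auto simp: z_def)
    have zx: "z \<in> wu \<epsilon> x" using wu_inv_f[OF v(3)] by (simp add: z_def)
    obtain t where t: "t \<in> P" "z \<in> T t" "\<forall>w\<in>T t \<inter> ws \<epsilon> z. f w \<in> T k"
      using backward[OF kP, of z] fz v by auto
    have tx: "t \<in> neighbours x" using s t zs by (auto simp: neighbours_def members_def)
    then have ty: "t \<in> neighbours y" using xy by (auto simp: cell_type_eq_iff neighbours_def)
    have "br z x = z"
      by (rule br_eq_right[OF zx]) (use small[OF s(1) zs s(2)] near_b near_delta in blast)
    then have "x \<in> u_hits t" using u_hits_iff[OF tx t(2)] t by simp
    then have "y \<in> u_hits t" using xy tx by (auto simp: cell_type_eq_iff)
    then have bt: "br z y \<in> T t" using u_hits_iff[OF ty t(2)] by simp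
    have ys: "y \<in> T s" using xy s by (auto simp: cell_type_eq_iff members_def)
    have zy: "d z y < ennreal \<delta>" using small[OF s(1) zs ys] near_b near_delta by blast
    let ?w = "br z y"
    have "?w \<in> ws \<epsilon> z" using br_ws[OF zy] .
    then have fw: "f ?w \<in> T k" using t bt by blast
    have "?w \<in> T s" using br_T[OF s(1) zs ys] .
    then have "d (f y) (f ?w) \<le> ennreal \<epsilon>" using small_f small s ys by blast
    then have "f ?w \<in> wu \<epsilon> (f y)" using wu_f br_wu[OF zy] by blast
    moreover have ky: "k \<in> neighbours (f y)" using k mem by (simp add: neighbours_def)
    moreover have "d (f ?w) (f y) < ennreal \<delta>"
      using neighbours_near[OF ky fw] near_delta by blast
    ultimately have "br (f ?w) (f y) = f ?w" using br_eq_right by blast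
    then show ?thesis using u_hits_iff[OF ky fw] fw by simp
  qed
  have "(f x \<in> u_hits k) = (f y \<in> u_hits k)" if "k \<in> neighbours (f x)" for k
    using u[OF xy y mem that] u[OF xy[symmetric] _ mem[symmetric], of k] that nb y ws_sym by blast
  moreover have "(f x \<in> s_hits k) = (f y \<in> s_hits k)" if "k \<in> neighbours (f x)" for k
    using s_hits_cong[OF ws_f[OF y]] that nb by blast
  ultimately show ?thesis using mem by (simp add: cell_type_eq_iff)
qed

lemma dual_cover: "markov_cover d (inv f) \<rho> \<epsilon> \<delta> P T b"
proof -
  interpret dual: expansive_product d "inv f" \<rho> \<epsilon> \<delta> by (rule dual)
  have ii: "inv (inv f) = f" using bij_f by (simp add: inv_inv_eq)
  show ?thesis
  proof (unfold_locales, unfold Ws_inv Wu_inv bracket_inv ii)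
    show "\<exists>j\<in>P. inv f x \<in> T j \<and> (\<forall>y\<in>T k \<inter> wu \<epsilon> x. inv f y \<in> T j) \<and>
        (\<forall>v\<in>T j \<inter> ws \<epsilon> (inv f x). f v \<in> T k)" if "k \<in> P" "x \<in> T k" for k x
      using backward[of k "inv f x"] that by auto
    show "\<exists>k\<in>P. x \<in> T k \<and> (\<forall>y\<in>T k \<inter> wu \<epsilon> x. inv f y \<in> T j) \<and>
        (\<forall>v\<in>T j \<inter> ws \<epsilon> (inv f x). f v \<in> T k)" if "j \<in> P" "inv f x \<in> T j" for j x
      using forward[of j "inv f x"] that by auto
    show "d (br p x) (br x q) < ennreal \<delta>"
      if "d x p \<le> ennreal (2 * b)" "d q x \<le> ennreal (2 * b)" for x p q
      using small_br[of x q p] that d_sym by metis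
  qed (use finite_P closed_T br_T cover small b small_f small_inv_f in auto)
qed

end

section \<open>The Markov partition\<close>

lemma interior_Union_frontier:
  assumes "finite \<F>" "\<And>F. F \<in> \<F> \<Longrightarrow> closed F"
  shows "interior (\<Union>(frontier ` \<F>)) = {}"
  using assms
proof (induction rule: finite_induct)
  case (insert F \<F>)
  have "interior (frontier F) = {}"
  proof -
    have "frontier F \<subseteq> F" using insert.prems by (simp add: frontier_subset_closed)
    then have "interior (frontier F) \<subseteq> interior F" by (rule interior_mono)
    moreover have "interior (frontier F) \<subseteq> frontier F" by (rule interior_subset)
    ultimately show ?thesis by (auto simp: frontier_def)
  qed
  moreover have "interior (\<Union>(frontier ` \<F>)) = {}" using insert by simp
  ultimately have "interior (frontier F \<union> \<Union>(frontier ` \<F>)) = {}"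
    using interior_closed_Un_empty_interior[of "frontier F" "\<Union>(frontier ` \<F>)"] by simp
  then show ?case by simp
qed simp

context markov_cover
begin

text \<open>
  The rectangles of the partition are the closures of the nonempty cores.
\<close>

definition core where "core c = interior (cell_type -` {c})"

lemma core_type: "x \<in> core c \<Longrightarrow> cell_type x = c"
  using interior_subset by (force simp: core_def)

lemma open_core: "open (core c)" by (simp add: core_def)

lemma finite_types: "finite (range cell_type)"
proof (rule finite_subset)
  show "range cell_type \<subseteq> Pow P \<times> Pow P \<times> Pow P"
    by (auto simp: cell_type_def members_def neighbours_def)
qed (use finite_P in auto)

lemma closed_s_hits:
  assumes "k \<in> P"
  shows "closed (s_hits k)"
proof -
  let ?D = "{(x, y). d x y \<le> ennreal (2 * b)}"
  have "closed ?D" using b by (intro closed_d_le) auto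
  have "continuous_on ?D (\<lambda>(x, y). br x y)"
    by (rule continuous_on_subset[OF continuous_br]) (use near_delta in auto)
  then have "closed (?D \<inter> (\<lambda>(x, y). br x y) -` T k)"
    by (rule continuous_closed_preimage[OF _ \<open>closed ?D\<close> closed_T[OF assms]])
  then have "closed (?D \<inter> (\<lambda>(x, y). br x y) -` T k \<inter> UNIV \<times> T k)"
    by (rule closed_Int[OF _ closed_Times[OF closed_UNIV closed_T[OF assms]]])
  then have "compact (?D \<inter> (\<lambda>(x, y). br x y) -` T k \<inter> UNIV \<times> T k)"
    using compact_Int_closed[OF compact_MM] by fastforce
  then have "closed (fst ` (?D \<inter> (\<lambda>(x, y). br x y) -` T k \<inter> UNIV \<times> T k))"
    by (intro compact_imp_closed compact_continuous_image continuous_on_fst continuous_on_id)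
  moreover have "fst ` (?D \<inter> (\<lambda>(x, y). br x y) -` T k \<inter> UNIV \<times> T k) = s_hits k"
    by (auto simp: s_hits_def image_iff Bex_def)
  ultimately show ?thesis by simp
qed

lemma dual_hits:
  "markov_cover.s_hits d (inv f) \<epsilon> T b = u_hits" "markov_cover.u_hits d (inv f) \<epsilon> T b = s_hits"
proof -
  interpret dual: markov_cover d "inv f" \<rho> \<epsilon> \<delta> P T b by (rule dual_cover)
  show "dual.s_hits = u_hits" "dual.u_hits = s_hits"
    by (auto simp: fun_eq_iff s_hits_def u_hits_def dual.s_hits_def dual.u_hits_def bracket_inv)
qed

lemma closed_u_hits:
  assumes "k \<in> P"
  shows "closed (u_hits k)"
proof -
  interpret dual: markov_cover d "inv f" \<rho> \<epsilon> \<delta> P T b by (rule dual_cover)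
  show ?thesis using dual.closed_s_hits[OF assms] by (simp add: dual_hits)
qed

text \<open>
  Away from the frontiers of the finitely many closed sets that define the types, the type is
  locally constant.
\<close>

lemma cores_dense: "closure (\<Union>c\<in>range cell_type. core c) = UNIV"
proof -
  define \<F> where "\<F> = T ` P \<union> s_hits ` P \<union> u_hits ` P"
  have fin: "finite \<F>" using finite_P by (simp add: \<F>_def)
  have cl: "closed F" if "F \<in> \<F>" for F
    using that closed_T closed_s_hits closed_u_hits by (auto simp: \<F>_def)
  have "x \<in> core (cell_type x)" if x: "x \<notin> \<Union>(frontier ` \<F>)" for x
    unfolding core_def
  proof (rule interiorI)
    let ?N = "\<Inter>F\<in>\<F>. if x \<in> F then interior F else - F"
    show "open ?N" using fin cl by (intro open_INT) auto
    have "x \<in> interior F" if "F \<in> \<F>" "x \<in> F" for F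
      using that x cl by (auto simp: frontier_def)
    then show "x \<in> ?N" by auto
    show "?N \<subseteq> cell_type -` {cell_type x}"
    proof
      fix y assume y: "y \<in> ?N"
      have "y \<in> F \<longleftrightarrow> x \<in> F" if "F \<in> \<F>" for F
        using INT_D[OF y that] interior_subset by (auto split: if_splits)
      then have *: "y \<in> T k \<longleftrightarrow> x \<in> T k" "y \<in> s_hits k \<longleftrightarrow> x \<in> s_hits k" "y \<in> u_hits k \<longleftrightarrow> x \<in> u_hits k"
        if "k \<in> P" for k
        using that by (auto simp: \<F>_def)
      then have "members y = members x" by (auto simp: members_def)
      then show "y \<in> cell_type -` {cell_type x}"
        using * by (auto simp: cell_type_eq_iff neighbours_def)
    qed
  qed
  then have "- \<Union>(frontier ` \<F>) \<subseteq> (\<Union>c\<in>range cell_type. core c)" by blast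
  moreover have "closure (- \<Union>(frontier ` \<F>)) = UNIV"
    using interior_Union_frontier[OF fin cl] by (simp only: closure_complement Compl_empty_eq)
  ultimately show ?thesis by (metis closure_mono top.extremum_uniqueI)
qed

lemma core_near: "\<lbrakk>x \<in> core c; y \<in> core c\<rbrakk> \<Longrightarrow> d x y \<le> ennreal b"
  using cell_type_near core_type by simp

lemma open_br_slice:
  assumes "open V"
  shows "open {w. d w x < ennreal \<delta> \<and> br w x \<in> V}" "open {w. d x w < ennreal \<delta> \<and> br x w \<in> V}"
proof -
  have op: "open ((\<lambda>(x, y). br x y) -` V \<inter> {(x, y). d x y < ennreal \<delta>})"
    using continuous_br assms continuous_on_open_vimage[OF open_d_less] by blast
  have "open ((\<lambda>w. (w, x)) -` ((\<lambda>(x, y). br x y) -` V \<inter> {(x, y). d x y < ennreal \<delta>}))"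
    "open ((\<lambda>w. (x, w)) -` ((\<lambda>(x, y). br x y) -` V \<inter> {(x, y). d x y < ennreal \<delta>}))"
    by (intro open_vimage[OF op] continuous_on_Pair continuous_on_const continuous_on_id)+
  then show "open {w. d w x < ennreal \<delta> \<and> br w x \<in> V}" "open {w. d x w < ennreal \<delta> \<and> br x w \<in> V}"
    by (simp_all add: vimage_def conj_commute)
qed

text \<open>
  A point \<open>w\<close> near \<open>z = [x, y]\<close> is the bracket of \<open>[w, x]\<close>
  and \<open>[y, w]\<close>, and these are near \<open>[z, x] = x\<close> and \<open>[y, z] =
  y\<close>. So both are in the core, and \<open>w\<close> has the same type.
\<close>

lemma core_br:
  assumes x: "x \<in> core c" and y: "y \<in> core c"
  shows "br x y \<in> core c"
proof -
  let ?z = "br x y"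
  let ?A = "{w. d w x < ennreal \<delta> \<and> br w x \<in> core c} \<inter> {w. d y w < ennreal \<delta> \<and> br y w \<in> core c}"
  have dxy: "d x y < ennreal \<delta>" using core_near[OF x y] near_b near_delta by blast
  have zt: "cell_type ?z = c" using cell_type_br[of x y] core_type x y by simp
  have zx: "d ?z x < ennreal \<delta>" and yz: "d y ?z < ennreal \<delta>"
    using cell_type_near[of ?z x] cell_type_near[of y ?z] zt core_type x y near_b near_delta by auto
  show ?thesis unfolding core_def[of c]
  proof (rule interiorI)
    show "open ?A" by (intro open_Int open_br_slice open_core)
    have "x \<in> ws \<epsilon> ?z" "y \<in> wu \<epsilon> ?z" using br_ws[OF dxy] br_wu[OF dxy] ws_sym wu_sym by blast+
    then have "br ?z x = x" "br y ?z = y" using br_eq_left br_eq_right zx yz by auto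
    then show "?z \<in> ?A" using x y zx yz by simp
    show "?A \<subseteq> cell_type -` {c}"
    proof
      fix w assume w: "w \<in> ?A"
      have t: "cell_type (br w x) = c" "cell_type (br y w) = c" using w core_type by auto
      then have dd: "d (br w x) (br y w) < ennreal \<delta>"
        using cell_type_near[of "br w x" "br y w"] near_b near_delta by simp
      have "w \<in> ws \<epsilon> (br w x)" "w \<in> wu \<epsilon> (br y w)"
        using w br_ws[of w x] br_wu[of y w] ws_sym wu_sym by blast+
      then have "br (br w x) (br y w) = w"
        using dd eps by (intro br_eqI[of _ _ _ \<epsilon> \<epsilon>]) auto
      then show "w \<in> cell_type -` {c}" using cell_type_br[of "br w x" "br y w"] t by simp
    qed
  qed
qed

lemma f_image: "f ` S = inv f -` S"
proof (intro equalityI subsetI)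
  fix y assume "y \<in> inv f -` S"
  then have "f (inv f y) \<in> f ` S" by blast
  then show "y \<in> f ` S" by simp
qed auto

text \<open>
  The pointwise Markov property gives the type of \<open>f z\<close>. It persists in a
  neighbourhood: for \<open>w\<close> near \<open>z\<close> the point \<open>[w, x]\<close> on the
  stable set of \<open>w\<close> is near \<open>x\<close>, so its image is still in the core of
  \<open>c'\<close>.
\<close>

lemma core_f:
  assumes x: "x \<in> core c" "f x \<in> core c'" and z: "z \<in> core c" "z \<in> ws \<epsilon> x"
  shows "f z \<in> core c'"
proof -
  let ?Q = "core c \<inter> f -` core c'"
  let ?A = "core c \<inter> {w. d w x < ennreal \<delta> \<and> br w x \<in> ?Q}"
  have zx: "d z x < ennreal \<delta>" using core_near[OF z(1) x(1)] near_b near_delta by blast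
  have oQ: "open ?Q" by (intro open_Int open_core open_vimage cont_f)
  show ?thesis unfolding core_def[of c']
  proof (rule interiorI)
    have "open (inv f -` ?A)"
      by (intro open_vimage cont_inv_f open_Int open_core open_br_slice(1)[OF oQ])
    then show "open (f ` ?A)" by (simp only: f_image)
    have "x \<in> ws \<epsilon> z" using z(2) by (simp add: ws_sym[of x])
    then have "br z x = x" using br_eq_left zx by simp
    then show "f z \<in> f ` ?A" by (intro imageI) (use x z zx in simp)
    show "f ` ?A \<subseteq> cell_type -` {c'}"
    proof clarify
      fix w assume w: "w \<in> core c" "d w x < ennreal \<delta>" "br w x \<in> core c" "f (br w x) \<in> core c'"
      have "cell_type (f w) = cell_type (f (br w x))"
        by (rule cell_type_f[OF _ br_ws[OF w(2)]]) (use core_type[OF w(1)] core_type[OF w(3)] in simp)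
      then show "f w \<in> cell_type -` {c'}" using core_type[OF w(4)] by simp
    qed
  qed
qed

lemma closure_core_near:
  assumes "x \<in> closure (core c)" "y \<in> closure (core c)"
  shows "d x y \<le> ennreal b"
proof -
  have "closure (core c \<times> core c) \<subseteq> {(x, y). d x y \<le> ennreal b}"
    by (rule closure_minimal[OF _ closed_d_le[OF b(1)]]) (auto intro: core_near[of _ c])
  then show ?thesis using assms by (auto simp: closure_Times)
qed

lemma continuous_br_core: "continuous_on (closure (core c) \<times> closure (core c)) (\<lambda>(x, y). br x y)"
  by (rule continuous_on_subset[OF continuous_br])
    (use closure_core_near near_b near_delta in blast)

lemma closure_core_br:
  assumes "x \<in> closure (core c)" "y \<in> closure (core c)"
  shows "br x y \<in> closure (core c)"
proof -
  have "(\<lambda>(x, y). br x y) ` closure (core c \<times> core c) \<subseteq> closure (core c)"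
  proof (rule image_closure_subset)
    show "continuous_on (closure (core c \<times> core c)) (\<lambda>(x, y). br x y)"
      by (simp add: closure_Times continuous_br_core)
    show "(\<lambda>(x, y). br x y) ` (core c \<times> core c) \<subseteq> closure (core c)"
      by (auto intro!: subsetD[OF closure_subset] core_br)
  qed simp
  then show ?thesis using assms by (auto simp: closure_Times)
qed

text \<open>
  Approximate \<open>x\<close> by points \<open>u\<close> of the core of \<open>c\<close> with
  image in the core of \<open>c'\<close>, and \<open>y\<close> by points \<open>v\<close> of the
  core of \<open>c\<close>. Then \<open>f [u, v]\<close> is in the core of \<open>c'\<close> by
  \<open>core_f\<close> and tends to \<open>f [x, y] = f y\<close>.
\<close>

lemma markov_s:
  assumes x: "x \<in> interior (closure (core c))" "f x \<in> interior (closure (core c'))"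
    and y: "y \<in> closure (core c)" "y \<in> ws \<epsilon> x"
  shows "f y \<in> closure (core c')"
proof -
  let ?Q = "core c \<inter> f -` core c'"
  have "x \<in> closure ?Q"
    unfolding closure_iff_nhds_not_empty
  proof (intro allI impI)
    fix W V assume "V \<subseteq> W" and V: "open V" "x \<in> V"
    let ?V = "V \<inter> f -` interior (closure (core c'))"
    have "open ?V" by (intro open_Int V(1) open_vimage cont_f open_interior)
    moreover have "x \<in> closure (core c)" using x(1) interior_subset by blast
    ultimately obtain u where u: "u \<in> ?V" "u \<in> core c"
      using x(2) V(2) closure_iff_nhds_not_empty[of x "core c"] by blast
    have "open (inv f -` (?V \<inter> core c))"
      by (intro open_vimage cont_inv_f open_Int open_core \<open>open ?V\<close>)
    moreover have "f u \<in> inv f -` (?V \<inter> core c)" "f u \<in> closure (core c')"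
      using u interior_subset by auto
    ultimately obtain v where "v \<in> inv f -` (?V \<inter> core c)" "v \<in> core c'"
      using closure_iff_nhds_not_empty[of "f u" "core c'"] by blast
    then have "inv f v \<in> ?Q \<inter> W" using \<open>V \<subseteq> W\<close> by auto
    then show "?Q \<inter> W \<noteq> {}" by blast
  qed
  then have xy: "(x, y) \<in> closure (?Q \<times> core c)" using y by (simp add: closure_Times)
  have sub: "closure (?Q \<times> core c) \<subseteq> closure (core c) \<times> closure (core c)"
    by (auto simp: closure_Times intro: subsetD[OF closure_mono])
  have "(\<lambda>z. f (br (fst z) (snd z))) ` closure (?Q \<times> core c) \<subseteq> closure (core c')"
  proof (rule image_closure_subset)
    show "continuous_on (closure (?Q \<times> core c)) (\<lambda>z. f (br (fst z) (snd z)))"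
      using continuous_on_subset[OF continuous_br_core sub]
      by (intro continuous_on_compose2[OF cont_f]) (auto simp: case_prod_unfold)
    show "(\<lambda>z. f (br (fst z) (snd z))) ` (?Q \<times> core c) \<subseteq> closure (core c')"
    proof clarsimp
      fix u v assume u: "u \<in> core c" "f u \<in> core c'" and v: "v \<in> core c"
      have "d u v < ennreal \<delta>" using core_near[OF u(1) v] near_b near_delta by blast
      then have "f (br u v) \<in> core c'" using core_f u core_br[OF u(1) v] br_ws by blast
      then show "f (br u v) \<in> closure (core c')" using closure_subset by blast
    qed
  qed simp
  then have "f (br x y) \<in> closure (core c')" using xy by auto
  moreover have "d x y < ennreal \<delta>"
    using closure_core_near[of x c y] x(1) y interior_subset near_b near_delta by blast
  ultimately show ?thesis using br_eq_left y by simp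
qed

text \<open>
  This is \<open>markov_s\<close> for the inverse of \<open>f\<close>; time reversal exchanges
  \<open>s_hits\<close> and \<open>u_hits\<close>, and so permutes the types without changing the
  cores.
\<close>

lemma markov_u:
  assumes x: "x \<in> interior (closure (core c))" "f x \<in> interior (closure (core c'))"
    and y: "y \<in> closure (core c')" "y \<in> wu \<epsilon> (f x)"
  shows "inv f y \<in> closure (core c)"
proof -
  interpret dual: markov_cover d "inv f" \<rho> \<epsilon> \<delta> P T b by (rule dual_cover)
  define swap where "swap = (\<lambda>(a :: 'k set, b :: 'k set, c :: 'k set). (a, c, b))"
  have "dual.cell_type z = swap (cell_type z)" for z
    by (simp add: dual.cell_type_def cell_type_def dual_hits swap_def)
  moreover have "swap p = swap q \<longleftrightarrow> p = q" for p q
    by (cases p; cases q) (auto simp: swap_def)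
  ultimately have "dual.cell_type -` {swap c} = cell_type -` {c}" for c
    by (simp only: vimage_def singleton_iff)
  then have core: "dual.core (swap c) = core c" for c
    by (simp add: core_def dual.core_def)
  show ?thesis
    using dual.markov_s[of "f x" "swap c'" "swap c" y] x y by (simp add: core Ws_inv)
qed

theorem markov_partition_exists:
  "\<exists>Q. markov_partition d f \<epsilon> \<delta> Q \<and> partition_diameter d Q \<le> ennreal b"
proof -
  define Q where "Q = {closure (core c) | c. c \<in> range cell_type \<and> core c \<noteq> {}}"
  have Q: "Q = (\<lambda>c. closure (core c)) ` {c \<in> range cell_type. core c \<noteq> {}}"
    by (auto simp: Q_def)
  have QD: "\<exists>c. R = closure (core c) \<and> core c \<noteq> {}" if "R \<in> Q" for R
    using that unfolding Q_def by blast
  have finQ: "finite Q" unfolding Q using finite_types by auto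
  have UQ: "\<Union>Q = UNIV"
  proof -
    have "closure (\<Union>c\<in>range cell_type. core c) \<subseteq> (\<Union>c\<in>range cell_type. closure (core c))"
      using finite_types closure_subset by (intro closure_minimal closed_UN) auto
    then have "UNIV \<subseteq> (\<Union>c\<in>range cell_type. closure (core c))"
      by (simp only: cores_dense)
    also have "\<dots> \<subseteq> \<Union>Q" unfolding Q using closure_empty by fastforce
    finally show ?thesis by blast
  qed
  have diam: "ediameter d R \<le> ennreal b" if R: "R \<in> Q" for R
  proof -
    obtain c where "R = closure (core c)" using QD[OF R] by blast
    then show ?thesis unfolding ediameter_def by (auto intro!: SUP_least closure_core_near[of _ c])
  qed
  have disj: "interior R \<inter> interior R' = {}" if RR': "R \<in> Q" "R' \<in> Q" "R \<noteq> R'" for R R'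
  proof (rule ccontr)
    obtain c c' where c: "R = closure (core c)" "R' = closure (core c')"
      using QD[OF RR'(1)] QD[OF RR'(2)] by blast
    assume ne: "interior R \<inter> interior R' \<noteq> {}"
    let ?O = "interior R \<inter> interior R'"
    have "?O \<inter> core c \<noteq> {}"
      using ne open_Int_closure_eq_empty[of ?O "core c"] interior_subset[of R] c by auto
    moreover have "?O \<inter> core c \<subseteq> closure (core c')" using interior_subset[of R'] c by blast
    moreover have "open (?O \<inter> core c)" by (intro open_Int open_interior open_core)
    ultimately have "?O \<inter> core c \<inter> core c' \<noteq> {}"
      using open_Int_closure_eq_empty[of "?O \<inter> core c" "core c'"] by blast
    then have "c = c'" using core_type by blast
    with RR' c show False by simp
  qed
  have "markov_partition d f \<epsilon> \<delta> Q"
    unfolding markov_partition_def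
  proof (intro conjI ballI)
    show "closed_partition Q"
      unfolding closed_partition_def using finQ UQ disj by (auto simp: Q_def)
    fix R assume R: "R \<in> Q"
    then obtain c where c: "R = closure (core c)" "core c \<noteq> {}" using QD by blast
    show "proper R"
    proof -
      have "core c \<subseteq> interior R"
        unfolding c(1) by (rule interior_maximal[OF closure_subset open_core])
      then have "R \<subseteq> closure (interior R)" using c closure_mono by blast
      moreover have "closure (interior R) \<subseteq> R" using c by (simp add: closure_minimal interior_subset)
      ultimately show ?thesis by (simp add: proper_def)
    qed
    have "ediameter d R < ennreal \<delta>"
      by (rule le_less_trans[OF diam[OF R]]) (use b in \<open>auto intro!: ennreal_lessI\<close>)
    then show "rectangle d f \<epsilon> \<delta> R"
      using c closure_core_br closure_subset by (auto simp: rectangle_def)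
    fix R' x assume R': "R' \<in> Q" and x: "x \<in> interior R \<inter> f -` interior R'"
    obtain c' where c': "R' = closure (core c')" using QD[OF R'] by blast
    show "f ` Ws_in d f \<epsilon> x R \<subseteq> Ws_in d f \<epsilon> (f x) R'"
      using markov_s[of x c c'] x c c' ws_f by (auto simp: Ws_in_def)
    show "f ` Wu_in d f \<epsilon> x R \<supseteq> Wu_in d f \<epsilon> (f x) R'"
    proof
      fix y assume "y \<in> Wu_in d f \<epsilon> (f x) R'"
      then have y: "y \<in> R'" "y \<in> wu \<epsilon> (f x)" by (auto simp: Wu_in_def)
      then have "inv f y \<in> R" using markov_u[of x c c' y] x c c' by auto
      moreover have "inv f y \<in> wu \<epsilon> x" using wu_inv_f[OF y(2)] by simp
      ultimately have "inv f y \<in> Wu_in d f \<epsilon> x R" by (simp add: Wu_in_def)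
      then show "y \<in> f ` Wu_in d f \<epsilon> x R" by (metis f_inv imageI)
    qed
  qed
  moreover have "partition_diameter d Q \<le> ennreal b"
  proof -
    have "Q \<noteq> {}" using UQ by auto
    then show ?thesis unfolding partition_diameter_def using finQ diam by (subst Max_le_iff) auto
  qed
  ultimately show ?thesis by blast
qed

end

section \<open>Existence of Markov partitions\<close>

theorem mainTheorem1:
  fixes A :: "('m::t2_space, 'e::{real_normed_vector, heine_borel}) chart set"
    and g :: "'m \<Rightarrow> 'e \<Rightarrow> 'e \<Rightarrow> real"
    and f :: "'m \<Rightarrow> 'm"
    and \<rho> \<epsilon> \<delta> \<beta> :: real
  assumes "compact (UNIV :: 'm set)"
    and "C1_atlas A"
    and "riemannian_metric A g"
    and "anosov A g f"
    and "expansivity_constant (riemannian_dist A g) f \<rho>"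
    and "0 < \<epsilon>" and "\<epsilon> < \<rho> / 4"
    and "local_product (riemannian_dist A g) f \<epsilon> \<delta>"
    and "\<beta> > 0"
  shows "\<exists>P. markov_partition (riemannian_dist A g) f \<epsilon> \<delta> P \<and>
             partition_diameter (riemannian_dist A g) P < ennreal \<beta>"
proof -
  interpret riemannian A g
    using assms(2,3) by (rule riemannian.intro)
  have f: "bij f" "continuous_on UNIV f" "continuous_on UNIV (inv f)"
    using assms(4) by (auto simp: anosov_def C1_diffeo_def C1_map_def)
  have zero: "riemannian_dist A g x y = 0 \<longleftrightarrow> x = y" for x y
  proof
    assume "x = y"
    have "riemannian_dist A g x x \<le> 0 + ennreal r" if "0 < r" for r
      using dist_g_nbhd[OF that, of x] by (auto intro: less_imp_le)
    then show "riemannian_dist A g x y = 0"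
      using ennreal_le_epsilon[of 0] \<open>x = y\<close> by fastforce
  qed (rule dist_g_eq_0)
  interpret expansive_product "riemannian_dist A g" f \<rho> \<epsilon> \<delta>
    by unfold_locales
      (use assms f zero dist_g_triangle dist_g_nbhd in \<open>auto intro: dist_g_sym\<close>)
  obtain P :: "'m set" and T b where b: "b < \<beta>" and
    cover: "markov_cover (riemannian_dist A g) f \<rho> \<epsilon> \<delta> P T b"
    using markov_cover_exists[OF \<open>\<beta> > 0\<close>] by blast
  obtain Q where "markov_partition (riemannian_dist A g) f \<epsilon> \<delta> Q"
    "partition_diameter (riemannian_dist A g) Q \<le> ennreal b"
    using markov_cover.markov_partition_exists[OF cover] by blast
  moreover have "ennreal b < ennreal \<beta>"
    using b \<open>\<beta> > 0\<close> by (intro ennreal_lessI)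
  ultimately show ?thesis by (meson le_less_trans)
qed

end
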